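(* For any complex number $z$ and any even positive integer $t$, $$\sum_{\lambda\in\mathcal{SC}}q^{|\lambda|}x^{|\mathcal{H}_t(\lambda)|}b^{\mathrm{BG}(\lambda)}\prod_{h\in\mathcal{H}_t(\lambda)}\left(1-\frac{z}{h^2}\right)^{1/2}=\left(x^{2}q^{2t};x^{2}q^{2t}\right)_\infty^{(z/t-t)/2}\left(q^{2t};q^{2t}\right)_{\infty}^{t/2}\left(-bq;q^4\right)_{\infty}\left(-q^3/b;q^4\right)_{\infty}.$$
   Context: A partition is a finite nonincreasing sequence $\lambda=(\lambda_1,\dots,\lambda_\ell)$ of positive integers (the empty partition is allowed), and $|\lambda|$ is the sum of its parts. A partition is identified with its Ferrers diagram, the set of boxes $(i,j)$ (row $i$, column $j$) with $1\le j\le\lambda_i$. The conjugate $\lambda'$ is given by $\lambda'_j=\#\{i:\lambda_i\ge j\}$; $\mathcal{SC}$ is the set of self-conjugate partitions ($\lambda=\lambda'$). The hook-length of a box $(i,j)$ is $\lambda_i-j+\lambda'_j-i+1$; $\mathcal{H}_t(\lambda)$ is the multiset of hook-lengths of $\lambda$ divisible by $t$ (cardinality and products are taken with multiplicity; empty products are $1$). The BG-rank is $\mathrm{BG}(\lambda)=\sum_{(i,j)\in\lambda}(-1)^{i+j}$. Also $(a;q)_\infty=\prod_{j\ge0}(1-aq^j)$. For each integer $h$, $(1-z/h^2)^{1/2}$ denotes a fixed square root depending only on $h$ (and $z$). A complex power $F^c$ of a formal power series $F$ with constant term $1$ means $\exp(c\log F)$. The identity is one of formal power series in $q$ whose coefficients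 are polynomials in $x,b,b^{-1}$. *)

theory Defs
  imports
    "HOL-Analysis.Analysis"
    "HOL-Computational_Algebra.Formal_Power_Series"
    "HOL-Library.Multiset"
    "HOL-Library.Poly_Mapping"
    "HOL-Library.Product_Plus"
begin

section \<open>Partitions and hook-lengths\<close>

definition is_partition :: "nat list \<Rightarrow> bool" where
  "is_partition lam \<longleftrightarrow> sorted_wrt (\<ge>) lam \<and> (\<forall>p\<in>set lam. 0 < p)"

text \<open>Rows and columns are numbered from 1; \<open>part lam i\<close> is the length of row \<open>i\<close>,
  which is 0 outside the diagram.\<close>

definition part :: "nat list \<Rightarrow> nat \<Rightarrow> nat" where
  "part lam i = (if 1 \<le> i \<and> i \<le> length lam then lam ! (i - 1) else 0)"

definition diagram :: "nat list \<Rightarrow> (nat \<times> nat) set" where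
  "diagram lam = {(i, j). 1 \<le> i \<and> i \<le> length lam \<and> 1 \<le> j \<and> j \<le> part lam i}"

definition conj_part :: "nat list \<Rightarrow> nat \<Rightarrow> nat" where
  "conj_part lam j = card {i. 1 \<le> i \<and> i \<le> length lam \<and> j \<le> part lam i}"

definition conjugate :: "nat list \<Rightarrow> nat list" where
  "conjugate lam = map (conj_part lam) [1..<Suc (part lam 1)]"

definition SC :: "nat list set" where
  "SC = {lam. is_partition lam \<and> conjugate lam = lam}"

text \<open>For a box of the diagram both differences below are nonnegative, so the truncated
  subtraction of natural numbers is harmless.\<close>

definition hook :: "nat list \<Rightarrow> nat \<times> nat \<Rightarrow> nat" where
  "hook lam = (\<lambda>(i, j). (part lam i - j) + (conj_part lam j - i) + 1)"

definition hooks_dvd :: "nat \<Rightarrow> nat list \<Rightarrow> nat multiset" where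
  "hooks_dvd t lam = filter_mset (\<lambda>h. t dvd h) (image_mset (hook lam) (mset_set (diagram lam)))"

definition BG :: "nat list \<Rightarrow> int" where
  "BG lam = (\<Sum>(i, j)\<in>diagram lam. (-1) ^ (i + j))"

section \<open>The coefficient ring and formal power series\<close>

text \<open>The monoid algebra of \<open>nat \<times> int\<close> over the complex numbers is the ring
  \<open>C[x, b, 1/b]\<close>: the key \<open>(m, k)\<close> stands for the monomial \<open>x ^ m * b ^ k\<close>.\<close>

type_synonym coeff_ring = "(nat \<times> int) \<Rightarrow>\<^sub>0 complex"

definition scalar :: "complex \<Rightarrow> coeff_ring" where
  "scalar c = Poly_Mapping.single (0, 0) c"

definition x_var :: coeff_ring where
  "x_var = Poly_Mapping.single (1, 0) 1"

definition b_pow :: "int \<Rightarrow> coeff_ring" where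
  "b_pow k = Poly_Mapping.single (0, k) 1"

definition lift_fps :: "complex fps \<Rightarrow> coeff_ring fps" where
  "lift_fps F = Abs_fps (\<lambda>n. scalar (fps_nth F n))"

text \<open>The power \<open>exp (c * log F)\<close> for \<open>F\<close> with constant term 1; here \<open>fps_ln 1\<close> is the
  series of \<open>log (1 + X)\<close>.\<close>

definition fps_cpow :: "coeff_ring fps \<Rightarrow> complex \<Rightarrow> coeff_ring fps" where
  "fps_cpow F c =
     lift_fps (fps_exp 1) oo (fps_const (scalar c) * (lift_fps (fps_ln 1) oo (F - 1)))"

text \<open>The infinite product is taken in the topology of the library on formal power series,
  where convergence means that each coefficient is eventually constant.\<close>

definition qpoch_inf :: "coeff_ring fps \<Rightarrow> coeff_ring fps \<Rightarrow> coeff_ring fps" where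
  "qpoch_inf a q = prodinf (\<lambda>j. 1 - a * q ^ j)"

end

(* Encode a partition by its Maya diagram {lam_i - i} in Z: the hook-lengths are the differences
   x - y with x in the set, y outside and y < x.  A self-conjugate partition is a diagram symmetric
   under y -> -1 - y, and for t = 2 u its residue classes mod t form u reflected pairs r, t - 1 - r.
   One class of each pair is an arbitrary Maya diagram and determines the other, so the hook-lengths
   divisible by t occur in pairs (which removes the square roots) and the generating function is a
   product over r < u.  A Maya diagram is a charge together with a diagram of charge 0, so each
   factor is a theta series times the Nekrasov-Okounkov series
     K_c = Sum_M q^(number of hooks) Prod_h (1 - c / h^2) = (q; q)^(c - 1).
   The product of the theta series is found from the case z = 0, x = 1, where the sum over diagonal
   hooks is evident.

   For K_c write c = m^2.  By Cauchy's determinant the weight of a diagram is a principal minor of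
   the product of the triangular Toeplitz matrices of (1 - X)^(-m) and (1 - 1/X)^m, so K_c is a
   trace on an exterior power.  The derivative in m inserts shift operators; a shift commutes with the
   matrix up to a finite rank term that acts on the minors as the scalar -m, and moving it around the
   trace yields dK/dm = 2 m log((q; q)) K.  As K = 1 for m = 1, where every nonempty diagram has a
   hook of length 1, the formula follows. *)

theory Submission
  imports "Jordan_Normal_Form.Determinant" Defs
begin

section \<open>Determinants indexed by natural numbers\<close>

text \<open>Traces are taken on the exterior power of degree \<open>N\<close> over the positions
  \<open>0, 1, 2, ...\<close>, which keeps all sums finite. Energies are measured from the ground
  state \<open>tri N\<close>, and only those up to \<open>tri N + N\<close> are used. In this range
  the finite rank term is under control: an injective tuple of energy \<open>tri N + n - k\<close>
  with \<open>n \<le> N\<close> contains all positions below \<open>k\<close>, so the kernel columns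
  that span the commutator are already present in the minor. The same bound makes
  \<open>N\<close>-element sets of naturals exhaust the Maya diagrams of a fixed charge with
  \<open>n\<close> inversions. The scalar \<open>- m\<close> is a coefficient of the logarithmic
  derivative of \<open>(1 - X) powr m\<close>. Transposing the kernel exchanges \<open>m\<close> and
  \<open>- m\<close>; hence traces are even in \<open>m\<close>, and the row shifts and the column
  shifts in the derivative contribute equally, which is the factor 2 in \<open>2 m\<close>. Cauchy's
  formula has the denominators \<open>m + x - y\<close>, so it is applied off the integers, and
  continuity in \<open>m\<close> supplies the rest. The theta series involve neither
  \<open>z\<close> nor \<open>x\<close>; one specialization therefore determines their product
  without evaluating any of them.\<close>

definition fdet :: "nat \<Rightarrow> (nat \<Rightarrow> nat \<Rightarrow> 'a::comm_ring_1) \<Rightarrow> 'a" where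
  "fdet N f = Determinant.det (Matrix.mat N N (\<lambda>(i, j). f i j))"

definition fcof :: "nat \<Rightarrow> (nat \<Rightarrow> nat \<Rightarrow> 'a::comm_ring_1) \<Rightarrow> nat \<Rightarrow> nat \<Rightarrow> 'a" where
  "fcof N f i j = cofactor (Matrix.mat N N (\<lambda>(i, j). f i j)) i j"

lemma fdet_cong:
  assumes "\<And>i j. i < N \<Longrightarrow> j < N \<Longrightarrow> f i j = g i j"
  shows "fdet N f = fdet N g"
  unfolding fdet_def using assms by (intro arg_cong[where f = Determinant.det]) (auto intro!: eq_matI)

lemma fdet_leibniz:
  "fdet N f = (\<Sum>p | p permutes {0..<N}. of_int (sign p) * (\<Prod>i = 0..<N. f i (p i)))"
proof -
  have "i < N \<Longrightarrow> p permutes {0..<N} \<Longrightarrow> p i < N" for p i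
    using permutes_in_image[of p "{0..<N}" i] by auto
  then show ?thesis
    unfolding fdet_def Determinant.det_def
    by (auto intro!: sum.cong prod.cong)
qed

lemma fdet_transpose: "fdet N (\<lambda>i j. f j i) = fdet N f"
proof -
  have "Matrix.mat N N (\<lambda>(i, j). f j i) = transpose_mat (Matrix.mat N N (\<lambda>(i, j). f i j))"
    by (auto intro!: eq_matI)
  then show ?thesis
    unfolding fdet_def by (metis mat_carrier Determinant.det_transpose)
qed

lemma fdet_rows_eq:
  assumes "i \<noteq> i'" "i < N" "i' < N" "\<And>j. j < N \<Longrightarrow> f i j = f i' j"
  shows "fdet N f = 0"
  unfolding fdet_def
  by (rule Determinant.det_identical_rows[OF _ assms(1-3)])
     (use assms in \<open>auto intro!: eq_vecI\<close>)

lemma fdet_cols_eq: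
  assumes "j \<noteq> j'" "j < N" "j' < N" "\<And>i. i < N \<Longrightarrow> f i j = f i j'"
  shows "fdet N f = 0"
  by (subst fdet_transpose[symmetric], rule fdet_rows_eq[OF assms(1-3)]) (rule assms(4))

lemma fdet_col_expand:
  assumes "c < N"
  shows "fdet N (\<lambda>i j. if j = c then v i else f i j) = (\<Sum>i<N. v i * fcof N f i c)"
proof -
  have *: "mat_delete (Matrix.mat N N (\<lambda>(i, j). if j = c then v i else f i j)) i c
    = mat_delete (Matrix.mat N N (\<lambda>(i, j). f i j)) i c" if "i < N" for i
    using that assms by (intro eq_matI) (auto simp: mat_delete_def)
  show ?thesis
    unfolding fdet_def fcof_def
    by (subst Determinant.laplace_expansion_column[where j = c and n = N])
       (use assms * in \<open>auto simp: Determinant.cofactor_def intro!: sum.cong\<close>)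
qed

lemma fdet_row_expand:
  assumes "r < N"
  shows "fdet N (\<lambda>i j. if i = r then v j else f i j) = (\<Sum>j<N. v j * fcof N f r j)"
proof -
  have *: "mat_delete (Matrix.mat N N (\<lambda>(i, j). if i = r then v j else f i j)) r j
    = mat_delete (Matrix.mat N N (\<lambda>(i, j). f i j)) r j" if "j < N" for j
    using that assms by (intro eq_matI) (auto simp: mat_delete_def)
  show ?thesis
    unfolding fdet_def fcof_def
    by (subst Determinant.laplace_expansion_row[where i = r and n = N])
       (use assms * in \<open>auto simp: Determinant.cofactor_def intro!: sum.cong\<close>)
qed

text \<open>Expanding along the replaced line, both sides become the sum of \<open>B i j\<close>
  times the cofactor of \<open>f\<close> at \<open>(i, j)\<close>. This is what trades a shift of
  columns for a shift of rows.\<close>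

lemma fdet_replace_rows_cols:
  "(\<Sum>r<N. fdet N (\<lambda>i j. if i = r then B i j else f i j))
   = (\<Sum>c<N. fdet N (\<lambda>i j. if j = c then B i j else f i j))"
proof -
  have r: "fdet N (\<lambda>i j. if i = r then B i j else f i j) = (\<Sum>j<N. B r j * fcof N f r j)"
    if "r < N" for r
    using fdet_row_expand[OF that, of "B r" f] by (simp cong: if_cong)
  have c: "fdet N (\<lambda>i j. if j = c then B i j else f i j) = (\<Sum>i<N. B i c * fcof N f i c)"
    if "c < N" for c
    using fdet_col_expand[OF that, of "\<lambda>i. B i c" f] by (simp cong: if_cong)
  have "(\<Sum>r<N. \<Sum>j<N. B r j * fcof N f r j) = (\<Sum>c<N. \<Sum>i<N. B i c * fcof N f i c)"
    by (rule sum.swap)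
  then show ?thesis using r c by simp
qed

lemma fdet_col_sum:
  assumes "c < N"
  shows "fdet N (\<lambda>i j. if j = c then \<Sum>s\<in>S. w s * v s i else f i j)
       = (\<Sum>s\<in>S. w s * fdet N (\<lambda>i j. if j = c then v s i else f i j))"
  unfolding fdet_col_expand[OF assms] sum_distrib_left sum_distrib_right mult.assoc
  by (rule sum.swap)

lemma fdet_col_add:
  assumes "c < N"
  shows "fdet N (\<lambda>i j. if j = c then v i + w i else f i j)
       = fdet N (\<lambda>i j. if j = c then v i else f i j) + fdet N (\<lambda>i j. if j = c then w i else f i j)"
  unfolding fdet_col_expand[OF assms] by (simp add: sum.distrib distrib_right)

lemma fdet_scale:
  "fdet N (\<lambda>i j. u i * v j * f i j) = (\<Prod>i<N. u i) * (\<Prod>j<N. v j) * fdet N f"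
proof -
  have "(\<Prod>i = 0..<N. u i * v (p i) * f i (p i))
      = (\<Prod>i<N. u i) * (\<Prod>j<N. v j) * (\<Prod>i = 0..<N. f i (p i))" if "p permutes {0..<N}" for p
    using prod.permute[OF that, of v] by (simp add: prod.distrib lessThan_atLeast0 o_def)
  then show ?thesis
    unfolding fdet_leibniz by (simp add: sum_distrib_left mult_ac)
qed

lemma has_field_derivative_fdet:
  fixes f :: "'a::real_normed_field \<Rightarrow> nat \<Rightarrow> nat \<Rightarrow> 'a"
  assumes "\<And>i j. i < N \<Longrightarrow> j < N \<Longrightarrow> ((\<lambda>m. f m i j) has_field_derivative f' i j) (at m)"
  shows "((\<lambda>m. fdet N (f m)) has_field_derivative
          (\<Sum>r<N. fdet N (\<lambda>i j. if i = r then f' i j else f m i j))) (at m)"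
proof -
  have mem: "i < N \<Longrightarrow> p permutes {0..<N} \<Longrightarrow> p i < N" for p i
    using permutes_in_image[of p "{0..<N}" i] by auto
  have *: "((\<lambda>m. fdet N (f m)) has_field_derivative
     (\<Sum>p | p permutes {0..<N}. of_int (sign p) *
        (\<Sum>r = 0..<N. f' r (p r) * (\<Prod>i \<in> {0..<N} - {r}. f m i (p i))))) (at m)"
    unfolding fdet_leibniz
  proof (rule DERIV_sum)
    fix p assume "p \<in> {p. p permutes {0..<N}}"
    then have "p permutes {0..<N}" by simp
    then have "((\<lambda>m. \<Prod>i = 0..<N. f m i (p i)) has_field_derivative
        (\<Sum>r = 0..<N. f' r (p r) * (\<Prod>i \<in> {0..<N} - {r}. f m i (p i)))) (at m)"
      by (intro has_field_derivative_prod assms) (simp_all add: mem)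
    then show "((\<lambda>m. of_int (sign p) * (\<Prod>i = 0..<N. f m i (p i))) has_field_derivative
        of_int (sign p) * (\<Sum>r = 0..<N. f' r (p r) * (\<Prod>i \<in> {0..<N} - {r}. f m i (p i)))) (at m)"
      by (rule DERIV_cmult)
  qed
  have **: "(\<Prod>i = 0..<N. if i = r then f' i (p i) else f m i (p i))
     = f' r (p r) * (\<Prod>i \<in> {0..<N} - {r}. f m i (p i))" if "r < N" for r p
    using that by (subst prod.remove[of _ r]) (auto intro!: prod.cong)
  have "(\<Sum>p | p permutes {0..<N}. of_int (sign p) *
        (\<Sum>r = 0..<N. f' r (p r) * (\<Prod>i \<in> {0..<N} - {r}. f m i (p i))))
     = (\<Sum>r<N. fdet N (\<lambda>i j. if i = r then f' i j else f m i j))"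
    unfolding fdet_leibniz lessThan_atLeast0 sum_distrib_left
    by (subst sum.swap) (intro sum.cong refl arg_cong[where f = "\<lambda>x. _ * x"] **[symmetric], simp)
  with * show ?thesis by simp
qed

section \<open>Elimination and Cauchy's determinant\<close>

text \<open>Elimination of the last column, written as a factorization \<open>A * B\<close> with
  \<open>A\<close> unit upper triangular and the last column of \<open>B\<close> zero above the
  corner.\<close>

lemma fdet_schur:
  fixes f :: "nat \<Rightarrow> nat \<Rightarrow> 'a::field"
  assumes "f N N \<noteq> 0"
  shows "fdet (Suc N) f = f N N * fdet N (\<lambda>i j. f i j - f i N * f N j / f N N)"
proof -
  define A where "A = Matrix.mat (Suc N) (Suc N)
    (\<lambda>(i, j). if i = j then 1 else if j = N then f i N / f N N else 0)"
  define B where "B = Matrix.mat (Suc N) (Suc N)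
    (\<lambda>(i, j). if i = N then f N j else f i j - f i N * f N j / f N N)"
  have carr: "A \<in> carrier_mat (Suc N) (Suc N)" "B \<in> carrier_mat (Suc N) (Suc N)"
    by (auto simp: A_def B_def)
  have "Matrix.mat (Suc N) (Suc N) (\<lambda>(i, j). f i j) = A * B"
  proof (rule eq_matI)
    fix i j assume "i < dim_row (A * B)" "j < dim_col (A * B)"
    then have ij: "i < Suc N" "j < Suc N" using carr by auto
    have "(A * B) $$ (i, j) = (\<Sum>k<Suc N. A $$ (i, k) * B $$ (k, j))"
      using ij carr by (auto simp: scalar_prod_def lessThan_atLeast0)
    also have "\<dots> = (\<Sum>k\<in>{i, N}. A $$ (i, k) * B $$ (k, j))"
      using ij by (intro sum.mono_neutral_right) (auto simp: A_def)
    also have "\<dots> = f i j"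
      using ij assms by (cases "i = N") (auto simp: A_def B_def)
    finally show "Matrix.mat (Suc N) (Suc N) (\<lambda>(i, j). f i j) $$ (i, j) = (A * B) $$ (i, j)"
      using ij by simp
  qed (use carr in auto)
  then have "fdet (Suc N) f = Determinant.det A * Determinant.det B"
    using carr by (simp add: fdet_def Determinant.det_mult)
  moreover have "Determinant.det A = 1"
    by (subst Determinant.det_upper_triangular[OF _ carr(1)])
       (simp_all add: A_def upper_triangular_def prod_list_diag_prod)
  moreover have "Determinant.det B = f N N * fdet N (\<lambda>i j. f i j - f i N * f N j / f N N)"
  proof -
    have "mat_delete B N N = Matrix.mat N N (\<lambda>(i, j). f i j - f i N * f N j / f N N)"
      by (intro eq_matI) (auto simp: mat_delete_def B_def)
    then have cof: "cofactor B N N = fdet N (\<lambda>i j. f i j - f i N * f N j / f N N)"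
      by (simp add: Determinant.cofactor_def fdet_def)
    have "Determinant.det B = (\<Sum>i<Suc N. B $$ (i, N) * cofactor B i N)"
      using carr(2) by (intro Determinant.laplace_expansion_column) auto
    also have "\<dots> = (\<Sum>i\<in>{N}. B $$ (i, N) * cofactor B i N)"
      using assms by (intro sum.mono_neutral_right) (auto simp: B_def)
    finally show ?thesis using cof by (simp add: B_def)
  qed
  ultimately show ?thesis by simp
qed

text \<open>The Schur complement of the corner is again a Cauchy matrix, with row \<open>i\<close>
  scaled by \<open>?u i\<close> and column \<open>j\<close> by \<open>?v j\<close>. The product is
  grouped by pairs \<open>j < i\<close> because the pairs turn into gap factors later.\<close>

lemma cauchy_det:
  fixes a b :: "nat \<Rightarrow> 'a::field"
  assumes "\<And>i j. i < N \<Longrightarrow> j < N \<Longrightarrow> a i \<noteq> b j"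
  shows "fdet N (\<lambda>i j. 1 / (a i - b j)) =
         (\<Prod>i<N. 1 / (a i - b i)) *
         (\<Prod>i<N. \<Prod>j<i. (a i - a j) * (b j - b i) / ((a i - b j) * (a j - b i)))"
  using assms
proof (induction N)
  case 0
  show ?case by (simp add: fdet_def)
next
  case (Suc N)
  have nz: "a i - b j \<noteq> 0" if "i \<le> N" "j \<le> N" for i j
    using Suc.prems[of i j] that by simp
  let ?u = "\<lambda>i. (a N - a i) / (a i - b N)" and ?v = "\<lambda>j. (b j - b N) / (a N - b j)"
  have "fdet (Suc N) (\<lambda>i j. 1 / (a i - b j)) = 1 / (a N - b N) *
     fdet N (\<lambda>i j. 1 / (a i - b j) - 1 / (a i - b N) * (1 / (a N - b j)) / (1 / (a N - b N)))"
    using nz[of N N] by (subst fdet_schur) auto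
  also have "fdet N (\<lambda>i j. 1 / (a i - b j) - 1 / (a i - b N) * (1 / (a N - b j)) / (1 / (a N - b N)))
     = fdet N (\<lambda>i j. ?u i * ?v j * (1 / (a i - b j)))"
  proof (rule fdet_cong)
    fix i j assume "i < N" "j < N"
    then have "a i - b j \<noteq> 0" "a i - b N \<noteq> 0" "a N - b j \<noteq> 0" "a N - b N \<noteq> 0"
      using nz by auto
    then show "1 / (a i - b j) - 1 / (a i - b N) * (1 / (a N - b j)) / (1 / (a N - b N))
      = ?u i * ?v j * (1 / (a i - b j))"
      by (simp add: divide_simps) (simp add: algebra_simps)
  qed
  also have "\<dots> = (\<Prod>i<N. ?u i) * (\<Prod>j<N. ?v j) * fdet N (\<lambda>i j. 1 / (a i - b j))"
    by (rule fdet_scale)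
  also have "(\<Prod>i<N. ?u i) * (\<Prod>j<N. ?v j)
     = (\<Prod>j<N. (a N - a j) * (b j - b N) / ((a N - b j) * (a j - b N)))"
    by (simp add: prod.distrib[symmetric] mult_ac)
  finally show ?case using Suc by (simp add: mult_ac)
qed

section \<open>A kernel interpolating between powers of the shift\<close>

text \<open>\<open>neg_binom m\<close> is the coefficient sequence of \<open>(1 - X) powr (- m)\<close>, and \<open>kernel m\<close> the product of
  the lower triangular Toeplitz matrix of this series with the upper triangular one for \<open>- m\<close>.\<close>

definition neg_binom :: "complex \<Rightarrow> nat \<Rightarrow> complex" where
  "neg_binom m d = pochhammer m d / fact d"

definition toeplitz :: "complex \<Rightarrow> nat \<Rightarrow> nat \<Rightarrow> complex" where
  "toeplitz m x s = (if s \<le> x then neg_binom m (x - s) else 0)"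

definition kernel :: "complex \<Rightarrow> nat \<Rightarrow> nat \<Rightarrow> complex" where
  "kernel m x y = (\<Sum>s\<le>y. toeplitz m x s * neg_binom (- m) (y - s))"

lemma neg_binom_0 [simp]: "neg_binom m 0 = 1"
  by (simp add: neg_binom_def)

lemma neg_binom_Suc: "of_nat (Suc d) * neg_binom m (Suc d) = (m + of_nat d) * neg_binom m d"
  by (simp add: neg_binom_def pochhammer_Suc divide_simps del: of_nat_Suc)

text \<open>The differential equation of \<open>(1 - X) powr (- m)\<close>; it stands in for the
  power itself in the identities below.\<close>

lemma neg_binom_deriv_fps: "(1 - fps_X) * fps_deriv (Abs_fps (neg_binom m)) = fps_const m * Abs_fps (neg_binom m)"
proof (rule fps_ext)
  fix n
  show "fps_nth ((1 - fps_X) * fps_deriv (Abs_fps (neg_binom m))) n = fps_nth (fps_const m * Abs_fps (neg_binom m)) n"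
    using neg_binom_Suc[of n m]
    by (cases n) (auto simp: algebra_simps)
qed

lemma neg_binom_mult_inverse: "Abs_fps (neg_binom m) * Abs_fps (neg_binom (- m)) = 1"
proof -
  let ?A = "Abs_fps (neg_binom m)" and ?B = "Abs_fps (neg_binom (- m))"
  have "(1 - fps_X) * fps_deriv (?A * ?B)
      = ((1 - fps_X) * fps_deriv ?A) * ?B + ?A * ((1 - fps_X) * fps_deriv ?B)"
    by (simp add: algebra_simps)
  also have "\<dots> = 0"
    unfolding neg_binom_deriv_fps by (simp add: algebra_simps flip: fps_const_neg)
  finally have "fps_deriv (?A * ?B) = 0"
    by (metis mult_eq_0_iff fps_X_neq_one right_minus_eq)
  then have "?A * ?B = fps_const (fps_nth (?A * ?B) 0)"
    using fps_deriv_eq_0_iff by blast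
  then show ?thesis by simp
qed

text \<open>With \<open>A\<close>, \<open>B\<close> the series for \<open>m\<close>,
  \<open>- m\<close> and \<open>A B = 1\<close>, the sum is a coefficient of
  \<open>X B' A = X B' / B = - m X / (1 - X)\<close>, whose coefficients from degree 1 on are all
  \<open>- m\<close>.\<close>

lemma neg_binom_convolution:
  assumes "k \<ge> 1"
  shows "(\<Sum>d\<le>k. of_nat (k - d) * neg_binom (- m) (k - d) * neg_binom m d) = - m"
proof -
  let ?A = "Abs_fps (neg_binom m)" and ?B = "Abs_fps (neg_binom (- m))"
  define C where "C = fps_X * fps_deriv ?B * ?A"
  have "(1 - fps_X) * C = fps_X * ((1 - fps_X) * fps_deriv ?B) * ?A"
    by (simp add: C_def mult_ac)
  also have "\<dots> = fps_const (- m) * fps_X * (?A * ?B)"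
    unfolding neg_binom_deriv_fps by (simp add: mult_ac)
  finally have C: "(1 - fps_X) * C = fps_const (- m) * fps_X"
    by (simp add: neg_binom_mult_inverse)
  have "fps_nth C (Suc n) = - m" for n
  proof (induction n)
    case 0
    have "fps_nth ((1 - fps_X) * C) 1 = - m" unfolding C by simp
    moreover have "fps_nth C 0 = 0" by (simp add: C_def)
    ultimately show ?case by (simp add: algebra_simps)
  next
    case (Suc n)
    have "fps_nth ((1 - fps_X) * C) (Suc (Suc n)) = 0" unfolding C by simp
    then show ?case using Suc by (simp add: algebra_simps eq_neg_iff_add_eq_0)
  qed
  moreover have "fps_nth C k = (\<Sum>d\<le>k. of_nat (k - d) * neg_binom (- m) (k - d) * neg_binom m d)"
  proof -
    have *: "fps_nth (fps_X * fps_deriv ?B) n = of_nat n * neg_binom (- m) n" for n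
      by (cases n) auto
    have "C = ?A * (fps_X * fps_deriv ?B)" by (simp only: C_def mult_ac)
    then have "fps_nth C k = (\<Sum>d=0..k. neg_binom m d * fps_nth (fps_X * fps_deriv ?B) (k - d))"
      by (simp only: fps_mult_nth fps_nth_Abs_fps)
    then show ?thesis by (simp only: * atLeast0AtMost mult_ac)
  qed
  ultimately show ?thesis using assms by (cases k) auto
qed

text \<open>Differentiating \<open>(1 - X) powr (- m)\<close> in \<open>m\<close> multiplies it by
  \<open>- log (1 - X)\<close>, the series \<open>G\<close>.\<close>

lemma neg_binom_has_derivative:
  "((\<lambda>m. neg_binom m d) has_field_derivative (\<Sum>k=1..d. neg_binom m (d - k) / of_nat k)) (at m)"
proof -
  \<comment> \<open>The constant coefficient is \<open>1 / 0 = 0\<close>, as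
    \<open>- log (1 - X)\<close> requires.\<close>
  define G :: "complex fps" where "G = Abs_fps (\<lambda>k. 1 / of_nat k)"
  define F where "F = G * Abs_fps (neg_binom m)"
  have G: "(1 - fps_X) * fps_deriv G = 1"
  proof (rule fps_ext)
    fix n show "fps_nth ((1 - fps_X) * fps_deriv G) n = fps_nth 1 n"
      by (cases n) (auto simp: G_def algebra_simps simp del: of_nat_Suc)
  qed
  have "(1 - fps_X) * fps_deriv F
      = ((1 - fps_X) * fps_deriv G) * Abs_fps (neg_binom m) + G * ((1 - fps_X) * fps_deriv (Abs_fps (neg_binom m)))"
    by (simp add: F_def algebra_simps)
  also have "\<dots> = Abs_fps (neg_binom m) + fps_const m * F"
    unfolding G neg_binom_deriv_fps by (simp add: F_def mult_ac)
  finally have F: "(1 - fps_X) * fps_deriv F = Abs_fps (neg_binom m) + fps_const m * F" .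
  \<comment> \<open>This is the recursion obtained by differentiating \<open>neg_binom_Suc\<close>
    in \<open>m\<close>, so induction identifies the derivatives with the coefficients of
    \<open>F\<close>.\<close>
  have F_Suc: "of_nat (Suc n) * fps_nth F (Suc n) = (m + of_nat n) * fps_nth F n + neg_binom m n" for n
    using arg_cong[OF F, of "\<lambda>H. fps_nth H n"]
    by (cases n) (auto simp: algebra_simps)
  have "((\<lambda>m. neg_binom m d) has_field_derivative fps_nth F d) (at m)"
  proof (induction d)
    case 0
    show ?case by (simp add: F_def G_def)
  next
    case (Suc d)
    have eq: "neg_binom m' (Suc d) = (m' + of_nat d) * neg_binom m' d / of_nat (Suc d)" for m'
      using neg_binom_Suc[of d m'] by (simp add: field_simps del: of_nat_Suc)
    have "((\<lambda>m. (m + of_nat d) * neg_binom m d / of_nat (Suc d)) has_field_derivative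
       (neg_binom m d + fps_nth F d * (m + of_nat d)) / of_nat (Suc d)) (at m)"
      by (auto intro!: derivative_eq_intros Suc DERIV_cdivide simp del: of_nat_Suc)
    moreover have "(neg_binom m d + fps_nth F d * (m + of_nat d)) / of_nat (Suc d) = fps_nth F (Suc d)"
      using F_Suc[of d] by (simp add: field_simps del: of_nat_Suc)
    ultimately show ?case by (simp add: eq del: of_nat_Suc)
  qed
  moreover have "fps_nth F d = (\<Sum>k=1..d. neg_binom m (d - k) / of_nat k)"
    unfolding F_def G_def fps_mult_nth
    by (simp add: sum.atLeast_Suc_atMost)
  ultimately show ?thesis by simp
qed

lemma toeplitz_shift: "toeplitz m x (s + k) = (if k \<le> x then toeplitz m (x - k) s else 0)"
  by (auto simp: toeplitz_def add.commute)

lemma toeplitz_has_derivative: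
  "((\<lambda>m. toeplitz m x s) has_field_derivative (\<Sum>k=1..x. toeplitz m (x - k) s / of_nat k)) (at m)"
proof (cases "s \<le> x")
  case True
  have "(\<Sum>k=1..x. toeplitz m (x - k) s / of_nat k) = (\<Sum>k=1..x-s. toeplitz m (x - k) s / of_nat k)"
    by (rule sum.mono_neutral_right) (auto simp: toeplitz_def)
  also have "\<dots> = (\<Sum>k=1..x-s. neg_binom m (x - s - k) / of_nat k)"
    by (rule sum.cong) (auto simp: toeplitz_def add.commute)
  finally show ?thesis
    using True neg_binom_has_derivative[of "x - s" m] by (simp add: toeplitz_def)
next
  case False
  then have "(\<Sum>k=1..x. toeplitz m (x - k) s / of_nat k) = 0"
    by (intro sum.neutral) (auto simp: toeplitz_def)
  then show ?thesis using False by (simp add: toeplitz_def)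
qed

text \<open>Terms beyond \<open>min x y\<close> vanish, so the upper limit is free: one limit can
  serve many entries, and the symmetry between \<open>(m, x)\<close> and \<open>(- m, y)\<close>
  becomes visible.\<close>

lemma kernel_eq_sum:
  assumes "min x y \<le> K"
  shows "kernel m x y = (\<Sum>s\<le>K. toeplitz m x s * toeplitz (- m) y s)"
proof -
  have "kernel m x y = (\<Sum>s\<le>y. toeplitz m x s * toeplitz (- m) y s)"
    unfolding kernel_def by (rule sum.cong) (auto simp: toeplitz_def)
  also have "\<dots> = (\<Sum>s\<le>min x y. toeplitz m x s * toeplitz (- m) y s)"
    by (rule sum.mono_neutral_right) (auto simp: toeplitz_def)
  also have "\<dots> = (\<Sum>s\<le>K. toeplitz m x s * toeplitz (- m) y s)"
    by (rule sum.mono_neutral_left) (use assms in \<open>auto simp: toeplitz_def\<close>)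
  finally show ?thesis .
qed

lemma kernel_transpose: "kernel (- m) y x = kernel m x y"
  using kernel_eq_sum[of x y "x" m] kernel_eq_sum[of y x "x" "- m"] by (simp add: mult.commute)

text \<open>Split the sum over \<open>s\<close> at \<open>k\<close>. The part from \<open>k\<close>
  on is the kernel with its row index lowered; the rest is the commutator of the kernel with the
  shift, of rank at most \<open>k\<close>.\<close>

lemma kernel_shift:
  "kernel m x (y + k) = (if k \<le> x then kernel m (x - k) y else 0)
     + (\<Sum>s<k. toeplitz m x s * neg_binom (- m) (y + k - s))"
proof -
  let ?g = "\<lambda>s. toeplitz m x s * neg_binom (- m) (y + k - s)"
  have "kernel m x (y + k) = sum ?g {0..<k} + sum ?g {k..<Suc y + k}"
    unfolding kernel_def
    by (subst sum.atLeastLessThan_concat)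
       (simp_all add: atLeastLessThanSuc_atLeastAtMost atLeast0AtMost del: sum.op_ivl_Suc)
  also have "sum ?g {k..<Suc y + k} = sum (\<lambda>s. ?g (s + k)) {0..<Suc y}"
    using sum.shift_bounds_nat_ivl[of ?g 0 k "Suc y"] by simp
  also have "\<dots> = (\<Sum>s\<le>y. toeplitz m x (s + k) * neg_binom (- m) (y - s))"
    by (rule sum.cong) auto
  also have "\<dots> = (if k \<le> x then kernel m (x - k) y else 0)"
    by (simp add: toeplitz_shift kernel_def)
  finally show ?thesis by (simp add: lessThan_atLeast0)
qed

text \<open>Inverts the upper triangular factor: column \<open>s\<close> of the lower triangular
  factor is a combination of the kernel columns \<open>0\<close> to \<open>s\<close>.\<close>

lemma toeplitz_eq_kernel_sum: "toeplitz m x s = (\<Sum>b\<le>s. neg_binom m (s - b) * kernel m x b)"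
proof -
  have "Abs_fps (kernel m x) = Abs_fps (toeplitz m x) * Abs_fps (neg_binom (- m))"
    by (rule fps_ext) (simp add: fps_mult_nth kernel_def atLeast0AtMost)
  then have "Abs_fps (toeplitz m x) = Abs_fps (kernel m x) * Abs_fps (neg_binom m)"
    using neg_binom_mult_inverse[of m] by (simp add: mult_ac)
  then have "fps_nth (Abs_fps (toeplitz m x)) s = fps_nth (Abs_fps (kernel m x) * Abs_fps (neg_binom m)) s"
    by (rule arg_cong)
  then show ?thesis
    by (simp only: fps_mult_nth atLeast0AtMost fps_nth_Abs_fps mult.commute[of "neg_binom m _"])
qed

text \<open>Each triangular factor contributes a logarithm, whose coefficients are
  \<open>1 / k\<close> and which lowers the row index or the column index by \<open>k\<close>. The
  minus sign comes from the parameter \<open>- m\<close> of the second factor.\<close>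

lemma kernel_has_derivative:
  "((\<lambda>m. kernel m x y) has_field_derivative
     (\<Sum>k=1..x. kernel m (x - k) y / of_nat k) - (\<Sum>k=1..y. kernel m x (y - k) / of_nat k)) (at m)"
proof -
  define K where "K = max x y"
  have eq: "kernel m x' y' = (\<Sum>s\<le>K. toeplitz m x' s * toeplitz (- m) y' s)" if "x' \<le> x" "y' \<le> y" for m x' y'
    using that by (intro kernel_eq_sum) (auto simp: K_def)
  have "((\<lambda>m. \<Sum>s\<le>K. toeplitz m x s * toeplitz (- m) y s) has_field_derivative
     (\<Sum>s\<le>K. (\<Sum>k=1..x. toeplitz m (x - k) s / of_nat k) * toeplitz (- m) y s
         + (\<Sum>k=1..y. toeplitz (- m) (y - k) s / of_nat k) * (- 1) * toeplitz m x s)) (at m)"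
    by (intro DERIV_sum DERIV_mult toeplitz_has_derivative DERIV_chain2[of "\<lambda>m. toeplitz m y _"])
       (auto intro!: derivative_eq_intros)
  moreover have "(\<Sum>s\<le>K. (\<Sum>k=1..x. toeplitz m (x - k) s / of_nat k) * toeplitz (- m) y s
         + (\<Sum>k=1..y. toeplitz (- m) (y - k) s / of_nat k) * (- 1) * toeplitz m x s)
     = (\<Sum>s\<le>K. \<Sum>k=1..x. toeplitz m (x - k) s * toeplitz (- m) y s / of_nat k)
       - (\<Sum>s\<le>K. \<Sum>k=1..y. toeplitz m x s * toeplitz (- m) (y - k) s / of_nat k)"
    by (simp add: sum_subtractf sum_distrib_right sum_distrib_left sum_negf mult_ac)
  moreover have "(\<Sum>s\<le>K. \<Sum>k=1..x. toeplitz m (x - k) s * toeplitz (- m) y s / of_nat k)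
     = (\<Sum>k=1..x. kernel m (x - k) y / of_nat k)"
    by (subst sum.swap) (simp add: eq sum_divide_distrib)
  moreover have "(\<Sum>s\<le>K. \<Sum>k=1..y. toeplitz m x s * toeplitz (- m) (y - k) s / of_nat k)
     = (\<Sum>k=1..y. kernel m x (y - k) / of_nat k)"
    by (subst sum.swap) (simp add: eq sum_divide_distrib)
  ultimately show ?thesis by (simp add: eq)
qed

section \<open>Closed form of the kernel\<close>

text \<open>The binomial coefficient \<open>m + x\<close> over \<open>x\<close>.\<close>

definition rising :: "complex \<Rightarrow> nat \<Rightarrow> complex" where
  "rising m x = pochhammer (1 + m) x / fact x"

lemma rising_0 [simp]: "rising m 0 = 1"
  by (simp add: rising_def)

lemma rising_Suc: "of_nat (Suc x) * rising m (Suc x) = (1 + m + of_nat x) * rising m x"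
  by (simp add: rising_def pochhammer_Suc divide_simps del: of_nat_Suc)

lemma neg_binom_Suc_rising: "of_nat (Suc x) * neg_binom m (Suc x) = m * rising m x"
  by (simp add: rising_def neg_binom_def pochhammer_rec add.commute divide_simps del: of_nat_Suc)

lemma neg_binom_rising: "(m + of_nat x) * neg_binom m x = m * rising m x"
  using neg_binom_Suc[of x m] neg_binom_Suc_rising[of x m] by simp

text \<open>Up to scaling of rows and columns the kernel is a Cauchy matrix. The induction runs
  along diagonals: \<open>kernel_shift\<close> with \<open>k = 1\<close> links \<open>(x, y)\<close>
  to \<open>(x + 1, y + 1)\<close>, and both have the same \<open>m + x - y\<close>.\<close>

lemma kernel_closed_form: "(m + of_nat x - of_nat y) * kernel m x y = m * rising m x * rising (- m) y"
proof (induction x arbitrary: y)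
  case 0
  have "kernel m 0 y = neg_binom (- m) y"
    using kernel_eq_sum[of 0 y 0 m] by (simp add: toeplitz_def)
  then show ?case using neg_binom_rising[of "- m" y] by (simp add: algebra_simps)
next
  case (Suc x)
  show ?case
  proof (cases y)
    case 0
    then show ?thesis using neg_binom_rising[of m "Suc x"] by (simp add: kernel_def toeplitz_def)
  next
    case (Suc y')
    let ?a = "of_nat (Suc x) :: complex" and ?b = "of_nat (Suc y') :: complex"
    have nz: "?a * ?b \<noteq> 0" by (simp del: of_nat_Suc)
    have k: "kernel m (Suc x) (Suc y') = kernel m x y' + neg_binom m (Suc x) * neg_binom (- m) (Suc y')"
      using kernel_shift[of m "Suc x" y' 1] by (simp add: toeplitz_def)
    have ih: "(m + ?a - ?b) * kernel m x y' = m * rising m x * rising (- m) y'"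
      using Suc.IH[of y'] by (simp add: algebra_simps)
    have "?a * ?b * ((m + ?a - ?b) * kernel m (Suc x) (Suc y'))
        = ?a * ?b * ((m + ?a - ?b) * kernel m x y')
          + (m + ?a - ?b) * ((?a * neg_binom m (Suc x)) * (?b * neg_binom (- m) (Suc y')))"
      unfolding k by (simp add: algebra_simps del: of_nat_Suc)
    also have "\<dots> = m * rising m x * rising (- m) y' * (?a * ?b - m * (m + ?a - ?b))"
      unfolding ih neg_binom_Suc_rising by (simp add: algebra_simps del: of_nat_Suc)
    \<comment> \<open>The identity \<open>a b - m (m + a - b) = (a + m) (b - m)\<close> is what
      makes the result factor.\<close>
    also have "\<dots> = m * ((?a + m) * rising m x) * ((?b - m) * rising (- m) y')"
      by (simp add: algebra_simps del: of_nat_Suc)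
    also have "(?a + m) * rising m x = ?a * rising m (Suc x)"
      by (subst rising_Suc) (simp add: algebra_simps)
    also have "(?b - m) * rising (- m) y' = ?b * rising (- m) (Suc y')"
      by (subst rising_Suc) (simp add: algebra_simps)
    finally have "?a * ?b * ((m + ?a - ?b) * kernel m (Suc x) (Suc y'))
      = ?a * ?b * (m * rising m (Suc x) * rising (- m) (Suc y'))"
      by (simp add: mult_ac del: of_nat_Suc)
    then show ?thesis using nz Suc by (simp del: of_nat_Suc)
  qed
qed

lemma rising_mult: "rising m x * rising (- m) x = (\<Prod>d=1..x. 1 - m\<^sup>2 / (of_nat d)\<^sup>2)"
proof (induction x)
  case (Suc x)
  let ?a = "of_nat (Suc x) :: complex"
  have nz: "?a \<noteq> 0" by (simp del: of_nat_Suc)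
  have "rising m (Suc x) = (?a + m) * rising m x / ?a" "rising (- m) (Suc x) = (?a - m) * rising (- m) x / ?a"
    using rising_Suc[of x m] rising_Suc[of x "- m"] nz by (simp_all add: field_simps)
  then have "rising m (Suc x) * rising (- m) (Suc x) = ((?a + m) * (?a - m) / ?a\<^sup>2) * (rising m x * rising (- m) x)"
    by (simp add: power2_eq_square mult_ac del: of_nat_Suc)
  also have "(?a + m) * (?a - m) / ?a\<^sup>2 = 1 - m\<^sup>2 / ?a\<^sup>2"
    using nz by (simp add: field_simps power2_eq_square del: of_nat_Suc)
  finally show ?case using Suc by (simp del: of_nat_Suc)
qed simp

section \<open>Traces of the minors of the kernel\<close>

text \<open>The least sum of \<open>N\<close> distinct naturals, that is, the energy of the ground
  state \<open>{..<N}\<close>.\<close>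

abbreviation tri :: "nat \<Rightarrow> nat" where
  "tri N \<equiv> \<Sum>i<N. i"

text \<open>Traces are sums over all tuples instead of subsets: tuples with a repeated entry contribute \<open>0\<close>,
  and shifting an entry needs no sign.\<close>

definition tuples :: "nat \<Rightarrow> nat \<Rightarrow> (nat \<Rightarrow> nat) set" where
  "tuples N w = {y \<in> {..<N} \<rightarrow>\<^sub>E UNIV. (\<Sum>i<N. y i) = w}"

definition minor :: "nat \<Rightarrow> complex \<Rightarrow> (nat \<Rightarrow> nat) \<Rightarrow> (nat \<Rightarrow> nat) \<Rightarrow> complex" where
  "minor N m y y' = fdet N (\<lambda>i j. kernel m (y i) (y' j))"

text \<open>The downward shift by \<open>k\<close> acting on the exterior power as a derivation, one
  row at a time; positions that would become negative are dropped.\<close>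

abbreviation lowered :: "nat \<Rightarrow> complex \<Rightarrow> nat \<Rightarrow> (nat \<Rightarrow> nat) \<Rightarrow> (nat \<Rightarrow> nat) \<Rightarrow> complex" where
  "lowered N m k y y' \<equiv> \<Sum>i | i < N \<and> k \<le> y i. minor N m (y(i := y i - k)) y'"

definition trace_coeff :: "nat \<Rightarrow> complex \<Rightarrow> nat \<Rightarrow> complex" where
  "trace_coeff N m w = (\<Sum>y\<in>tuples N w. minor N m y y)"

definition lowering :: "nat \<Rightarrow> complex \<Rightarrow> nat \<Rightarrow> nat \<Rightarrow> complex" where
  "lowering N m k w = (\<Sum>y\<in>tuples N w. lowered N m k y y)"

lemma tuples_le: "y \<in> tuples N w \<Longrightarrow> i < N \<Longrightarrow> y i \<le> w"
  unfolding tuples_def by (auto intro!: member_le_sum)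

lemma finite_tuples [simp]: "finite (tuples N w)"
proof (rule finite_subset)
  show "tuples N w \<subseteq> {..<N} \<rightarrow>\<^sub>E {..w}"
    using tuples_le unfolding tuples_def by fastforce
qed (simp add: finite_PiE)

lemma tuples_upd:
  assumes "y \<in> tuples N w" "i < N"
  shows "y(i := v) \<in> tuples N (w - y i + v)"
proof -
  have "(\<Sum>j<N. (y(i := v)) j) = v + (\<Sum>j\<in>{..<N} - {i}. y j)"
    using assms(2) by (subst sum.remove[of _ i]) auto
  moreover have "w = y i + (\<Sum>j\<in>{..<N} - {i}. y j)"
    using assms by (auto simp: tuples_def sum.remove[of _ i])
  ultimately show ?thesis
    using assms by (auto simp: tuples_def PiE_iff extensional_def)
qed

lemma minor_row_inj: "\<not> inj_on y {..<N} \<Longrightarrow> minor N m y y' = 0"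
  unfolding minor_def inj_on_def by (auto intro: fdet_rows_eq)

lemma minor_col_inj: "\<not> inj_on y' {..<N} \<Longrightarrow> minor N m y y' = 0"
  unfolding minor_def inj_on_def by (auto intro: fdet_cols_eq)

lemma minor_transpose: "minor N (- m) y' y = minor N m y y'"
  unfolding minor_def kernel_transpose by (rule fdet_transpose)

lemma trace_coeff_uminus: "trace_coeff N (- m) w = trace_coeff N m w"
  unfolding trace_coeff_def minor_transpose ..

text \<open>Puts the lowering into the form that \<open>fdet_replace_rows_cols\<close> handles; a
  dropped position becomes a zero row.\<close>

lemma minor_lower_row:
  "lowered N m k y y'
   = (\<Sum>r<N. fdet N (\<lambda>i j. if i = r then (if k \<le> y i then kernel m (y i - k) (y' j) else 0)
                            else kernel m (y i) (y' j)))"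
proof -
  let ?D = "\<lambda>r. fdet N (\<lambda>i j. if i = r then (if k \<le> y i then kernel m (y i - k) (y' j) else 0)
                            else kernel m (y i) (y' j))"
  have "(\<Sum>r<N. ?D r)
     = (\<Sum>r<N. if k \<le> y r then minor N m (y(r := y r - k)) y' else 0)"
  proof (intro sum.cong refl)
    fix r assume "r \<in> {..<N}"
    then have "fdet N (\<lambda>i j. if i = r then 0 else kernel m (y i) (y' j)) = 0"
      using fdet_row_expand[of r N "\<lambda>_. 0"] by simp
    then show "?D r
        = (if k \<le> y r then minor N m (y(r := y r - k)) y' else 0)"
      unfolding minor_def by (auto intro!: fdet_cong simp: if_distrib cong: if_cong)
  qed
  also have "\<dots> = (\<Sum>r | r \<in> {..<N} \<and> k \<le> y r. minor N m (y(r := y r - k)) y')"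
    by (rule sum.inter_filter[symmetric]) simp
  finally show ?thesis by simp
qed

text \<open>Expand the new column over the kernel columns \<open>b \<le> s\<close>. Each such
  \<open>b\<close> is below \<open>k\<close>, hence equals some \<open>y j\<close>; unless
  \<open>b = y c\<close>, the determinant has two equal columns.\<close>

lemma toeplitz_column:
  assumes "c < N" "s < k" "{..<k} \<subseteq> y ` {..<N}"
  shows "fdet N (\<lambda>i j. if j = c then toeplitz m (y i) s else kernel m (y i) (y j))
       = (if y c \<le> s then neg_binom m (s - y c) else 0) * minor N m y y"
proof -
  have *: "fdet N (\<lambda>i j. if j = c then kernel m (y i) b else kernel m (y i) (y j))
     = (if b = y c then minor N m y y else 0)" if "b \<le> s" for b
  proof (cases "b = y c")
    case True
    then show ?thesis by (auto simp: minor_def intro!: fdet_cong)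
  next
    case False
    from that assms have "b \<in> y ` {..<N}" by auto
    then obtain j where "j < N" "y j = b" by auto
    then show ?thesis using False assms(1)
      by (auto intro!: fdet_cols_eq[of c j])
  qed
  have "fdet N (\<lambda>i j. if j = c then toeplitz m (y i) s else kernel m (y i) (y j))
      = fdet N (\<lambda>i j. if j = c then \<Sum>b\<le>s. neg_binom m (s - b) * kernel m (y i) b else kernel m (y i) (y j))"
    by (simp only: toeplitz_eq_kernel_sum)
  also have "\<dots> = (\<Sum>b\<le>s. neg_binom m (s - b) * (if b = y c then minor N m y y else 0))"
    using assms(1) * by (subst fdet_col_sum) auto
  also have "\<dots> = (if y c \<le> s then neg_binom m (s - y c) else 0) * minor N m y y"
    by (simp add: if_distrib cong: if_cong)
  finally show ?thesis .
qed

text \<open>The commutator of a shift by \<open>k\<close> with the kernel is supported on the first \<open>k\<close> columns.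
  Those are spanned by the first \<open>k\<close> columns of the kernel itself, which explains the condition on \<open>y\<close>.\<close>

lemma minor_raise:
  assumes "k \<ge> 1" and inj: "inj_on y {..<N}" and sub: "{..<k} \<subseteq> y ` {..<N}"
  shows "(\<Sum>i<N. minor N m y (y(i := y i + k)))
       = lowered N m k y y - m * minor N m y y"
proof -
  let ?A = "\<lambda>i j. kernel m (y i) (y j)"
  let ?B = "\<lambda>i j. if k \<le> y i then kernel m (y i - k) (y j) else 0"
  let ?D = "minor N m y y"
  have "minor N m y (y(c := y c + k)) = fdet N (\<lambda>i j. if j = c then ?B i j else ?A i j)
     + (\<Sum>s<k. neg_binom (- m) (y c + k - s) * ((if y c \<le> s then neg_binom m (s - y c) else 0) * ?D))"
    if "c < N" for c
  proof -
    have "minor N m y (y(c := y c + k))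
       = fdet N (\<lambda>i j. if j = c then ?B i c + (\<Sum>s<k. neg_binom (- m) (y c + k - s) * toeplitz m (y i) s)
                        else ?A i j)"
      unfolding minor_def by (rule fdet_cong) (auto simp: kernel_shift mult.commute)
    also have "\<dots> = fdet N (\<lambda>i j. if j = c then ?B i c else ?A i j)
       + (\<Sum>s<k. neg_binom (- m) (y c + k - s) * fdet N (\<lambda>i j. if j = c then toeplitz m (y i) s else ?A i j))"
      by (simp only: fdet_col_add[OF that] fdet_col_sum[OF that])
    also have "(\<Sum>s<k. neg_binom (- m) (y c + k - s) * fdet N (\<lambda>i j. if j = c then toeplitz m (y i) s else ?A i j))
       = (\<Sum>s<k. neg_binom (- m) (y c + k - s) * ((if y c \<le> s then neg_binom m (s - y c) else 0) * ?D))"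
      using toeplitz_column[OF that _ sub] by (intro sum.cong) auto
    also have "fdet N (\<lambda>i j. if j = c then ?B i c else ?A i j)
       = fdet N (\<lambda>i j. if j = c then ?B i j else ?A i j)"
      by (rule fdet_cong) auto
    finally show ?thesis .
  qed
  then have "(\<Sum>i<N. minor N m y (y(i := y i + k)))
     = (\<Sum>c<N. fdet N (\<lambda>i j. if j = c then ?B i j else ?A i j))
       + (\<Sum>c<N. \<Sum>s<k. neg_binom (- m) (y c + k - s) * (if y c \<le> s then neg_binom m (s - y c) else 0)) * ?D"
    by (simp add: sum.distrib sum_distrib_left sum_distrib_right mult_ac)
  also have "(\<Sum>c<N. fdet N (\<lambda>i j. if j = c then ?B i j else ?A i j))
     = lowered N m k y y"
    by (simp only: minor_lower_row fdet_replace_rows_cols)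
  \<comment> \<open>The values of \<open>y\<close> below \<open>k\<close> are exactly
    \<open>0\<close> to \<open>k - 1\<close>, so the sum over columns is a sum over
    \<open>a < k\<close>. With \<open>d = s - a\<close>, each \<open>d\<close> arises from
    \<open>k - d\<close> values of \<open>a\<close>, which leaves the sum in
    \<open>neg_binom_convolution\<close>.\<close>
  also have "(\<Sum>c<N. \<Sum>s<k. neg_binom (- m) (y c + k - s) * (if y c \<le> s then neg_binom m (s - y c) else 0)) = - m"
  proof -
    let ?h = "\<lambda>a s. neg_binom (- m) (a + k - s) * (if a \<le> s then neg_binom m (s - a) else 0)"
    have "(\<Sum>c<N. \<Sum>s<k. ?h (y c) s) = (\<Sum>a\<in>y ` {..<N}. \<Sum>s<k. ?h a s)"
      by (subst sum.reindex[OF inj]) simp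
    also have "\<dots> = (\<Sum>a<k. \<Sum>s<k. ?h a s)"
      by (rule sum.mono_neutral_right) (use sub in \<open>auto intro!: sum.neutral\<close>)
    also have "\<dots> = (\<Sum>a<k. \<Sum>d\<le>k. if a + d < k then neg_binom (- m) (k - d) * neg_binom m d else 0)"
    proof (rule sum.cong[OF refl])
      fix a assume "a \<in> {..<k}"
      then have a: "a < k" by simp
      have "(\<Sum>s<k. ?h a s) = (\<Sum>s\<in>{a..<k}. ?h a s)"
        by (rule sum.mono_neutral_right) auto
      also have "\<dots> = (\<Sum>d\<in>{..<k - a}. neg_binom (- m) (k - d) * neg_binom m d)"
        by (rule sum.reindex_bij_witness[of _ "\<lambda>d. a + d" "\<lambda>s. s - a"])
           (use a in \<open>auto simp: add.commute\<close>)
      also have "\<dots> = (\<Sum>d\<in>{..<k - a}. if a + d < k then neg_binom (- m) (k - d) * neg_binom m d else 0)"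
        by (rule sum.cong) auto
      also have "\<dots> = (\<Sum>d\<le>k. if a + d < k then neg_binom (- m) (k - d) * neg_binom m d else 0)"
        by (rule sum.mono_neutral_left) auto
      finally show "(\<Sum>s<k. ?h a s) = (\<Sum>d\<le>k. if a + d < k then neg_binom (- m) (k - d) * neg_binom m d else 0)" by simp
    qed
    also have "\<dots> = (\<Sum>d\<le>k. \<Sum>a<k. if a + d < k then neg_binom (- m) (k - d) * neg_binom m d else 0)"
      by (rule sum.swap)
    also have "\<dots> = (\<Sum>d\<le>k. of_nat (k - d) * neg_binom (- m) (k - d) * neg_binom m d)"
    proof (intro sum.cong refl)
      fix d assume "d \<in> {..k}"
      have "(\<Sum>a<k. if a + d < k then neg_binom (- m) (k - d) * neg_binom m d else 0)
          = (\<Sum>a<k - d. neg_binom (- m) (k - d) * neg_binom m d)"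
        by (rule sum.mono_neutral_cong_right) auto
      then show "(\<Sum>a<k. if a + d < k then neg_binom (- m) (k - d) * neg_binom m d else 0)
          = of_nat (k - d) * neg_binom (- m) (k - d) * neg_binom m d"
        by simp
    qed
    also have "\<dots> = - m" by (rule neg_binom_convolution[OF assms(1)])
    finally show ?thesis .
  qed
  finally show ?thesis by (simp only: mult_minus_left add_uminus_conv_diff)
qed

text \<open>Cyclicity of the trace: take the lowered tuple as the new summation variable; then the
  column tuple is the raised one.\<close>

lemma lowering_eq_raise:
  assumes "k \<le> w"
  shows "lowering N m k w = (\<Sum>y\<in>tuples N (w - k). \<Sum>i<N. minor N m y (y(i := y i + k)))"
proof -
  have "lowering N m k w
     = (\<Sum>(y, i)\<in>Sigma (tuples N w) (\<lambda>y. {i. i < N \<and> k \<le> y i}). minor N m (y(i := y i - k)) y)"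
    unfolding lowering_def by (subst sum.Sigma) auto
  also have "\<dots> = (\<Sum>(y, i)\<in>tuples N (w - k) \<times> {..<N}. minor N m y (y(i := y i + k)))"
  proof (rule sum.reindex_bij_witness[of _
      "\<lambda>(y, i). (y(i := y i + k), i)" "\<lambda>(y, i). (y(i := y i - k), i)"], goal_cases)
    case (2 p)
    then show ?case using tuples_upd[of "fst p" N w "snd p" "fst p (snd p) - k"]
        tuples_le[of "fst p" N w "snd p"]
      by (auto simp: case_prod_beta)
  next
    case (4 p)
    then show ?case using tuples_upd[of "fst p" N "w - k" "snd p" "fst p (snd p) + k"]
        tuples_le[of "fst p" N "w - k" "snd p"] assms
      by (auto simp: case_prod_beta)
  qed auto
  also have "\<dots> = (\<Sum>y\<in>tuples N (w - k). \<Sum>i<N. minor N m y (y(i := y i + k)))"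
    by (subst sum.cartesian_product) simp
  finally show ?thesis .
qed

section \<open>Sets of naturals close to the ground state\<close>

lemma sum_ge_triangle: "finite X \<Longrightarrow> tri (card X) \<le> \<Sum>X" for X :: "nat set"
proof (induction "card X" arbitrary: X)
  case (Suc n)
  then have ne: "X \<noteq> {}" by auto
  have "n = card (X - {Max X})" using Suc ne by (simp add: card_Diff_singleton)
  then have "(\<Sum>i<n. i) \<le> \<Sum>(X - {Max X})" using Suc by (metis finite_Diff)
  moreover have "X \<subseteq> {..Max X}" using Suc ne by auto
  then have "card X \<le> Suc (Max X)" using card_mono[of "{..Max X}" X] by simp
  then have "n \<le> Max X" using Suc by simp
  moreover have "\<Sum>X = Max X + \<Sum>(X - {Max X})" using Suc ne by (intro sum.remove) auto
  ultimately show ?case using Suc(2)[symmetric] by simp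
qed simp

text \<open>Closing the gap at \<open>a\<close> by the map \<open>g\<close> keeps the elements
  distinct and lowers every element above \<open>a\<close> by one; there are at least
  \<open>card X - a\<close> of these.\<close>

lemma sum_ge_triangle_gap:
  fixes X :: "nat set"
  assumes "finite X" "a \<notin> X"
  shows "tri (card X) + card X \<le> \<Sum>X + a"
proof -
  define g where "g = (\<lambda>x::nat. if a < x then x - 1 else x)"
  have inj: "inj_on g X"
    using assms(2) unfolding g_def by (intro inj_onI) (auto split: if_splits, (metis Suc_pred le_antisym less_Suc_eq_le not_less zero_less_iff_neq_zero not_less_zero)+)
  have "tri (card X) \<le> \<Sum>(g ` X)"
    using sum_ge_triangle[of "g ` X"] assms(1) inj by (simp add: card_image)
  also have "\<dots> = (\<Sum>x\<in>X. g x)" by (subst sum.reindex[OF inj]) simp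
  finally have 1: "tri (card X) \<le> (\<Sum>x\<in>X. g x)" .
  have "\<Sum>X = (\<Sum>x\<in>X. g x + (if a < x then 1 else 0))"
    by (intro sum.cong) (auto simp: g_def)
  also have "\<dots> = (\<Sum>x\<in>X. g x) + card {x\<in>X. a < x}"
    using assms(1) by (simp add: sum.distrib flip: sum.inter_filter)
  finally have 2: "\<Sum>X = (\<Sum>x\<in>X. g x) + card {x\<in>X. a < x}" .
  have "X \<subseteq> {x\<in>X. a < x} \<union> {..<a}" using assms(2) by (auto simp: not_less le_less)
  then have "card X \<le> card ({x\<in>X. a < x} \<union> {..<a})" using assms(1) by (intro card_mono) auto
  also have "\<dots> \<le> card {x\<in>X. a < x} + a" using card_Un_le[of "{x\<in>X. a < x}" "{..<a}"] by simp
  finally show ?thesis using 1 2 by linarith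
qed

lemma tuples_sum_image:
  assumes "y \<in> tuples N w" "inj_on y {..<N}"
  shows "\<Sum>(y ` {..<N}) = w" "card (y ` {..<N}) = N"
  using assms by (auto simp: tuples_def sum.reindex card_image)

text \<open>If \<open>k \<le> n\<close>, a missing position \<open>a < k\<close> would force an
  energy of at least \<open>tri N + N - a\<close>, which exceeds \<open>tri N + n - k\<close>; so
  \<open>minor_raise\<close> applies. If \<open>k > n\<close>, the remaining energy is below the
  ground state, and every minor has two equal rows.\<close>

lemma lowering_rec:
  assumes "k \<ge> 1" "n \<le> N"
  shows "lowering N m k (tri N + n) =
    (if k \<le> n then lowering N m k (tri N + (n - k)) - m * trace_coeff N m (tri N + (n - k)) else 0)"
proof (cases "k \<le> tri N + n")
  case True
  let ?w = "tri N + n - k"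
  have eq: "lowering N m k (tri N + n) = (\<Sum>y\<in>tuples N ?w. \<Sum>i<N. minor N m y (y(i := y i + k)))"
    by (rule lowering_eq_raise[OF True])
  show ?thesis
  proof (cases "k \<le> n")
    case kn: True
    have "(\<Sum>i<N. minor N m y (y(i := y i + k)))
       = lowered N m k y y - m * minor N m y y"
      if y: "y \<in> tuples N ?w" for y
    proof (cases "inj_on y {..<N}")
      case True
      have "{..<k} \<subseteq> y ` {..<N}"
      proof (rule ccontr)
        assume "\<not> {..<k} \<subseteq> y ` {..<N}"
        then obtain a where "a < k" "a \<notin> y ` {..<N}" by auto
        then show False
          using sum_ge_triangle_gap[of "y ` {..<N}" a] tuples_sum_image[OF y True] kn assms(2)
          by simp
      qed
      then show ?thesis using minor_raise[OF assms(1) True] by simp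
    qed (simp add: minor_row_inj minor_col_inj)
    then show ?thesis using kn
      unfolding eq by (simp add: lowering_def trace_coeff_def sum_subtractf sum_distrib_left)
  next
    case kn: False
    have "minor N m y y' = 0" if y: "y \<in> tuples N ?w" for y y'
    proof (rule minor_row_inj, rule notI)
      assume "inj_on y {..<N}"
      then show False
        using sum_ge_triangle[of "y ` {..<N}"] tuples_sum_image[OF y] kn True by simp
    qed
    then show ?thesis using kn unfolding eq by simp
  qed
next
  case False
  have "{i. i < N \<and> k \<le> y i} = {}" if "y \<in> tuples N (tri N + n)" for y
    using tuples_le[OF that] False by fastforce
  then have "lowering N m k (tri N + n) = 0"
    unfolding lowering_def by (intro sum.neutral ballI) (simp only: empty_iff)
  then show ?thesis using False by simp
qed

text \<open>Unrolls \<open>lowering_rec\<close>: descending from \<open>n\<close> in steps of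
  \<open>k\<close> visits the indices \<open>i < n\<close> congruent to \<open>n\<close> modulo
  \<open>k\<close>.\<close>

lemma lowering_closed:
  assumes "k \<ge> 1" "n \<le> N"
  shows "lowering N m k (tri N + n) =
    - m * (\<Sum>i | i < n \<and> k dvd n - i. trace_coeff N m (tri N + i))"
  using assms(2)
proof (induction n rule: less_induct)
  case (less n)
  show ?case
  proof (cases "k \<le> n")
    case True
    have "{i. i < n \<and> k dvd n - i} = insert (n - k) {i. i < n - k \<and> k dvd (n - k) - i}"
    proof (intro Set.set_eqI iffI)
      fix i assume "i \<in> {i. i < n \<and> k dvd n - i}"
      then have i: "i < n" "k dvd n - i" by auto
      then have "k \<le> n - i" by (simp add: dvd_imp_le)
      moreover have "k dvd n - i - k" by (rule dvd_diff_nat[OF i(2) dvd_refl])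
      moreover have "n - i - k = n - k - i" by simp
      ultimately show "i \<in> insert (n - k) {i. i < n - k \<and> k dvd (n - k) - i}"
        using True i(1) by auto
    next
      fix i assume "i \<in> insert (n - k) {i. i < n - k \<and> k dvd (n - k) - i}"
      then consider "i = n - k" | "i < n - k" "k dvd n - k - i" by auto
      then show "i \<in> {i. i < n \<and> k dvd n - i}"
      proof cases
        case 2
        have "k dvd (n - k - i) + k" by (rule dvd_add[OF 2(2) dvd_refl])
        moreover have "(n - k - i) + k = n - i" using 2(1) by simp
        ultimately have "k dvd n - i" by (simp only:)
        moreover have "i < n" using 2(1) by simp
        ultimately show ?thesis by blast
      qed (use True assms(1) in auto)
    qed
    then have set_sum: "(\<Sum>i | i < n \<and> k dvd n - i. trace_coeff N m (tri N + i))
       = trace_coeff N m (tri N + (n - k))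
         + (\<Sum>i | i < n - k \<and> k dvd (n - k) - i. trace_coeff N m (tri N + i))"
      by (simp only:) (rule sum.insert, auto)
    have ih: "lowering N m k (tri N + (n - k))
       = - m * (\<Sum>i | i < n - k \<and> k dvd (n - k) - i. trace_coeff N m (tri N + i))"
      using True assms(1) less.prems by (intro less.IH) auto
    show ?thesis
      unfolding lowering_rec[OF assms(1) less.prems, of m] if_P[OF True] ih set_sum
      by (simp only: distrib_left mult_minus_left) simp
  next
    case False
    have "\<not> k dvd n - i" if "i < n" for i
    proof
      assume "k dvd n - i"
      then have "k \<le> n - i" using that by (intro dvd_imp_le) auto
      then show False using False by simp
    qed
    then have "(\<Sum>i | i < n \<and> k dvd n - i. trace_coeff N m (tri N + i)) = 0"
      by (intro sum.neutral) blast
    then show ?thesis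
      unfolding lowering_rec[OF assms(1) less.prems, of m] if_not_P[OF False] by simp
  qed
qed

section \<open>The derivative of the trace in \<open>m\<close>\<close>

text \<open>Row shifts give lowered minors at \<open>m\<close>; column shifts become, after
  transposition, lowered minors at \<open>- m\<close>. No entry of \<open>y\<close> exceeds
  \<open>w\<close>, so the range \<open>1..w\<close> of \<open>k\<close> serves all entries.\<close>

lemma minor_has_derivative:
  assumes "y \<in> tuples N w"
  shows "((\<lambda>m. minor N m y y) has_field_derivative
    (\<Sum>k=1..w. (lowered N m k y y
       - lowered N (- m) k y y) / of_nat k)) (at m)"
proof -
  let ?A = "\<lambda>i j. kernel m (y i) (y j)"
  let ?B = "\<lambda>k i j. if k \<le> y i then kernel m (y i - k) (y j) else 0"
  let ?C = "\<lambda>k i j. if k \<le> y j then kernel m (y i) (y j - k) else 0"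
  let ?f' = "\<lambda>i j. \<Sum>k=1..w. 1 / of_nat k * (?B k i j + (- 1) * ?C k i j)"
  have ext: "(\<Sum>k=1..a. g k / of_nat k) = (\<Sum>k=1..w. 1 / of_nat k * (if k \<le> a then g k else 0))"
    if "a \<le> w" for a and g :: "nat \<Rightarrow> complex"
    by (rule sum.mono_neutral_cong_left) (use that in auto)
  have "((\<lambda>m. kernel m (y i) (y j)) has_field_derivative ?f' i j) (at m)" if "i < N" "j < N" for i j
  proof -
    have "?f' i j = (\<Sum>k=1..y i. kernel m (y i - k) (y j) / of_nat k)
        - (\<Sum>k=1..y j. kernel m (y i) (y j - k) / of_nat k)"
      unfolding ext[OF tuples_le[OF assms that(1)]] ext[OF tuples_le[OF assms that(2)]]
      by (simp add: sum_subtractf[symmetric] right_diff_distrib)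
    then show ?thesis using kernel_has_derivative[of "y i" "y j" m] by (simp only:)
  qed
  then have "((\<lambda>m. minor N m y y) has_field_derivative
      (\<Sum>r<N. fdet N (\<lambda>i j. if i = r then ?f' i j else ?A i j))) (at m)"
    unfolding minor_def by (rule has_field_derivative_fdet)
  moreover have "(\<Sum>r<N. fdet N (\<lambda>i j. if i = r then ?f' i j else ?A i j))
     = (\<Sum>k=1..w. ((\<Sum>r<N. fdet N (\<lambda>i j. if i = r then ?B k i j else ?A i j))
           - (\<Sum>r<N. fdet N (\<lambda>i j. if i = r then ?C k i j else ?A i j))) / of_nat k)"
  proof -
    have "fdet N (\<lambda>i j. if i = r then ?f' i j else ?A i j)
       = (\<Sum>k=1..w. (fdet N (\<lambda>i j. if i = r then ?B k i j else ?A i j)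
           - fdet N (\<lambda>i j. if i = r then ?C k i j else ?A i j)) / of_nat k)" if r: "r < N" for r
    proof -
      have row: "fdet N (\<lambda>i j. if i = r then X i j else ?A i j) = (\<Sum>j<N. X r j * fcof N ?A r j)" for X
        using fdet_row_expand[OF r, of "X r" ?A] by (simp cong: if_cong)
      show ?thesis unfolding row
        by (simp add: sum_distrib_right sum_subtractf[symmetric] sum_divide_distrib left_diff_distrib
              diff_divide_distrib del: sum_subtractf) (subst sum.swap, simp add: sum_subtractf)
    qed
    then show ?thesis
      by (simp add: sum_subtractf[symmetric] sum_divide_distrib) (rule sum.swap)
  qed
  moreover have "(\<Sum>r<N. fdet N (\<lambda>i j. if i = r then ?C k i j else ?A i j))
     = lowered N (- m) k y y" for k
  proof -
    have "(\<Sum>r<N. fdet N (\<lambda>i j. if i = r then ?C k i j else ?A i j))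
        = (\<Sum>c<N. fdet N (\<lambda>i j. if j = c then ?C k i j else ?A i j))"
      by (rule fdet_replace_rows_cols)
    also have "\<dots> = (\<Sum>c<N. fdet N (\<lambda>i j. if i = c then (if k \<le> y i then kernel (- m) (y i - k) (y j) else 0)
                            else kernel (- m) (y i) (y j)))"
      by (subst (2) fdet_transpose[symmetric]) (simp add: kernel_transpose cong: if_cong)
    finally show ?thesis unfolding minor_lower_row .
  qed
  ultimately show ?thesis unfolding minor_lower_row by simp
qed

text \<open>The coefficient of \<open>q ^ n\<close> in \<open>- log\<close> of the Euler product.
  For \<open>n = 0\<close> the index set is infinite, so the value is 0.\<close>

definition inv_divisor_sum :: "nat \<Rightarrow> complex" where
  "inv_divisor_sum n = (\<Sum>k | k dvd n. 1 / of_nat k)"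

text \<open>Since traces are even in \<open>m\<close>, \<open>lowering_closed\<close> at
  \<open>m\<close> and at \<open>- m\<close> differ only in sign, whence \<open>- 2 m\<close>. For
  fixed \<open>i\<close>, the shifts that reach it are the divisors \<open>k\<close> of
  \<open>n - i\<close>, each with coefficient \<open>1 / k\<close>.\<close>

lemma trace_coeff_has_derivative:
  assumes "n \<le> N"
  shows "((\<lambda>m. trace_coeff N m (tri N + n)) has_field_derivative
     - 2 * m * (\<Sum>i<n. inv_divisor_sum (n - i) * trace_coeff N m (tri N + i))) (at m)"
proof -
  let ?w = "tri N + n" and ?T = "\<lambda>i. trace_coeff N m (tri N + i)"
  have "((\<lambda>m. trace_coeff N m ?w) has_field_derivative
     (\<Sum>y\<in>tuples N ?w. \<Sum>k=1..?w. (lowered N m k y y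
       - lowered N (- m) k y y) / of_nat k)) (at m)"
    unfolding trace_coeff_def by (intro DERIV_sum minor_has_derivative)
  moreover have "(\<Sum>y\<in>tuples N ?w. \<Sum>k=1..?w. (lowered N m k y y
       - lowered N (- m) k y y) / of_nat k)
     = (\<Sum>k=1..?w. (lowering N m k ?w - lowering N (- m) k ?w) / of_nat k)"
    by (subst sum.swap) (simp add: lowering_def sum_subtractf sum_divide_distrib diff_divide_distrib)
  moreover have "(\<Sum>k=1..?w. (lowering N m k ?w - lowering N (- m) k ?w) / of_nat k)
     = (\<Sum>k=1..?w. \<Sum>i | i < n \<and> k dvd n - i. - 2 * m * ?T i / of_nat k)"
  proof (intro sum.cong refl)
    fix k assume "k \<in> {1..?w}"
    then have "k \<ge> 1" by simp
    then show "(lowering N m k ?w - lowering N (- m) k ?w) / of_nat k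
        = (\<Sum>i | i < n \<and> k dvd n - i. - 2 * m * ?T i / of_nat k)"
      by (simp only: lowering_closed[OF _ assms] trace_coeff_uminus)
         (simp add: sum_distrib_left sum_divide_distrib sum_negf algebra_simps)
  qed
  moreover have "(\<Sum>k=1..?w. \<Sum>i | i < n \<and> k dvd n - i. - 2 * m * ?T i / of_nat k)
     = (\<Sum>i<n. \<Sum>k | k \<in> {1..?w} \<and> k dvd n - i. - 2 * m * ?T i / of_nat k)"
    using sum.swap_restrict[of "{1..?w}" "{..<n}" "\<lambda>k i. - 2 * m * ?T i / of_nat k" "\<lambda>k i. k dvd n - i"]
    by simp
  moreover have "\<dots> = (\<Sum>i<n. - 2 * m * (inv_divisor_sum (n - i) * ?T i))"
  proof (intro sum.cong refl)
    fix i assume "i \<in> {..<n}"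
    then have i: "i < n" by simp
    have "{k. k \<in> {1..?w} \<and> k dvd n - i} = {k. k dvd n - i}"
    proof (intro Set.set_eqI iffI)
      fix k assume "k \<in> {k. k dvd n - i}"
      then have k: "k dvd n - i" by simp
      have "k \<le> n - i" using i by (intro dvd_imp_le[OF k]) simp
      moreover have "k \<noteq> 0" using k i by (cases "k = 0") auto
      ultimately show "k \<in> {k. k \<in> {1..?w} \<and> k dvd n - i}" using k by auto
    qed simp
    then show "(\<Sum>k | k \<in> {1..?w} \<and> k dvd n - i. - 2 * m * ?T i / of_nat k)
        = - 2 * m * (inv_divisor_sum (n - i) * ?T i)"
      unfolding inv_divisor_sum_def by (simp add: sum_distrib_left sum_distrib_right mult_ac)
  qed
  ultimately show ?thesis by (simp add: sum_distrib_left)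
qed

section \<open>The Nekrasov-Okounkov series\<close>

definition inversions :: "'a::linorder set \<Rightarrow> ('a \<times> 'a) set" where
  "inversions X = {(x, z). x \<in> X \<and> z \<notin> X \<and> z < x}"

definition gap_factor :: "complex \<Rightarrow> nat \<Rightarrow> nat \<Rightarrow> complex" where
  "gap_factor c x z = 1 - c / (of_nat x - of_nat z)\<^sup>2"

definition nat_weight :: "complex \<Rightarrow> nat set \<Rightarrow> complex" where
  "nat_weight c X = (\<Prod>(x, z)\<in>inversions X. gap_factor c x z)"

lemma finite_inversions_nat: "finite X \<Longrightarrow> finite (inversions X)" for X :: "nat set"
  by (rule finite_subset[of _ "X \<times> {..Max X}"])
     (auto simp: inversions_def intro: order.trans[OF less_imp_le] Max_ge)

lemma gap_factor_commute: "gap_factor c x z = gap_factor c z x"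
  by (simp add: gap_factor_def power2_commute)

text \<open>Both products run over unordered pairs, ordered by index on the left and by value on the
  right; as \<open>p\<close> is symmetric, the order in which \<open>y\<close> lists its values does
  not matter.\<close>

lemma prod_pairs_reindex:
  fixes p :: "nat \<Rightarrow> nat \<Rightarrow> 'a::comm_monoid_mult" and y :: "nat \<Rightarrow> nat"
  assumes inj: "inj_on y {..<N}" and sym: "\<And>x z. p x z = p z x"
  shows "(\<Prod>i<N. \<Prod>j<i. p (y i) (y j))
     = (\<Prod>(x, z)\<in>{(x, z). x \<in> y ` {..<N} \<and> z \<in> y ` {..<N} \<and> z < x}. p x z)"
proof -
  define v where "v = the_inv_into {..<N} y"
  have vy: "v (y i) = i" if "i < N" for i
    using inj that by (simp add: v_def the_inv_into_f_f)
  have ne: "y i \<noteq> y j" if "j < i" "i < N" for i j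
  proof -
    have "j < N" using that by simp
    then show ?thesis using inj_onD[OF inj, of i j] that by auto
  qed
  have "(\<Prod>i<N. \<Prod>j<i. p (y i) (y j)) = (\<Prod>(i, j)\<in>Sigma {..<N} (\<lambda>i. {..<i}). p (y i) (y j))"
    by (rule prod.Sigma) auto
  also have "\<dots> = (\<Prod>(x, z)\<in>{(x, z). x \<in> y ` {..<N} \<and> z \<in> y ` {..<N} \<and> z < x}. p x z)"
  proof (rule prod.reindex_bij_witness[of _
      "\<lambda>(x, z). (max (v x) (v z), min (v x) (v z))"
      "\<lambda>(i, j). (max (y i) (y j), min (y i) (y j))"], goal_cases)
    case (1 a)
    obtain i j where a: "a = (i, j)" by force
    from 1 a have ij: "j < i" "i < N" "j < N" by auto
    then show ?case using vy[of i] vy[of j] a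
      by (cases "y i \<le> y j") (auto simp: max_def min_def)
  next
    case (2 a)
    obtain i j where a: "a = (i, j)" by force
    from 2 a have ij: "j < i" "i < N" "j < N" by auto
    show ?case using ne[OF ij(1,2)] ij a by (auto simp: max_def min_def)
  next
    case (3 b)
    then obtain i j where b: "b = (y i, y j)" "i < N" "j < N" "y j < y i" by auto
    then show ?case using vy by (cases "i \<le> j") (auto simp: max_def min_def)
  next
    case (4 b)
    then obtain i j where b: "b = (y i, y j)" "i < N" "j < N" "y j < y i" by auto
    then have "i \<noteq> j" by auto
    then show ?case using b vy by (auto simp: max_def min_def)
  next
    case (5 a)
    then show ?case using sym by (auto simp: max_def min_def)
  qed
  finally show ?thesis .
qed

lemma rising_mult_gap: "rising m x * rising (- m) x = (\<Prod>z<x. gap_factor (m\<^sup>2) x z)"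
  unfolding rising_mult gap_factor_def
  by (rule prod.reindex_bij_witness[of _ "\<lambda>z. x - z" "\<lambda>d. x - d"]) (auto simp: of_nat_diff)

lemma gap_factor_nonzero:
  assumes "m \<notin> \<int>"
  shows "gap_factor (m\<^sup>2) x z \<noteq> 0"
proof
  assume 0: "gap_factor (m\<^sup>2) x z = 0"
  then have "(of_nat x - of_nat z :: complex) \<noteq> 0"
    by (auto simp: gap_factor_def)
  then have "m\<^sup>2 = (of_nat x - of_nat z)\<^sup>2"
    using 0 by (simp add: gap_factor_def)
  then have "m = of_nat x - of_nat z \<or> m = - (of_nat x - of_nat z)"
    by (rule power2_eq_iff[THEN iffD1])
  then show False using assms by auto
qed

text \<open>The row and column factors at a position \<open>x\<close> multiply to the gap factors of
  all \<open>z < x\<close>. Cauchy's product divides by those with \<open>z\<close> in the set as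
  well, and the inversions remain.\<close>

lemma minor_eq_nat_weight_nonint:
  assumes inj: "inj_on y {..<N}" and m: "m \<notin> \<int>"
  shows "minor N m y y = nat_weight (m\<^sup>2) (y ` {..<N})"
proof -
  let ?p = "gap_factor (m\<^sup>2)" and ?X = "y ` {..<N}"
  let ?Q = "{(x, z). x \<in> ?X \<and> z \<in> ?X \<and> z < x}"
  have m0: "m \<noteq> 0" using m by auto
  have ne: "m + of_nat x - of_nat z \<noteq> 0" for x z
  proof
    assume "m + of_nat x - of_nat z = 0"
    then have "m = of_nat z - of_nat x" by (simp add: algebra_simps)
    then show False using m by auto
  qed
  have kernel: "kernel m x z = (m * rising m x) * rising (- m) z * (1 / ((m + of_nat x) - of_nat z))" for x z
    using kernel_closed_form[of m x z] ne[of x z] by (simp add: field_simps)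
  have "minor N m y y = (\<Prod>i<N. m * rising m (y i)) * (\<Prod>j<N. rising (- m) (y j)) *
     ((\<Prod>i<N. 1 / ((m + of_nat (y i)) - of_nat (y i))) *
      (\<Prod>i<N. \<Prod>j<i. ((m + of_nat (y i)) - (m + of_nat (y j))) * (of_nat (y j) - of_nat (y i))
        / (((m + of_nat (y i)) - of_nat (y j)) * ((m + of_nat (y j)) - of_nat (y i)))))"
    unfolding minor_def kernel fdet_scale
    by (subst cauchy_det) (use ne in auto)
  also have "(\<Prod>i<N. \<Prod>j<i. ((m + of_nat (y i)) - (m + of_nat (y j))) * (of_nat (y j) - of_nat (y i))
        / (((m + of_nat (y i)) - of_nat (y j)) * ((m + of_nat (y j)) - of_nat (y i))))
     = (\<Prod>i<N. \<Prod>j<i. 1 / ?p (y i) (y j))"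
  proof (intro prod.cong refl)
    fix i j assume ij: "i \<in> {..<N}" "j \<in> {..<i}"
    define d where "d = (of_nat (y i) - of_nat (y j) :: complex)"
    have "y i \<noteq> y j" using inj_onD[OF inj, of i j] ij by auto
    then have d0: "d \<noteq> 0" by (simp add: d_def)
    have nz: "m + d \<noteq> 0" "m - d \<noteq> 0"
      using ne[of "y i" "y j"] ne[of "y j" "y i"] by (auto simp: d_def algebra_simps)
    have "1 - m\<^sup>2 / d\<^sup>2 = - ((m + d) * (m - d)) / (d * d)"
      using d0 by (simp add: field_simps power2_eq_square)
    then have "d * (- d) / ((m + d) * (m - d)) = 1 / (1 - m\<^sup>2 / d\<^sup>2)"
      using nz d0 by simp
    then show "((m + of_nat (y i)) - (m + of_nat (y j))) * (of_nat (y j) - of_nat (y i))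
        / (((m + of_nat (y i)) - of_nat (y j)) * ((m + of_nat (y j)) - of_nat (y i)))
       = 1 / ?p (y i) (y j)"
      by (simp add: gap_factor_def d_def algebra_simps)
  qed
  also have "\<dots> = 1 / (\<Prod>i<N. \<Prod>j<i. ?p (y i) (y j))"
    by (simp add: prod_dividef)
  also have "(\<Prod>i<N. \<Prod>j<i. ?p (y i) (y j))
     = (\<Prod>(x, z)\<in>?Q. ?p x z)"
    by (rule prod_pairs_reindex[OF inj gap_factor_commute])
  \<comment> \<open>The factors \<open>m\<close> of the rows cancel the diagonal Cauchy entries
    \<open>1 / m\<close>.\<close>
  also have "(\<Prod>i<N. m * rising m (y i)) * (\<Prod>j<N. rising (- m) (y j)) *
     ((\<Prod>i<N. 1 / ((m + of_nat (y i)) - of_nat (y i))) * (1 / (\<Prod>(x, z)\<in>?Q. ?p x z)))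
    = (\<Prod>i<N. rising m (y i) * rising (- m) (y i)) / (\<Prod>(x, z)\<in>?Q. ?p x z)"
    using m0 by (simp add: prod.distrib prod_dividef power_one_over)
  also have "(\<Prod>i<N. rising m (y i) * rising (- m) (y i)) = (\<Prod>x\<in>?X. \<Prod>z<x. ?p x z)"
    unfolding rising_mult_gap by (simp add: prod.reindex[OF inj])
  also have "\<dots> = (\<Prod>(x, z)\<in>Sigma ?X (\<lambda>x. {..<x}). ?p x z)"
    by (rule prod.Sigma) auto
  also have "Sigma ?X (\<lambda>x. {..<x}) = inversions ?X \<union> ?Q"
    by (auto simp: inversions_def)
  also have "(\<Prod>(x, z)\<in>\<dots>. ?p x z)
     = nat_weight (m\<^sup>2) ?X * (\<Prod>(x, z)\<in>?Q. ?p x z)"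
    unfolding nat_weight_def
  proof (rule prod.union_disjoint)
    show "finite (inversions ?X)" by (rule finite_inversions_nat) simp
    show "finite ?Q"
      by (rule finite_subset[of _ "?X \<times> ?X"]) auto
  qed (auto simp: inversions_def)
  finally show ?thesis
  proof -
    assume eq: "minor N m y y = nat_weight (m\<^sup>2) ?X
      * (\<Prod>(x, z)\<in>?Q. ?p x z)
      / (\<Prod>(x, z)\<in>?Q. ?p x z)"
    have "finite ?Q"
      by (rule finite_subset[of _ "?X \<times> ?X"]) auto
    then have "(\<Prod>(x, z)\<in>?Q. ?p x z) \<noteq> 0"
      using gap_factor_nonzero[OF m] by (auto simp: prod_zero_iff)
    then show ?thesis using eq by simp
  qed
qed

text \<open>Both sides are continuous in \<open>m\<close>, and the only integer at distance less
  than 1 from an integer is that integer itself, so the nonintegral case passes to the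
  limit.\<close>

lemma minor_eq_nat_weight:
  assumes inj: "inj_on y {..<N}" and y: "y \<in> tuples N w"
  shows "minor N m y y = nat_weight (m\<^sup>2) (y ` {..<N})"
proof (cases "m \<in> \<int>")
  case True
  let ?f = "\<lambda>m. minor N m y y" and ?g = "\<lambda>m. nat_weight (m\<^sup>2) (y ` {..<N})"
  have f: "?f \<midarrow>m\<rightarrow> ?f m"
    using DERIV_isCont[OF minor_has_derivative[OF y]] by (simp add: isCont_def)
  have g: "?g \<midarrow>m\<rightarrow> ?g m"
    unfolding nat_weight_def gap_factor_def case_prod_beta divide_inverse
    by (intro tendsto_prod tendsto_diff tendsto_mult tendsto_power tendsto_const tendsto_ident_at)
  have "eventually (\<lambda>m'. ?f m' = ?g m') (at m)"
    unfolding eventually_at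
  proof (intro exI[of _ 1] conjI ballI impI)
    fix m' :: complex assume "m' \<noteq> m \<and> dist m' m < 1"
    then have m': "m' \<noteq> m" "dist m' m < 1" by auto
    have "m' \<notin> \<int>"
    proof
      assume "m' \<in> \<int>"
      then obtain a b where ab: "m' = of_int a" "m = of_int b"
        using True by (auto elim!: Ints_cases)
      have "dist m' m = of_int \<bar>a - b\<bar>"
        unfolding ab dist_norm of_int_diff[symmetric] by (simp only: norm_of_int of_int_abs)
      then show False using m' ab by auto
    qed
    then show "?f m' = ?g m'" by (rule minor_eq_nat_weight_nonint[OF inj])
  qed simp
  then have "?g \<midarrow>m\<rightarrow> ?f m" by (rule Lim_transform_eventually[OF f])
  then show ?thesis using tendsto_unique[OF _ _ g] by (metis at_neq_bot)
qed (rule minor_eq_nat_weight_nonint[OF inj])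

definition subsets_sum :: "nat \<Rightarrow> nat \<Rightarrow> nat set set" where
  "subsets_sum N w = {X. finite X \<and> card X = N \<and> \<Sum>X = w}"

lemma finite_subsets_sum [simp]: "finite (subsets_sum N w)"
proof (rule finite_subset)
  show "subsets_sum N w \<subseteq> Pow {..w}"
    by (auto simp: subsets_sum_def intro: member_le_sum[of _ _ "\<lambda>x. x"])
qed simp

text \<open>Each \<open>N\<close>-element set is the image of \<open>fact N\<close> injective
  tuples, and tuples with a repetition contribute 0.\<close>

lemma trace_coeff_eq:
  "trace_coeff N m w = fact N * (\<Sum>X\<in>subsets_sum N w. nat_weight (m\<^sup>2) X)"
proof -
  let ?S = "{y \<in> tuples N w. inj_on y {..<N}}"
  have "trace_coeff N m w = (\<Sum>y\<in>?S. minor N m y y)"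
    unfolding trace_coeff_def
    by (rule sum.mono_neutral_right) (auto intro: minor_row_inj)
  also have "\<dots> = (\<Sum>y\<in>?S. nat_weight (m\<^sup>2) (y ` {..<N}))"
    by (rule sum.cong) (auto intro: minor_eq_nat_weight)
  also have "\<dots> = (\<Sum>X\<in>subsets_sum N w. \<Sum>y\<in>{y \<in> ?S. y ` {..<N} = X}. nat_weight (m\<^sup>2) (y ` {..<N}))"
    by (rule sum.group[symmetric, OF _ finite_subsets_sum])
       (auto simp: subsets_sum_def tuples_sum_image)
  also have "\<dots> = (\<Sum>X\<in>subsets_sum N w. fact N * nat_weight (m\<^sup>2) X)"
  proof (rule sum.cong[OF refl])
    fix X assume "X \<in> subsets_sum N w"
    then have X: "finite X" "card X = N" "\<Sum>X = w" by (auto simp: subsets_sum_def)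
    have "{y \<in> ?S. y ` {..<N} = X} = {y \<in> {..<N} \<rightarrow>\<^sub>E X. inj_on y {..<N}}"
    proof (intro Set.set_eqI iffI)
      fix y assume "y \<in> {y \<in> {..<N} \<rightarrow>\<^sub>E X. inj_on y {..<N}}"
      then have y: "y \<in> {..<N} \<rightarrow>\<^sub>E X" "inj_on y {..<N}" by auto
      then have im: "y ` {..<N} = X"
        using X by (intro card_subset_eq) (auto simp: card_image)
      have "(\<Sum>i<N. y i) = \<Sum>(y ` {..<N})" by (simp add: sum.reindex[OF y(2)])
      then show "y \<in> {y \<in> ?S. y ` {..<N} = X}"
        using y im X by (auto simp: tuples_def PiE_iff)
    qed (auto simp: tuples_def PiE_iff)
    moreover have "card {y \<in> {..<N} \<rightarrow>\<^sub>E X. inj_on y {..<N}} = fact N"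
      using card_inj_on_subset_funcset[of "{..<N}" X "{..<N}"] X
      by (simp add: fact_prod_rev)
    ultimately have "card {y \<in> ?S. y ` {..<N} = X} = fact N" by simp
    then show "(\<Sum>y\<in>{y \<in> ?S. y ` {..<N} = X}. nat_weight (m\<^sup>2) (y ` {..<N}))
       = fact N * nat_weight (m\<^sup>2) X"
      by simp
  qed
  finally show ?thesis by (simp add: sum_distrib_left)
qed

definition nek_coeff :: "nat \<Rightarrow> complex \<Rightarrow> nat \<Rightarrow> complex" where
  "nek_coeff N c n = (\<Sum>X\<in>subsets_sum N (tri N + n). nat_weight c X)"

lemma nek_coeff_has_derivative:
  assumes "n \<le> N"
  shows "((\<lambda>m. nek_coeff N (m\<^sup>2) n) has_field_derivative
     - 2 * m * (\<Sum>i<n. inv_divisor_sum (n - i) * nek_coeff N (m\<^sup>2) i)) (at m)"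
proof -
  have eq: "nek_coeff N (m\<^sup>2) n = trace_coeff N m (tri N + n) / fact N" for m n
    by (simp add: nek_coeff_def trace_coeff_eq)
  show ?thesis
    unfolding eq using DERIV_cdivide[OF trace_coeff_has_derivative[OF assms, of m], of "fact N"]
    by (simp add: sum_divide_distrib[symmetric])
qed

lemma nat_weight_1:
  assumes "finite X" "card X = N"
  shows "nat_weight 1 X = (if X = {..<N} then 1 else 0)"
proof (cases "X = {..<N}")
  case True
  then have "inversions X = {}" by (auto simp: inversions_def)
  then show ?thesis using True by (simp add: nat_weight_def)
next
  case False
  \<comment> \<open>An element directly above a gap gives the factor \<open>1 - 1 / 1 = 0\<close>.
    Without one the set is closed downwards, hence equal to \<open>{..<N}\<close>.\<close>
  have "\<exists>z. z \<notin> X \<and> Suc z \<in> X"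
  proof (rule ccontr)
    assume "\<not> ?thesis"
    then have closed: "Suc z \<in> X \<Longrightarrow> z \<in> X" for z by blast
    have down: "x \<in> X \<Longrightarrow> z \<le> x \<Longrightarrow> z \<in> X" for x z
    proof (induction x)
      case (Suc x)
      then show ?case using closed[of x] by (cases "z = Suc x") auto
    qed simp
    have "X = {..<N}"
    proof (cases "X = {}")
      case False
      define k where "k = Max X"
      have "k \<in> X" "\<And>x. x \<in> X \<Longrightarrow> x \<le> k" using assms(1) False by (auto simp: k_def)
      then have X: "X = {..<Suc k}" using down[of k] by fastforce
      then have "Suc k = N" using assms(2) by simp
      then show ?thesis using X by simp
    qed (use assms(2) in auto)
    then show False using \<open>X \<noteq> {..<N}\<close> by simp
  qed
  then obtain z where "z \<notin> X" "Suc z \<in> X" by auto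
  then have "(Suc z, z) \<in> inversions X" "gap_factor 1 (Suc z) z = 0"
    by (auto simp: inversions_def gap_factor_def)
  then have "nat_weight 1 X = 0"
    unfolding nat_weight_def using finite_inversions_nat[OF assms(1)]
    by (intro prod_zero) (auto intro!: bexI[of _ "(Suc z, z)"])
  then show ?thesis using False by simp
qed

lemma nek_coeff_1: "nek_coeff N 1 n = (if n = 0 then 1 else 0)"
proof -
  have "nek_coeff N 1 n = (\<Sum>X\<in>subsets_sum N (tri N + n). if X = {..<N} then 1 else 0)"
    unfolding nek_coeff_def by (rule sum.cong) (auto simp: subsets_sum_def nat_weight_1)
  also have "\<dots> = (if {..<N} \<in> subsets_sum N (tri N + n) then 1 else 0)"
    by (simp add: sum.delta)
  also have "\<dots> = (if n = 0 then 1 else 0)"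
    by (simp add: subsets_sum_def)
  finally show ?thesis .
qed

section \<open>Solving the differential equation\<close>

text \<open>Minus the logarithm of the Euler product, which \<open>ln_euler\<close>
  confirms.\<close>

definition lambert :: "complex fps" where
  "lambert = Abs_fps inv_divisor_sum"

lemma lambert_0 [simp]: "fps_nth lambert 0 = 0"
  by (simp add: lambert_def inv_divisor_sum_def)

text \<open>The rule that \<open>exp (c F)\<close> has derivative \<open>F exp (c F)\<close> in
  \<open>c\<close>; each coefficient is a polynomial in \<open>c\<close> because \<open>F\<close>
  has no constant term.\<close>

lemma fps_exp_compose_has_derivative:
  fixes F :: "complex fps"
  assumes "fps_nth F 0 = 0"
  shows "((\<lambda>c. fps_nth (fps_exp c oo F) n) has_field_derivative fps_nth (F * (fps_exp c oo F)) n) (at c)"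
proof -
  have pow0: "fps_nth (F ^ i) k = 0" if "k < i" for i k
    using startsby_zero_power_prefix[OF assms, of i] that by blast
  have "((\<lambda>c. fps_nth (fps_exp c oo F) n) has_field_derivative
      (\<Sum>i=0..n. (of_nat i * c ^ (i - 1)) / fact i * fps_nth (F ^ i) n)) (at c)"
    unfolding fps_compose_nth fps_exp_nth
    by (intro DERIV_sum DERIV_cmult_right DERIV_cdivide) (auto intro!: derivative_eq_intros)
  moreover have "(\<Sum>i=0..n. (of_nat i * c ^ (i - 1)) / fact i * fps_nth (F ^ i) n)
      = fps_nth (F * (fps_exp c oo F)) n"
  proof -
    \<comment> \<open>The added term vanishes because \<open>F ^ Suc n\<close> starts in degree
      \<open>Suc n\<close>; it makes room for shifting the index \<open>i\<close>.\<close>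
    have "(\<Sum>i=0..n. (of_nat i * c ^ (i - 1)) / fact i * fps_nth (F ^ i) n)
        = (\<Sum>i=0..Suc n. (of_nat i * c ^ (i - 1)) / fact i * fps_nth (F ^ i) n)"
      using pow0[of n "Suc n"] by simp
    also have "\<dots> = (\<Sum>i=0..n. (of_nat (Suc i) * c ^ i) / fact (Suc i) * fps_nth (F ^ Suc i) n)"
      by (subst sum.atLeast0_atMost_Suc_shift) (simp del: of_nat_Suc fact_Suc power_Suc)
    also have "\<dots> = (\<Sum>i=0..n. c ^ i / fact i * fps_nth (F * F ^ i) n)"
    proof (rule sum.cong[OF refl])
      fix i
      have "of_nat (Suc i) \<noteq> (0 :: complex)" by (rule of_nat_neq_0)
      then show "(of_nat (Suc i) * c ^ i) / fact (Suc i) * fps_nth (F ^ Suc i) n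
          = c ^ i / fact i * fps_nth (F * F ^ i) n"
        by (simp add: fact_Suc del: of_nat_Suc)
    qed
    also have "\<dots> = (\<Sum>j=0..n. fps_nth F j * (\<Sum>i=0..n. c ^ i / fact i * fps_nth (F ^ i) (n - j)))"
      unfolding fps_mult_nth sum_distrib_left by (subst sum.swap) (simp add: mult_ac)
    also have "\<dots> = (\<Sum>j=0..n. fps_nth F j * fps_nth (fps_exp c oo F) (n - j))"
    proof (intro sum.cong refl arg_cong2[where f = "(*)"])
      fix j assume "j \<in> {0..n}"
      show "(\<Sum>i=0..n. c ^ i / fact i * fps_nth (F ^ i) (n - j)) = fps_nth (fps_exp c oo F) (n - j)"
        unfolding fps_compose_nth fps_exp_nth
        by (rule sum.mono_neutral_cong_right) (auto simp: pow0)
    qed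
    finally show ?thesis by (simp add: fps_mult_nth)
  qed
  ultimately show ?thesis by simp
qed

text \<open>On both sides the derivative of coefficient \<open>n\<close> in \<open>m\<close> is the
  same combination of the coefficients \<open>i < n\<close>. By induction the difference is constant
  in \<open>m\<close>, and at \<open>m = 1\<close> it is 0.\<close>

lemma nek_coeff_eq_exp:
  assumes "n \<le> N"
  shows "nek_coeff N (m\<^sup>2) n = fps_nth (fps_exp (1 - m\<^sup>2) oo lambert) n"
  using assms
proof (induction n arbitrary: m rule: less_induct)
  case (less n)
  let ?e = "\<lambda>m i. fps_nth (fps_exp (1 - m\<^sup>2) oo lambert) i"
  have "((\<lambda>m. ?e m n) has_field_derivative
      fps_nth (lambert * (fps_exp (1 - m\<^sup>2) oo lambert)) n * (- 2 * m)) (at m)" for m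
    by (rule DERIV_chain2[OF fps_exp_compose_has_derivative[OF lambert_0]])
       (auto intro!: derivative_eq_intros)
  moreover have "fps_nth (lambert * (fps_exp (1 - m\<^sup>2) oo lambert)) n
      = (\<Sum>i<n. inv_divisor_sum (n - i) * ?e m i)" for m
  proof -
    have "fps_nth (lambert * (fps_exp (1 - m\<^sup>2) oo lambert)) n
       = fps_nth ((fps_exp (1 - m\<^sup>2) oo lambert) * lambert) n"
      by (simp only: mult.commute)
    also have "\<dots> = (\<Sum>i=0..n. ?e m i * fps_nth lambert (n - i))"
      by (rule fps_mult_nth)
    also have "\<dots> = (\<Sum>i<n. ?e m i * fps_nth lambert (n - i))"
      by (rule sum.mono_neutral_right) auto
    finally show ?thesis by (simp add: lambert_def mult.commute)
  qed
  ultimately have e: "((\<lambda>m. ?e m n) has_field_derivative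
      - 2 * m * (\<Sum>i<n. inv_divisor_sum (n - i) * ?e m i)) (at m)" for m
    by (simp add: mult.commute)
  have "((\<lambda>m. nek_coeff N (m\<^sup>2) n) has_field_derivative
      - 2 * m * (\<Sum>i<n. inv_divisor_sum (n - i) * ?e m i)) (at m)" for m
    using nek_coeff_has_derivative[OF less.prems, of m] less by simp
  then have "((\<lambda>m. nek_coeff N (m\<^sup>2) n - ?e m n) has_field_derivative 0) (at m)" for m
    using DERIV_diff[OF _ e[of m]] by fastforce
  then have "\<exists>c. \<forall>m\<in>UNIV. nek_coeff N (m\<^sup>2) n - ?e m n = c"
    by (intro has_field_derivative_zero_constant) auto
  then obtain c where c: "nek_coeff N (m\<^sup>2) n - ?e m n = c" for m by auto
  have "c = 0"
    using c[of 1] by (simp add: nek_coeff_1 fps_compose_0)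
  then show ?case using c[of m] by simp
qed

section \<open>Maya diagrams\<close>

definition maya :: "int set \<Rightarrow> bool" where
  "maya M \<longleftrightarrow> finite (M \<inter> {0..}) \<and> finite ({..<0} - M)"

text \<open>The sum of \<open>f\<close> over \<open>M\<close> regularized by subtracting the vacuum
  \<open>{..<0}\<close>; for a Maya diagram both index sets are finite.\<close>

definition maya_sum :: "(int \<Rightarrow> int) \<Rightarrow> int set \<Rightarrow> int" where
  "maya_sum f M = sum f (M \<inter> {0..}) - sum f ({..<0} - M)"

definition charge :: "int set \<Rightarrow> int" where
  "charge M = maya_sum (\<lambda>_. 1) M"

text \<open>A full half-line with a finite set above it. Every Maya diagram has this form, and
  statements about it reduce to finite sets of naturals.\<close>

definition beads :: "int \<Rightarrow> nat set \<Rightarrow> int set" where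
  "beads K X = {..<- K} \<union> (\<lambda>x. int x - K) ` X"

definition int_weight :: "complex \<Rightarrow> int set \<Rightarrow> complex" where
  "int_weight c M = (\<Prod>(i, j)\<in>inversions M. 1 - c / (of_int (i - j))\<^sup>2)"

lemma beads_iff: "j \<in> beads K X \<longleftrightarrow> j < - K \<or> (0 \<le> j + K \<and> nat (j + K) \<in> X)"
proof
  assume "j < - K \<or> (0 \<le> j + K \<and> nat (j + K) \<in> X)"
  then show "j \<in> beads K X"
    by (auto simp: beads_def image_iff intro!: bexI[of _ "nat (j + K)"])
qed (auto simp: beads_def)

lemma maya_beads: "finite X \<Longrightarrow> maya (beads K X)"
  unfolding maya_def
proof
  assume X: "finite X"
  have "beads K X \<inter> {0..} \<subseteq> {0..<- K} \<union> (\<lambda>x. int x - K) ` X" by (auto simp: beads_def)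
  then show "finite (beads K X \<inter> {0..})" by (rule finite_subset) (use X in auto)
  have "{..<0} - beads K X \<subseteq> {- K..<0}" by (auto simp: beads_def)
  then show "finite ({..<0} - beads K X)" by (rule finite_subset) auto
qed

lemma maya_beadsE:
  assumes "maya M" "{..<- K} \<subseteq> M"
  obtains X where "finite X" "M = beads K X"
proof
  let ?X = "{x. int x - K \<in> M}"
  have "int ` ?X \<subseteq> (\<lambda>j. j + K) ` ((M \<inter> {0..}) \<union> {- K..<0})"
  proof
    fix a assume "a \<in> int ` ?X"
    then have "a - K \<in> (M \<inter> {0..}) \<union> {- K..<0}" by auto
    then show "a \<in> (\<lambda>j. j + K) ` ((M \<inter> {0..}) \<union> {- K..<0})"
      by (intro image_eqI[of _ _ "a - K"]) auto
  qed
  moreover have "finite ((\<lambda>j. j + K) ` ((M \<inter> {0..}) \<union> {- K..<0}))"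
    using assms(1) by (auto simp: maya_def)
  ultimately have "finite (int ` ?X)" by (rule finite_subset)
  then show "finite ?X" by (rule finite_imageD) auto
  show "M = beads K ?X"
    using assms(2) by (auto simp: beads_iff)
qed

lemma maya_lower_bound:
  assumes "maya M"
  obtains K where "K \<ge> K0" "{..<- K} \<subseteq> M"
proof
  let ?H = "{..<0} - M"
  define K where "K = max K0 (- Min (insert 0 ?H))"
  have fin: "finite (insert 0 ?H)" using assms by (auto simp: maya_def)
  show "K \<ge> K0" by (simp add: K_def)
  show "{..<- K} \<subseteq> M"
  proof
    fix j assume "j \<in> {..<- K}"
    then have j: "j < Min (insert 0 ?H)" by (auto simp: K_def)
    then have "j < 0" using Min_le[OF fin, of 0] by simp
    moreover have "j \<notin> ?H" using j Min_le[OF fin, of j] by auto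
    ultimately show "j \<in> M" by auto
  qed
qed

lemma maya_eq_beads:
  assumes "maya M"
  obtains K X where "K \<ge> K0" "finite X" "M = beads K X"
  by (metis assms maya_lower_bound maya_beadsE)

lemma beads_shift: "(\<lambda>j. j + c) ` beads K X = beads (K - c) X"
proof (intro Set.set_eqI iffI)
  fix j assume "j \<in> beads (K - c) X"
  then have "j - c \<in> beads K X" by (auto simp: beads_iff algebra_simps)
  then show "j \<in> (\<lambda>j. j + c) ` beads K X" by (rule image_eqI[rotated]) simp
qed (auto simp: beads_iff algebra_simps)

text \<open>Only the position \<open>- 1\<close> crosses the origin: if occupied it becomes a
  counted bead at 0, if empty a counted hole disappears. Either way \<open>f 0\<close> is
  gained.\<close>

lemma maya_sum_shift:
  assumes "maya M"
  shows "maya_sum f ((\<lambda>j. j + 1) ` M) = maya_sum (\<lambda>j. f (j + 1)) M + f 0"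
proof -
  let ?s = "\<lambda>j :: int. j + 1"
  have fin: "finite (M \<inter> {0..})" "finite ({..<0} - M)"
    using assms by (auto simp: maya_def)
  have inj: "inj_on ?s A" for A by (auto intro: inj_onI)
  have pos: "?s ` M \<inter> {0..} = ?s ` (M \<inter> {0..}) \<union> (if - 1 \<in> M then {0} else {})"
  proof (intro Set.set_eqI iffI)
    fix j assume "j \<in> ?s ` M \<inter> {0..}"
    then obtain i where i: "j = i + 1" "i \<in> M" "0 \<le> i + 1" by auto
    then show "j \<in> ?s ` (M \<inter> {0..}) \<union> (if - 1 \<in> M then {0} else {})"
      by (cases "i = - 1") auto
  qed (auto split: if_splits intro: image_eqI[of _ _ "- 1"])
  have neg: "?s ` ({..<0} - M) = ({..<0} - ?s ` M) \<union> (if - 1 \<in> M then {} else {0})"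
  proof (intro Set.set_eqI iffI)
    fix j assume j: "j \<in> ({..<0} - ?s ` M) \<union> (if - 1 \<in> M then {} else {0})"
    then have "j - 1 \<in> {..<0} - M" by (auto split: if_splits simp: image_iff)
    then show "j \<in> ?s ` ({..<0} - M)" by (rule image_eqI[rotated]) simp
  next
    fix j assume "j \<in> ?s ` ({..<0} - M)"
    then obtain i where i: "j = i + 1" "i < 0" "i \<notin> M" by auto
    then have "j \<notin> ?s ` M" by auto
    then show "j \<in> ({..<0} - ?s ` M) \<union> (if - 1 \<in> M then {} else {0})"
      using i by (cases "i = - 1") auto
  qed
  have "sum f (?s ` M \<inter> {0..}) = sum (\<lambda>j. f (j + 1)) (M \<inter> {0..}) + (if - 1 \<in> M then f 0 else 0)"
    unfolding pos using fin
    by (subst sum.union_disjoint) (auto simp: sum.reindex[OF inj])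
  moreover have "sum (\<lambda>j. f (j + 1)) ({..<0} - M)
      = sum f ({..<0} - ?s ` M) + (if - 1 \<in> M then 0 else f 0)"
  proof -
    have "sum (\<lambda>j. f (j + 1)) ({..<0} - M) = sum f (?s ` ({..<0} - M))"
      by (simp add: sum.reindex[OF inj])
    also have "\<dots> = sum f ({..<0} - ?s ` M) + (if - 1 \<in> M then 0 else f 0)"
    proof -
      have "finite ({..<0} - ?s ` M)"
        using fin(2) neg by (metis finite_Un finite_imageI)
      then show ?thesis unfolding neg by (subst sum.union_disjoint) auto
    qed
    finally show ?thesis .
  qed
  ultimately show ?thesis unfolding maya_sum_def by auto
qed

lemma maya_sum_beads:
  assumes "finite X"
  shows "maya_sum f (beads (int N) X) = (\<Sum>x\<in>X. f (int x - int N)) - (\<Sum>i=1..N. f (- int i))"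
proof (induction N arbitrary: f)
  case 0
  have inj: "inj_on int X" by auto
  have eqs: "beads 0 X \<inter> {0..} = int ` X" "{..<0} - beads 0 X = {}" by (auto simp: beads_def)
  show ?case unfolding maya_sum_def of_nat_0 eqs by (simp add: sum.reindex[OF inj])
next
  case (Suc N)
  have "(\<lambda>j. j + 1) ` beads (int (Suc N)) X = beads (int N) X"
    by (simp add: beads_shift)
  then have "maya_sum (\<lambda>j. f (j - 1)) (beads (int N) X) = maya_sum f (beads (int (Suc N)) X) + f (- 1)"
    using maya_sum_shift[OF maya_beads[OF assms], of "\<lambda>j. f (j - 1)" "int (Suc N)"] by simp
  moreover have "(\<Sum>i=1..Suc N. f (- int i)) = f (- 1) + (\<Sum>i=1..N. f (- int i - 1))"
  proof -
    have "(\<Sum>i=1..Suc N. f (- int i)) = (\<Sum>i=0..N. f (- int (Suc i)))"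
      using sum.atLeast_Suc_atMost_Suc_shift[of "\<lambda>i. f (- int i)" 0 N]
      by (simp add: o_def del: sum.cl_ivl_Suc)
    also have "\<dots> = f (- int (Suc 0)) + (\<Sum>i=Suc 0..N. f (- int (Suc i)))"
      by (rule sum.atLeast_Suc_atMost) simp
    also have "(\<Sum>i=Suc 0..N. f (- int (Suc i))) = (\<Sum>i=1..N. f (- int i - 1))"
      by (intro sum.cong arg_cong[where f = f]) auto
    finally show ?thesis by simp
  qed
  ultimately show ?case using Suc.IH[of "\<lambda>j. f (j - 1)"]
    by (simp add: algebra_simps)
qed

lemma charge_beads:
  assumes "finite X"
  shows "charge (beads K X) = int (card X) - K"
proof (induction K rule: int_induct[of _ 0])
  case base
  then show ?case using maya_sum_beads[OF assms, of "\<lambda>_. 1" 0] by (simp add: charge_def)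
next
  case (step1 K)
  have "charge (beads K X) = charge (beads (K + 1) X) + 1"
    unfolding charge_def
    using maya_sum_shift[OF maya_beads[OF assms], of "\<lambda>_. 1" "K + 1"] by (simp add: beads_shift)
  then show ?case using step1 by simp
next
  case (step2 K)
  have "charge (beads (K - 1) X) = charge (beads K X) + 1"
    unfolding charge_def
    using maya_sum_shift[OF maya_beads[OF assms], of "\<lambda>_. 1" "K"] by (simp add: beads_shift)
  then show ?case using step2 by simp
qed

lemma energy_beads:
  assumes "finite X"
  shows "2 * maya_sum (\<lambda>j. j) (beads K X) = 2 * int (\<Sum>X) - 2 * K * int (card X) + K * (K + 1)"
proof (induction K rule: int_induct[of _ 0])
  case base
  then show ?case using maya_sum_beads[OF assms, of "\<lambda>j. j" 0] by simp
next
  case (step1 K)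
  have "maya_sum (\<lambda>j. j) (beads K X) = maya_sum (\<lambda>j. j + 1) (beads (K + 1) X)"
    using maya_sum_shift[OF maya_beads[OF assms], of "\<lambda>j. j" "K + 1"] by (simp add: beads_shift)
  also have "\<dots> = maya_sum (\<lambda>j. j) (beads (K + 1) X) + charge (beads (K + 1) X)"
    by (simp add: maya_sum_def charge_def sum.distrib)
  finally show ?case using step1 by (simp add: charge_beads[OF assms] algebra_simps)
next
  case (step2 K)
  have "maya_sum (\<lambda>j. j) (beads (K - 1) X) = maya_sum (\<lambda>j. j + 1) (beads K X)"
    using maya_sum_shift[OF maya_beads[OF assms], of "\<lambda>j. j" K] by (simp add: beads_shift)
  also have "\<dots> = maya_sum (\<lambda>j. j) (beads K X) + charge (beads K X)"
    by (simp add: maya_sum_def charge_def sum.distrib)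
  finally show ?case using step2 by (simp add: charge_beads[OF assms] algebra_simps)
qed

lemma inversions_beads:
  "inversions (beads K X) = (\<lambda>(x, z). (int x - K, int z - K)) ` inversions X"
proof (intro Set.set_eqI iffI)
  fix p assume "p \<in> inversions (beads K X)"
  then obtain i j where p: "p = (i, j)" "i \<in> beads K X" "j \<notin> beads K X" "j < i"
    by (auto simp: inversions_def)
  then have "(nat (i + K), nat (j + K)) \<in> inversions X" "0 \<le> i + K" "0 \<le> j + K"
    by (auto simp: inversions_def beads_iff)
  then show "p \<in> (\<lambda>(x, z). (int x - K, int z - K)) ` inversions X"
    using p(1) by (intro image_eqI[of _ _ "(nat (i + K), nat (j + K))"]) auto
qed (auto simp: inversions_def beads_iff)

lemma inj_beads_pair: "inj_on (\<lambda>(x, z). (int x - K, int z - K)) A"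
  by (auto intro!: inj_onI)

lemma card_inversions_beads: "card (inversions (beads K X)) = card (inversions X)"
  unfolding inversions_beads by (rule card_image[OF inj_beads_pair])

lemma int_weight_beads: "int_weight c (beads K X) = nat_weight c X"
  unfolding int_weight_def nat_weight_def inversions_beads
  by (subst prod.reindex[OF inj_beads_pair])
     (auto intro!: prod.cong simp: gap_factor_def case_prod_beta)

lemma finite_inversions_maya: "maya M \<Longrightarrow> finite (inversions M)"
  by (metis maya_eq_beads inversions_beads finite_inversions_nat finite_imageI)

text \<open>An element \<open>x\<close> is the number of all \<open>z < x\<close>. Those outside
  \<open>X\<close> are inversions, those inside add up to \<open>tri (card X)\<close>.\<close>

lemma sum_eq_inversions:
  fixes X :: "nat set"
  assumes "finite X"
  shows "\<Sum>X = card (inversions X) + tri (card X)"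
proof -
  have pairs: "(\<Sum>x\<in>X. card {z\<in>X. z < x}) = tri (card X)"
    using assms
  proof (induction X rule: finite_linorder_max_induct)
    case (insert b A)
    have b: "b \<notin> A" using insert by auto
    have "{z \<in> insert b A. z < b} = A" using insert by auto
    moreover have "{z \<in> insert b A. z < x} = {z \<in> A. z < x}" if "x \<in> A" for x
      using that insert by auto
    ultimately show ?case using insert b by (simp add: add.commute)
  qed simp
  have "\<Sum>X = (\<Sum>x\<in>X. card {z. z \<notin> X \<and> z < x} + card {z\<in>X. z < x})"
  proof (rule sum.cong[OF refl])
    fix x assume "x \<in> X"
    have "{..<x} = {z. z \<notin> X \<and> z < x} \<union> {z\<in>X. z < x}" by auto
    then have "card {..<x} = card ({z. z \<notin> X \<and> z < x} \<union> {z\<in>X. z < x})" by simp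
    also have "\<dots> = card {z. z \<notin> X \<and> z < x} + card {z\<in>X. z < x}"
      by (rule card_Un_disjoint) auto
    finally show "x = card {z. z \<notin> X \<and> z < x} + card {z\<in>X. z < x}" by simp
  qed
  also have "\<dots> = (\<Sum>x\<in>X. card {z. z \<notin> X \<and> z < x}) + tri (card X)"
    by (simp add: sum.distrib pairs)
  also have "(\<Sum>x\<in>X. card {z. z \<notin> X \<and> z < x}) = card (Sigma X (\<lambda>x. {z. z \<notin> X \<and> z < x}))"
    using assms by simp
  also have "Sigma X (\<lambda>x. {z. z \<notin> X \<and> z < x}) = inversions X"
    by (auto simp: inversions_def)
  finally show ?thesis .
qed

text \<open>The ground state of charge \<open>c\<close> is \<open>{..<c}\<close> with energy
  \<open>c (c - 1) / 2\<close>, and every inversion adds 1.\<close>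

lemma maya_energy:
  assumes "maya M"
  shows "2 * maya_sum (\<lambda>j. j) M = 2 * int (card (inversions M)) + charge M * (charge M - 1)"
proof -
  obtain K X where KX: "finite X" "M = beads K X" by (rule maya_eq_beads[OF assms])
  have tri: "2 * int (\<Sum>i<n. i) = int n * (int n - 1)" for n
    by (induction n) (auto simp: algebra_simps)
  show ?thesis
    unfolding KX(2) energy_beads[OF KX(1)] charge_beads[OF KX(1)] card_inversions_beads
      sum_eq_inversions[OF KX(1)]
    using tri[of "card X"] by (simp add: algebra_simps)
qed

lemma charge_shift: "maya M \<Longrightarrow> charge ((\<lambda>j. j + c) ` M) = charge M + c"
  by (elim maya_eq_beads) (simp add: beads_shift charge_beads)

lemma maya_shift: "maya M \<Longrightarrow> maya ((\<lambda>j. j + c) ` M)"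
  by (elim maya_eq_beads) (simp add: beads_shift maya_beads)

lemma card_inversions_shift: "maya M \<Longrightarrow> card (inversions ((\<lambda>j. j + c) ` M)) = card (inversions M)"
  by (elim maya_eq_beads) (simp add: beads_shift card_inversions_beads)

lemma int_weight_shift: "maya M \<Longrightarrow> int_weight w ((\<lambda>j. j + c) ` M) = int_weight w M"
  by (elim maya_eq_beads) (simp add: beads_shift int_weight_beads)

text \<open>A diagram of charge \<open>c\<close> with a hole below \<open>c - N\<close> has more
  than \<open>N\<close> elements above that hole, hence more than \<open>n\<close> inversions. So
  every diagram in the target is full below \<open>c - N\<close> and comes from a finite
  set.\<close>

lemma maya_charge_bij:
  assumes "n \<le> N"
  shows "bij_betw (beads (int N - c)) (subsets_sum N (tri N + n))
     {M. maya M \<and> charge M = c \<and> card (inversions M) = n}"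
  unfolding bij_betw_def
proof
  let ?K = "int N - c"
  show "inj_on (beads ?K) (subsets_sum N (tri N + n))"
  proof (rule inj_onI)
    fix X Y assume eq: "beads ?K X = beads ?K Y"
    have "x \<in> X \<longleftrightarrow> int x - ?K \<in> beads ?K X" for x X by (simp add: beads_iff)
    then show "X = Y" using eq by auto
  qed
  show "beads ?K ` subsets_sum N (tri N + n) = {M. maya M \<and> charge M = c \<and> card (inversions M) = n}"
  proof (intro Set.set_eqI iffI)
    fix M assume "M \<in> beads ?K ` subsets_sum N (tri N + n)"
    then obtain X where X: "M = beads ?K X" "finite X" "card X = N" "\<Sum>X = tri N + n"
      by (auto simp: subsets_sum_def)
    then show "M \<in> {M. maya M \<and> charge M = c \<and> card (inversions M) = n}"
      using sum_eq_inversions[OF X(2)]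
      by (simp add: maya_beads charge_beads card_inversions_beads)
  next
    fix M assume "M \<in> {M. maya M \<and> charge M = c \<and> card (inversions M) = n}"
    then have M: "maya M" "charge M = c" "card (inversions M) = n" by auto
    obtain L X0 where L: "L \<ge> ?K" "finite X0" "M = beads L X0"
      by (rule maya_eq_beads[OF M(1)])
    have card0: "int (card X0) = c + L" using M(2) L charge_beads[OF L(2), of L] by simp
    have "{..<- ?K} \<subseteq> M"
    proof (rule ccontr)
      assume "\<not> {..<- ?K} \<subseteq> M"
      then obtain j where j: "j < - ?K" "j \<notin> M" by auto
      then have j0: "0 \<le> j + L" "nat (j + L) \<notin> X0" using L(3) by (auto simp: beads_iff)
      define y where "y = nat (j + L)"
      have "X0 \<subseteq> {x \<in> X0. y < x} \<union> {..<y}" using j0 by (auto simp: y_def not_less le_less)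
      then have "card X0 \<le> card ({x \<in> X0. y < x} \<union> {..<y})" using L(2) by (intro card_mono) auto
      also have "\<dots> \<le> card {x \<in> X0. y < x} + y" using card_Un_le[of "{x\<in>X0. y < x}" "{..<y}"] by simp
      finally have 1: "card X0 \<le> card {x \<in> X0. y < x} + y" .
      have "(\<lambda>x. (x, y)) ` {x \<in> X0. y < x} \<subseteq> inversions X0"
        using j0 by (auto simp: inversions_def y_def)
      then have "card ((\<lambda>x. (x, y)) ` {x \<in> X0. y < x}) \<le> card (inversions X0)"
        by (rule card_mono[OF finite_inversions_nat[OF L(2)]])
      moreover have "card ((\<lambda>x. (x, y)) ` {x \<in> X0. y < x}) = card {x \<in> X0. y < x}"
        by (rule card_image) (auto intro: inj_onI)
      ultimately have 2: "card {x \<in> X0. y < x} \<le> n"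
        using M(3) L(3) by (simp add: card_inversions_beads)
      have "int y = j + L" using j0 by (simp add: y_def)
      then show False using 1 2 card0 j(1) assms by linarith
    qed
    then obtain X where X: "finite X" "M = beads ?K X" by (rule maya_beadsE[OF M(1)])
    have "card X = N" using M(2) X(2) charge_beads[OF X(1), of ?K] by simp
    then have "X \<in> subsets_sum N (tri N + n)"
      using X sum_eq_inversions[OF X(1)] M(3) by (simp add: subsets_sum_def card_inversions_beads)
    then show "M \<in> beads ?K ` subsets_sum N (tri N + n)" using X(2) by blast
  qed
qed

lemma finite_maya_charge: "finite {M. maya M \<and> charge M = c \<and> card (inversions M) = n}"
  using bij_betw_finite[OF maya_charge_bij[OF order_refl]] by simp

theorem nekrasov_okounkov:
  "(\<Sum>M | maya M \<and> charge M = c \<and> card (inversions M) = n. int_weight z M)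
     = fps_nth (fps_exp (1 - z) oo lambert) n"
proof -
  have "(\<Sum>M | maya M \<and> charge M = c \<and> card (inversions M) = n. int_weight z M) = nek_coeff n z n"
    unfolding nek_coeff_def
    by (subst sum.reindex_bij_betw[OF maya_charge_bij[OF order_refl], symmetric])
       (simp add: int_weight_beads)
  also have "\<dots> = fps_nth (fps_exp (1 - z) oo lambert) n"
    \<comment> \<open>The root of \<open>z\<close> plays the role of \<open>m\<close>, and
      \<open>N = n\<close> is the smallest degree in the admissible range.\<close>
    using nek_coeff_eq_exp[of n n "csqrt z"] by simp
  finally show ?thesis .
qed

section \<open>Self-conjugate partitions as symmetric Maya diagrams\<close>

definition row_pos :: "nat list \<Rightarrow> nat \<Rightarrow> int" where
  "row_pos lam i = int (part lam i) - int i"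

text \<open>The positions missing from the Maya diagram, numbered by columns, so that the
  hook-length of \<open>(i, j)\<close> is \<open>row_pos lam i - col_pos lam j\<close>.\<close>

definition col_pos :: "nat list \<Rightarrow> nat \<Rightarrow> int" where
  "col_pos lam j = int j - 1 - int (conj_part lam j)"

text \<open>All \<open>i \<ge> 1\<close> are allowed: beyond the last row \<open>part\<close> is 0,
  and these indices fill the negative half-line.\<close>

definition maya_of :: "nat list \<Rightarrow> int set" where
  "maya_of lam = row_pos lam ` {1..}"

lemma part_0: "i > length lam \<Longrightarrow> part lam i = 0"
  by (simp add: part_def)

lemma part_pos: "is_partition lam \<Longrightarrow> 1 \<le> i \<Longrightarrow> i \<le> length lam \<Longrightarrow> part lam i > 0"
  by (auto simp: part_def is_partition_def)

lemma part_antimono: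
  assumes "is_partition lam" "1 \<le> i" "i \<le> j"
  shows "part lam j \<le> part lam i"
proof (cases "i = j \<or> j > length lam")
  case False
  then have "i - 1 < j - 1" "j - 1 < length lam" using assms by auto
  then have "lam ! (j - 1) \<le> lam ! (i - 1)"
    using assms(1) by (auto simp: is_partition_def sorted_wrt_iff_nth_less)
  then show ?thesis using False assms by (simp add: part_def)
qed (auto simp: part_0)

lemma row_pos_strict: "is_partition lam \<Longrightarrow> 1 \<le> i \<Longrightarrow> i < j \<Longrightarrow> row_pos lam j < row_pos lam i"
  using part_antimono[of lam i j] by (simp add: row_pos_def)

lemma down_closed_eq:
  fixes A :: "nat set"
  assumes "finite A" "0 \<notin> A" "\<And>i k. i \<in> A \<Longrightarrow> 1 \<le> k \<Longrightarrow> k \<le> i \<Longrightarrow> k \<in> A"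
  shows "A = {1..card A}"
proof (cases "A = {}")
  case False
  define m where "m = Max A"
  have m: "m \<in> A" "\<And>i. i \<in> A \<Longrightarrow> i \<le> m" using assms(1) False by (auto simp: m_def)
  have "A = {1..m}"
  proof (intro Set.set_eqI iffI)
    fix i assume "i \<in> A"
    moreover have "i \<noteq> 0" using \<open>i \<in> A\<close> assms(2) by metis
    ultimately show "i \<in> {1..m}" using m(2) by auto
  next
    fix i assume "i \<in> {1..m}"
    then show "i \<in> A" using assms(3)[OF m(1)] by auto
  qed
  moreover from this have "card A = m" by simp
  ultimately show ?thesis by simp
qed simp

text \<open>As parts decrease, the rows that reach column \<open>j\<close> form an initial segment,
  whose length is \<open>conj_part lam j\<close>.\<close>

lemma conj_part_galois:
  assumes "is_partition lam" "1 \<le> i" "1 \<le> j"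
  shows "i \<le> conj_part lam j \<longleftrightarrow> j \<le> part lam i"
proof -
  let ?A = "{i. 1 \<le> i \<and> i \<le> length lam \<and> j \<le> part lam i}"
  have mem: "k \<in> ?A \<longleftrightarrow> 1 \<le> k \<and> j \<le> part lam k" for k
    using part_0[of lam k] assms(3) by (cases "k \<le> length lam") auto
  have "?A = {1..card ?A}"
  proof (rule down_closed_eq)
    show "finite ?A" by (rule finite_subset[of _ "{..length lam}"]) auto
    fix k l assume "k \<in> ?A" "1 \<le> l" "l \<le> k"
    then show "l \<in> ?A" using part_antimono[OF assms(1), of l k] by (auto simp: mem)
  qed auto
  then have "i \<in> ?A \<longleftrightarrow> i \<in> {1..conj_part lam j}" by (simp only: conj_part_def)
  then show ?thesis using assms(2) unfolding mem by auto
qed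

lemma conj_part_antimono:
  assumes "is_partition lam" "1 \<le> j" "j \<le> k"
  shows "conj_part lam k \<le> conj_part lam j"
proof (cases "conj_part lam k = 0")
  case False
  then show ?thesis
    using conj_part_galois[OF assms(1), of "conj_part lam k" k]
      conj_part_galois[OF assms(1), of "conj_part lam k" j] assms by auto
qed simp

lemma col_less_row_iff:
  assumes "is_partition lam" "1 \<le> i" "1 \<le> j"
  shows "col_pos lam j < row_pos lam i \<longleftrightarrow> j \<le> part lam i"
  using conj_part_galois[OF assms] by (auto simp: col_pos_def row_pos_def)

lemma col_neq_row:
  assumes "is_partition lam" "1 \<le> i" "1 \<le> j"
  shows "col_pos lam j \<noteq> row_pos lam i"
  using conj_part_galois[OF assms] by (auto simp: col_pos_def row_pos_def)

text \<open>A missing position \<open>y\<close> separates the first \<open>p\<close> rows, which lie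
  above it, from the others; these \<open>p\<close> rows are exactly the ones that reach a certain
  column \<open>j\<close>.\<close>

lemma not_maya_of_iff:
  assumes "is_partition lam"
  shows "y \<notin> maya_of lam \<longleftrightarrow> (\<exists>j\<ge>1. y = col_pos lam j)"
proof
  assume y: "y \<notin> maya_of lam"
  then have ne: "row_pos lam i \<noteq> y" if "i \<ge> 1" for i using that by (auto simp: maya_of_def)
  let ?A = "{i. 1 \<le> i \<and> y < row_pos lam i}"
  define p where "p = card ?A"
  have A: "?A = {1..p}" unfolding p_def
  proof (rule down_closed_eq)
    have "?A \<subseteq> {..nat (int (part lam 1) - y)}"
    proof
      fix i assume "i \<in> ?A"
      then show "i \<in> {..nat (int (part lam 1) - y)}"
        using part_antimono[OF assms, of 1 i] by (auto simp: row_pos_def)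
    qed
    then show "finite ?A" by (rule finite_subset) simp
    fix i k assume "i \<in> ?A" "1 \<le> k" "k \<le> i"
    then show "k \<in> ?A" using row_pos_strict[OF assms, of k i] by (cases "k = i") auto
  qed auto
  have "p + 1 \<notin> {1..p}" by simp
  then have "p + 1 \<notin> ?A" using A by (simp only:) simp
  then have up: "row_pos lam (p + 1) < y" using ne[of "p + 1"] by auto
  \<comment> \<open>Solves \<open>y = col_pos lam j\<close> under the expectation
    \<open>conj_part lam j = p\<close>, which is verified next.\<close>
  define j where "j = nat (y + 1 + int p)"
  have j: "int j = y + 1 + int p" "1 \<le> j" using up by (auto simp: j_def row_pos_def)
  have "i \<le> conj_part lam j \<longleftrightarrow> i \<le> p" if i: "1 \<le> i" for i
  proof -
    have "j \<le> part lam i \<longleftrightarrow> i \<le> p"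
    proof
      assume "i \<le> p"
      then have "p \<in> ?A" using A i by auto
      then have "j \<le> part lam p" using j by (simp add: row_pos_def)
      then show "j \<le> part lam i" using part_antimono[OF assms i \<open>i \<le> p\<close>] by simp
    next
      assume ji: "j \<le> part lam i"
      show "i \<le> p"
      proof (rule ccontr)
        assume "\<not> i \<le> p"
        then have "part lam i \<le> part lam (p + 1)" by (intro part_antimono[OF assms]) auto
        then show False using up ji j by (simp add: row_pos_def)
      qed
    qed
    then show ?thesis using conj_part_galois[OF assms i j(2)] by simp
  qed
  from this[of p] this[of "conj_part lam j"] have "conj_part lam j = p"
    by (cases "p = 0"; cases "conj_part lam j = 0") auto
  then have "y = col_pos lam j" using j by (simp add: col_pos_def)
  then show "\<exists>j\<ge>1. y = col_pos lam j" using j by blast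
next
  assume "\<exists>j\<ge>1. y = col_pos lam j"
  then show "y \<notin> maya_of lam" using col_neq_row[OF assms] by (auto simp: maya_of_def)
qed

lemma diagram_bij_inversions:
  assumes "is_partition lam"
  shows "bij_betw (\<lambda>(i, j). (row_pos lam i, col_pos lam j)) (diagram lam) (inversions (maya_of lam))"
  unfolding bij_betw_def
proof
  let ?h = "\<lambda>(i, j). (row_pos lam i, col_pos lam j)"
  have diag: "(i, j) \<in> diagram lam \<longleftrightarrow> 1 \<le> i \<and> 1 \<le> j \<and> j \<le> part lam i" for i j
    using part_0[of lam i] by (cases "i \<le> length lam") (auto simp: diagram_def)
  have row_inj: "i = i'" if "1 \<le> i" "1 \<le> i'" "row_pos lam i = row_pos lam i'" for i i'
    using row_pos_strict[OF assms, of i i'] row_pos_strict[OF assms, of i' i] that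
    by (cases i i' rule: linorder_cases) auto
  have col_inj: "j = j'" if "1 \<le> j" "1 \<le> j'" "col_pos lam j = col_pos lam j'" for j j'
    using conj_part_antimono[OF assms, of j j'] conj_part_antimono[OF assms, of j' j] that
    by (cases j j' rule: linorder_cases) (auto simp: col_pos_def)
  show "inj_on ?h (diagram lam)"
    by (rule inj_onI) (auto simp: diag intro: row_inj col_inj)
  show "?h ` diagram lam = inversions (maya_of lam)"
  proof (intro Set.set_eqI iffI)
    fix q assume "q \<in> ?h ` diagram lam"
    then obtain i j where q: "q = (row_pos lam i, col_pos lam j)" "1 \<le> i" "1 \<le> j" "j \<le> part lam i"
      by (auto simp: diag)
    moreover have "row_pos lam i \<in> maya_of lam" using q(2) by (auto simp: maya_of_def)
    moreover have "col_pos lam j \<notin> maya_of lam" using not_maya_of_iff[OF assms] q(3) by blast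
    ultimately show "q \<in> inversions (maya_of lam)"
      using col_less_row_iff[OF assms q(2,3)] by (simp add: inversions_def)
  next
    fix q assume "q \<in> inversions (maya_of lam)"
    then obtain x y where q: "q = (x, y)" "x \<in> maya_of lam" "y \<notin> maya_of lam" "y < x"
      by (auto simp: inversions_def)
    from q(2) obtain i where i: "1 \<le> i" "x = row_pos lam i" by (auto simp: maya_of_def)
    from q(3) obtain j where j: "1 \<le> j" "y = col_pos lam j" using not_maya_of_iff[OF assms] by auto
    have "(i, j) \<in> diagram lam"
      using col_less_row_iff[OF assms i(1) j(1)] q(4) i j by (simp add: diag)
    then show "q \<in> ?h ` diagram lam"
      using q(1) i(2) j(2) by force
  qed
qed

lemma finite_diagram: "finite (diagram lam)"
proof -
  have "diagram lam = Sigma {1..length lam} (\<lambda>i. {1..part lam i})"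
    by (auto simp: diagram_def)
  then show ?thesis by simp
qed

lemma hook_eq:
  assumes "is_partition lam" "(i, j) \<in> diagram lam"
  shows "hook lam (i, j) = nat (row_pos lam i - col_pos lam j)"
proof -
  have ij: "1 \<le> i" "1 \<le> j" "j \<le> part lam i" using assms(2) by (auto simp: diagram_def)
  then have "i \<le> conj_part lam j" using conj_part_galois[OF assms(1)] by simp
  then show ?thesis using ij by (simp add: hook_def row_pos_def col_pos_def)
qed

lemma hooks_eq_inversions:
  assumes "is_partition lam"
  shows "image_mset (hook lam) (mset_set (diagram lam))
     = image_mset (\<lambda>(x, y). nat (x - y)) (mset_set (inversions (maya_of lam)))"
proof -
  let ?h = "\<lambda>(i, j). (row_pos lam i, col_pos lam j)"
  have bij: "inj_on ?h (diagram lam)" "?h ` diagram lam = inversions (maya_of lam)"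
    using diagram_bij_inversions[OF assms] by (auto simp: bij_betw_def)
  have "image_mset (\<lambda>(x, y). nat (x - y)) (mset_set (inversions (maya_of lam)))
     = image_mset (\<lambda>(x, y). nat (x - y)) (image_mset ?h (mset_set (diagram lam)))"
    using image_mset_mset_set[OF bij(1)] bij(2) by simp
  also have "\<dots> = image_mset (hook lam) (mset_set (diagram lam))"
    unfolding multiset.map_comp
    by (rule image_mset_cong) (auto simp: finite_diagram hook_eq[OF assms])
  finally show ?thesis by simp
qed

text \<open>The finite set consists of the hook-lengths in the first column.\<close>

lemma maya_of_beads:
  assumes "is_partition lam"
  defines "N \<equiv> length lam"
  shows "maya_of lam = beads (int N) ((\<lambda>i. part lam i + N - i) ` {1..N})"
    and "inj_on (\<lambda>i. part lam i + N - i) {1..N}"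
proof -
  let ?g = "\<lambda>i. part lam i + N - i"
  have g: "int (?g i) - int N = row_pos lam i" if "i \<in> {1..N}" for i
    using that by (simp add: row_pos_def)
  show "inj_on ?g {1..N}"
  proof (rule inj_onI)
    fix i j assume ij: "i \<in> {1..N}" "j \<in> {1..N}" "?g i = ?g j"
    then have "row_pos lam i = row_pos lam j" using g by metis
    then show "i = j"
      using row_pos_strict[OF assms(1), of i j] row_pos_strict[OF assms(1), of j i] ij(1,2)
      by (cases i j rule: linorder_cases) auto
  qed
  have "(\<lambda>x. int x - int N) ` (?g ` {1..N}) = row_pos lam ` {1..N}"
    unfolding image_image using g by (intro image_cong) auto
  moreover have "{..<- int N} = row_pos lam ` {Suc N..}"
  proof (intro Set.set_eqI iffI)
    fix y assume "y \<in> {..<- int N}"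
    then have "nat (- y) \<in> {Suc N..}" "y = row_pos lam (nat (- y))"
      by (auto simp: row_pos_def part_0 N_def)
    then show "y \<in> row_pos lam ` {Suc N..}" by blast
  qed (auto simp: row_pos_def part_0 N_def)
  moreover have "{1..} = {1..N} \<union> {Suc N..}" by auto
  ultimately show "maya_of lam = beads (int N) (?g ` {1..N})"
    unfolding maya_of_def beads_def by (metis Un_commute image_Un)
qed

lemma maya_sum_maya_of:
  assumes "is_partition lam"
  shows "maya_sum f (maya_of lam) = (\<Sum>i=1..length lam. f (row_pos lam i) - f (- int i))"
proof -
  let ?N = "length lam"
  have "maya_sum f (maya_of lam)
     = (\<Sum>i=1..?N. f (int (part lam i + ?N - i) - int ?N)) - (\<Sum>i=1..?N. f (- int i))"
    unfolding maya_of_beads(1)[OF assms]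
    by (subst maya_sum_beads, simp) (simp only: sum.reindex[OF maya_of_beads(2)[OF assms]] o_def)
  also have "(\<Sum>i=1..?N. f (int (part lam i + ?N - i) - int ?N)) = (\<Sum>i=1..?N. f (row_pos lam i))"
    by (rule sum.cong) (auto simp: row_pos_def)
  finally show ?thesis by (simp add: sum_subtractf)
qed

lemma maya_maya_of: "is_partition lam \<Longrightarrow> maya (maya_of lam)"
  by (simp add: maya_of_beads(1) maya_beads)

lemma sum_list_eq_maya_sum:
  assumes "is_partition lam"
  shows "int (sum_list lam) = maya_sum (\<lambda>j. j) (maya_of lam)"
proof -
  have "(\<Sum>i=1..length lam. part lam i) = (\<Sum>i<length lam. lam ! i)"
    by (rule sum.reindex_bij_witness[of _ Suc "\<lambda>i. i - 1"]) (auto simp: part_def)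
  then have "sum_list lam = (\<Sum>i=1..length lam. part lam i)"
    by (simp add: sum_list_sum_nth lessThan_atLeast0)
  then show ?thesis
    unfolding maya_sum_maya_of[OF assms] by (simp add: row_pos_def)
qed

definition parity_sign :: "int \<Rightarrow> int" where
  "parity_sign j = (if even j then 1 else - 1)"

text \<open>The alternating sum along a row telescopes, each box changing \<open>parity_sign\<close>
  by twice its sign; hence the factor 2.\<close>

lemma BG_eq_maya_sum:
  assumes "is_partition lam"
  shows "2 * BG lam = maya_sum parity_sign (maya_of lam)"
proof -
  have row: "2 * (\<Sum>j=1..p. (- 1) ^ (i + j)) = parity_sign (int p - int i) - parity_sign (- int i)" for p i
  proof (induction p)
    case (Suc p)
    then show ?case
      by (auto simp: parity_sign_def minus_one_power_iff)
  qed simp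
  have "diagram lam = Sigma {1..length lam} (\<lambda>i. {1..part lam i})"
    by (auto simp: diagram_def)
  then have "BG lam = (\<Sum>i=1..length lam. \<Sum>j=1..part lam i. (- 1) ^ (i + j))"
    unfolding BG_def by (simp only:) (subst sum.Sigma, auto)
  then have "2 * BG lam = (\<Sum>i=1..length lam. 2 * (\<Sum>j=1..part lam i. (- 1) ^ (i + j)))"
    by (simp only: sum_distrib_left)
  then show ?thesis
    unfolding row maya_sum_maya_of[OF assms] row_pos_def .
qed

section \<open>Self-conjugacy as a symmetry of the Maya diagram\<close>

text \<open>At each stage both functions must take the largest value of the common range that has
  not occurred before.\<close>

lemma strict_anti_range_eq:
  fixes f g :: "nat \<Rightarrow> int"
  assumes f: "\<And>i j. 1 \<le> i \<Longrightarrow> i < j \<Longrightarrow> f j < f i" and g: "\<And>i j. 1 \<le> i \<Longrightarrow> i < j \<Longrightarrow> g j < g i"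
    and eq: "f ` {1..} = g ` {1..}" and n: "1 \<le> n"
  shows "f n = g n"
  using n
proof (induction n rule: less_induct)
  case (less n)
  have le: "a n \<le> b n"
    if ab: "a ` {1..} \<subseteq> b ` {1..}" and a: "\<And>i j. 1 \<le> i \<Longrightarrow> i < j \<Longrightarrow> a j < a i"
      and b: "\<And>i j. 1 \<le> i \<Longrightarrow> i < j \<Longrightarrow> b j < b i"
      and ih: "\<And>m. m < n \<Longrightarrow> 1 \<le> m \<Longrightarrow> a m = b m" for a b :: "nat \<Rightarrow> int"
  proof -
    obtain m where m: "1 \<le> m" "a n = b m" using ab less.prems by auto
    have "\<not> m < n" using m ih[of m] a[of m n] by auto
    then show ?thesis using m b[of n m] less.prems by (cases "m = n") auto
  qed
  show ?case
    using le[of f g] le[of g f] f g eq less.IH by force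
qed

lemma part_inject:
  assumes "is_partition lam" "is_partition mu" "\<And>i. 1 \<le> i \<Longrightarrow> part lam i = part mu i"
  shows "lam = mu"
proof (rule nth_equalityI)
  have le: "length a \<le> length b" if "is_partition a" "\<And>i. 1 \<le> i \<Longrightarrow> part a i = part b i" for a b
  proof (rule ccontr)
    assume "\<not> length a \<le> length b"
    then show False using part_pos[OF that(1), of "length a"] that(2)[of "length a"] part_0[of b "length a"]
      by simp
  qed
  show len: "length lam = length mu"
    using le[of lam mu] le[of mu lam] assms by simp
  fix i assume "i < length lam"
  then show "lam ! i = mu ! i"
    using assms(3)[of "Suc i"] len by (simp add: part_def)
qed

lemma maya_of_inject:
  assumes "is_partition lam" "is_partition mu" "maya_of lam = maya_of mu"
  shows "lam = mu"
proof (rule part_inject[OF assms(1,2)])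
  fix i :: nat assume "1 \<le> i"
  then have "row_pos lam i = row_pos mu i"
    using assms by (intro strict_anti_range_eq) (auto simp: maya_of_def intro: row_pos_strict)
  then show "part lam i = part mu i" by (simp add: row_pos_def)
qed

lemma conjugate_eq_iff:
  assumes "is_partition lam"
  shows "conjugate lam = lam \<longleftrightarrow> (\<forall>j\<ge>1. conj_part lam j = part lam j)"
proof
  have zero: "conj_part lam j = 0" if "j > part lam 1" for j
    using conj_part_galois[OF assms, of 1 j] that by (cases "conj_part lam j") auto
  {
    assume eq: "conjugate lam = lam"
    show "\<forall>j\<ge>1. conj_part lam j = part lam j"
    proof (intro allI impI)
      fix j :: nat assume j: "1 \<le> j"
      have len: "length lam = part lam 1" using arg_cong[OF eq, of length] by (simp add: conjugate_def del: upt_Suc)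
      show "conj_part lam j = part lam j"
      proof (cases "j \<le> length lam")
        case True
        then have "conjugate lam ! (j - 1) = conj_part lam j"
          using j len by (simp add: conjugate_def del: upt_Suc)
        then show ?thesis using True j eq by (simp add: part_def)
      next
        case False
        then show ?thesis using zero len part_0[of lam j] by simp
      qed
    qed
  next
    assume eq: "\<forall>j\<ge>1. conj_part lam j = part lam j"
    have "i \<le> length lam \<longleftrightarrow> i \<le> part lam 1" if i: "1 \<le> i" for i
    proof -
      have "i \<le> length lam \<longleftrightarrow> 1 \<le> part lam i"
        using part_pos[OF assms i] part_0[of lam i] by (cases "i \<le> length lam") auto
      also have "\<dots> \<longleftrightarrow> i \<le> part lam 1" using conj_part_galois[OF assms i, of 1] eq by simp
      finally show ?thesis .
    qed
    from this[of "length lam"] this[of "part lam 1"] have len: "length lam = part lam 1"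
      by (cases "length lam = 0"; cases "part lam 1 = 0") (auto simp: Suc_le_eq)
    show "conjugate lam = lam"
    proof (rule nth_equalityI)
      fix i assume "i < length (conjugate lam)"
      then have i: "i < part lam 1" by (simp add: conjugate_def del: upt_Suc)
      then have "conjugate lam ! i = conj_part lam (Suc i)"
        by (simp add: conjugate_def del: upt_Suc)
      also have "\<dots> = part lam (Suc i)" using eq by simp
      also have "\<dots> = lam ! i" using i unfolding len[symmetric] by (simp add: part_def)
      finally show "conjugate lam ! i = lam ! i" .
    qed (simp add: conjugate_def len del: upt_Suc)
  }
qed

text \<open>Conjugation reflects the diagram: \<open>- 1 - col_pos lam j\<close> is what
  \<open>row_pos\<close> would be for the conjugate. Both sequences decrease strictly, so they agree
  as soon as their ranges do.\<close>

lemma SC_iff: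
  assumes "is_partition lam"
  shows "lam \<in> SC \<longleftrightarrow> (\<forall>y. y \<notin> maya_of lam \<longleftrightarrow> - 1 - y \<in> maya_of lam)"
proof -
  have "lam \<in> SC \<longleftrightarrow> (\<forall>j\<ge>1. conj_part lam j = part lam j)"
    using assms conjugate_eq_iff by (simp add: SC_def)
  also have "\<dots> \<longleftrightarrow> (\<forall>j\<ge>1. - 1 - col_pos lam j = row_pos lam j)"
    by (auto simp: col_pos_def row_pos_def)
  also have "\<dots> \<longleftrightarrow> (\<lambda>j. - 1 - col_pos lam j) ` {1..} = maya_of lam"
  proof
    assume eq: "(\<lambda>j. - 1 - col_pos lam j) ` {1..} = maya_of lam"
    show "\<forall>j\<ge>1. - 1 - col_pos lam j = row_pos lam j"
    proof (intro allI impI)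
      fix j :: nat assume "1 \<le> j"
      then show "- 1 - col_pos lam j = row_pos lam j"
      proof (rule strict_anti_range_eq[rotated 3])
        fix i j :: nat assume "1 \<le> i" "i < j"
        then show "- 1 - col_pos lam j < - 1 - col_pos lam i"
          using conj_part_antimono[OF assms, of i j] by (simp add: col_pos_def)
      qed (use row_pos_strict[OF assms] eq in \<open>auto simp: maya_of_def\<close>)
    qed
  qed (auto simp: maya_of_def)
  also have "(\<lambda>j. - 1 - col_pos lam j) ` {1..} = {y. - 1 - y \<notin> maya_of lam}"
  proof (intro Set.set_eqI iffI)
    fix y assume "y \<in> {y. - 1 - y \<notin> maya_of lam}"
    then obtain j where "j \<ge> 1" "- 1 - y = col_pos lam j" using not_maya_of_iff[OF assms] by auto
    then show "y \<in> (\<lambda>j. - 1 - col_pos lam j) ` {1..}"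
      by (intro image_eqI[of _ _ j]) auto
  qed (use not_maya_of_iff[OF assms] in auto)
  also have "{y. - 1 - y \<notin> maya_of lam} = maya_of lam \<longleftrightarrow> (\<forall>y. y \<notin> maya_of lam \<longleftrightarrow> - 1 - y \<in> maya_of lam)"
    by auto
  finally show ?thesis .
qed

lemma maya_of_surj:
  assumes "maya M" "charge M = 0"
  obtains lam where "is_partition lam" "maya_of lam = M"
proof -
  obtain K0 where K0: "K0 \<ge> 0" "{..<- K0} \<subseteq> M" by (rule maya_lower_bound[OF assms(1)])
  \<comment> \<open>Minimality leaves the position \<open>- N\<close> empty, which makes all parts
    positive.\<close>
  define N where "N = (LEAST n. {..<- int n} \<subseteq> M)"
  have ex: "{..<- int (nat K0)} \<subseteq> M" using K0 by simp
  have N: "{..<- int N} \<subseteq> M" unfolding N_def by (rule LeastI[of "\<lambda>n. {..<- int n} \<subseteq> M", OF ex])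
  obtain X where X: "finite X" "M = beads (int N) X" by (rule maya_beadsE[OF assms(1) N])
  have cX: "card X = N" using assms(2) X charge_beads[OF X(1), of "int N"] by simp
  have X0: "0 \<notin> X"
  proof
    assume 0: "0 \<in> X"
    then have "N \<noteq> 0" using cX X(1) by (auto simp: card_gt_0_iff)
    then have "N - 1 < N" by simp
    moreover have "{..<- int (N - 1)} \<subseteq> M"
    proof
      fix y assume "y \<in> {..<- int (N - 1)}"
      then have "y < - int N \<or> y = - int N" using \<open>N \<noteq> 0\<close> by auto
      then show "y \<in> M" using 0 X(2) by (auto simp: beads_iff)
    qed
    ultimately show False unfolding N_def using not_less_Least by blast
  qed
  define xs where "xs = sorted_list_of_set X"
  have xs: "length xs = N" "set xs = X" "sorted_wrt (<) xs"
    using X(1) cX by (auto simp: xs_def)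
  have gap: "xs ! a + (b - a) \<le> xs ! b" if "a \<le> b" "b < N" for a b
    using that
  proof (induction b)
    case (Suc b)
    show ?case
    proof (cases "a = Suc b")
      case False
      then have "xs ! b < xs ! Suc b" using Suc.prems xs by (auto simp: sorted_wrt_iff_nth_less)
      then show ?thesis using Suc False by auto
    qed simp
  qed simp
  have pos: "k < xs ! k" if "k < N" for k
  proof -
    have "xs ! 0 \<in> X" using that xs(1) unfolding xs(2)[symmetric] by (intro nth_mem) auto
    then have "xs ! 0 \<noteq> 0" using X0 by metis
    then show ?thesis using gap[of 0 k] that by simp
  qed
  \<comment> \<open>Each part is an element of \<open>X\<close>, taken from the largest down, minus
    the number of smaller elements.\<close>
  define lam where "lam = map (\<lambda>i. xs ! (N - Suc i) - (N - Suc i)) [0..<N]"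
  have len: "length lam = N" by (simp add: lam_def)
  have nth: "lam ! i = xs ! (N - Suc i) - (N - Suc i)" if "i < N" for i using that by (simp add: lam_def)
  have part: "is_partition lam"
    unfolding is_partition_def
  proof
    show "sorted_wrt (\<ge>) lam"
      unfolding sorted_wrt_iff_nth_less
    proof (intro allI impI)
      fix i j assume ij: "i < j" "j < length lam"
      then have *: "N - Suc j \<le> N - Suc i" "N - Suc i < N" by (auto simp: len)
      show "lam ! j \<le> lam ! i"
      proof -
        have "i < N" "j < N" using ij len by auto
        then show ?thesis unfolding nth[OF \<open>i < N\<close>] nth[OF \<open>j < N\<close>]
          using gap[OF *] *(1) by linarith
      qed
    qed
    show "\<forall>p\<in>set lam. 0 < p"
    proof
      fix p assume "p \<in> set lam"
      then obtain i where i: "i < N" "p = lam ! i" by (auto simp: in_set_conv_nth len)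
      then show "0 < p" using pos[of "N - Suc i"] nth[of i] by simp
    qed
  qed
  have "(\<lambda>i. part lam i + N - i) ` {1..N} = X"
  proof -
    have "part lam i + N - i = xs ! (N - i)" if "i \<in> {1..N}" for i
      using that pos[of "N - i"] nth[of "i - 1"] by (auto simp: part_def len Suc_diff_le)
    then have "(\<lambda>i. part lam i + N - i) ` {1..N} = (\<lambda>i. xs ! (N - i)) ` {1..N}" by (rule image_cong[OF refl])
    also have "\<dots> = (\<lambda>k. xs ! k) ` ((\<lambda>i. N - i) ` {1..N})" by (simp add: image_image)
    also have "(\<lambda>i. N - i) ` {1..N} = {..<N}"
    proof (intro Set.set_eqI iffI)
      fix k assume "k \<in> {..<N}"
      then show "k \<in> (\<lambda>i. N - i) ` {1..N}" by (intro image_eqI[of _ _ "N - k"]) auto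
    qed auto
    also have "(\<lambda>k. xs ! k) ` {..<N} = set xs" by (auto simp: set_conv_nth xs(1))
    finally show ?thesis using xs(2) by simp
  qed
  then have "maya_of lam = M" using maya_of_beads(1)[OF part] X(2) len by simp
  then show ?thesis using that part by blast
qed

section \<open>Diagonal hooks\<close>

text \<open>The elements \<open>a\<close> of \<open>D\<close> are the arm lengths of the diagonal
  boxes, so the diagonal hook-lengths are \<open>2 * a + 1\<close>; the negative half is forced by
  the symmetry.\<close>

definition sym_maya :: "nat set \<Rightarrow> int set" where
  "sym_maya D = {y. if 0 \<le> y then nat y \<in> D else nat (- 1 - y) \<notin> D}"

lemma sym_maya_pos: "sym_maya D \<inter> {0..} = int ` D"
proof (intro Set.set_eqI iffI)
  fix y assume "y \<in> sym_maya D \<inter> {0..}"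
  then show "y \<in> int ` D" by (intro image_eqI[of _ _ "nat y"]) (auto simp: sym_maya_def split: if_splits)
qed (auto simp: sym_maya_def)

lemma sym_maya_neg: "{..<0} - sym_maya D = (\<lambda>a. - 1 - int a) ` D"
proof (intro Set.set_eqI iffI)
  fix y assume "y \<in> {..<0} - sym_maya D"
  then show "y \<in> (\<lambda>a. - 1 - int a) ` D"
    by (intro image_eqI[of _ _ "nat (- 1 - y)"]) (auto simp: sym_maya_def split: if_splits)
qed (auto simp: sym_maya_def)

lemma maya_sym_maya: "finite D \<Longrightarrow> maya (sym_maya D)"
  by (simp add: maya_def sym_maya_pos sym_maya_neg)

lemma maya_sum_sym_maya: "maya_sum f (sym_maya D) = (\<Sum>a\<in>D. f (int a)) - (\<Sum>a\<in>D. f (- 1 - int a))"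
proof -
  have "inj_on int D" "inj_on (\<lambda>a. - 1 - int a) D" by (auto intro: inj_onI)
  then show ?thesis by (simp add: maya_sum_def sym_maya_pos sym_maya_neg sum.reindex)
qed

lemma sym_maya_symmetric: "y \<notin> sym_maya D \<longleftrightarrow> - 1 - y \<in> sym_maya D"
  by (auto simp: sym_maya_def)

definition diag :: "nat list \<Rightarrow> nat set" where
  "diag lam = {a. int a \<in> maya_of lam}"

lemma maya_of_SC:
  assumes "lam \<in> SC"
  shows "maya_of lam = sym_maya (diag lam)"
proof -
  have "is_partition lam" using assms by (simp add: SC_def)
  then have sym: "y \<notin> maya_of lam \<longleftrightarrow> - 1 - y \<in> maya_of lam" for y
    using SC_iff assms by blast
  have "y \<in> maya_of lam \<longleftrightarrow> y \<in> sym_maya (diag lam)" for y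
    using sym[of y] by (auto simp: sym_maya_def diag_def)
  then show ?thesis by blast
qed

lemma diag_sym_maya: "maya_of lam = sym_maya D \<Longrightarrow> diag lam = D"
  by (auto simp: diag_def sym_maya_def)

lemma diag_bij: "bij_betw diag SC {D. finite D}"
  unfolding bij_betw_def
proof
  show "inj_on diag SC"
  proof (rule inj_onI)
    fix lam mu assume "lam \<in> SC" "mu \<in> SC" "diag lam = diag mu"
    then show "lam = mu" by (intro maya_of_inject) (auto simp: maya_of_SC, auto simp: SC_def)
  qed
  show "diag ` SC = {D. finite D}"
  proof (intro Set.set_eqI iffI)
    fix D assume "D \<in> diag ` SC"
    then obtain lam where lam: "lam \<in> SC" "D = diag lam" by auto
    then have "maya (sym_maya D)" using maya_of_SC maya_maya_of by (metis SC_def mem_Collect_eq)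
    then have "finite (int ` D)" unfolding maya_def sym_maya_pos by (rule conjunct1)
    then show "D \<in> {D. finite D}" by (simp add: finite_image_iff)
  next
    fix D :: "nat set" assume "D \<in> {D. finite D}"
    then have D: "finite D" by simp
    have "charge (sym_maya D) = 0" by (simp add: charge_def maya_sum_sym_maya)
    then obtain lam where lam: "is_partition lam" "maya_of lam = sym_maya D"
      using maya_of_surj[OF maya_sym_maya[OF D]] by blast
    then have "lam \<in> SC" using SC_iff[OF lam(1)] sym_maya_symmetric by simp
    then show "D \<in> diag ` SC" using diag_sym_maya[OF lam(2)] by blast
  qed
qed

lemma SC_size:
  assumes "lam \<in> SC"
  shows "sum_list lam = (\<Sum>a\<in>diag lam. 2 * a + 1)"
proof -
  have "is_partition lam" using assms by (simp add: SC_def)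
  then have "int (sum_list lam) = (\<Sum>a\<in>diag lam. int a) - (\<Sum>a\<in>diag lam. - 1 - int a)"
    using sum_list_eq_maya_sum maya_of_SC[OF assms] maya_sum_sym_maya by simp
  also have "\<dots> = int (\<Sum>a\<in>diag lam. 2 * a + 1)"
    by (simp add: sum_subtractf[symmetric] algebra_simps)
  finally show ?thesis by linarith
qed

text \<open>The bead at \<open>a\<close> and the hole at \<open>- 1 - a\<close> have opposite
  parities, so they contribute equally to twice the BG-rank.\<close>

lemma SC_BG:
  assumes "lam \<in> SC"
  shows "BG lam = (\<Sum>a\<in>diag lam. (- 1) ^ a)"
proof -
  have "is_partition lam" using assms by (simp add: SC_def)
  then have "2 * BG lam = (\<Sum>a\<in>diag lam. parity_sign (int a)) - (\<Sum>a\<in>diag lam. parity_sign (- 1 - int a))"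
    using BG_eq_maya_sum maya_of_SC[OF assms] maya_sum_sym_maya by simp
  also have "\<dots> = (\<Sum>a\<in>diag lam. 2 * (- 1) ^ a)"
    unfolding sum_subtractf[symmetric] by (rule sum.cong) (auto simp: parity_sign_def)
  finally show ?thesis by (simp add: sum_distrib_left[symmetric])
qed

section \<open>Generating functions of graded families\<close>

text \<open>\<open>w\<close> is the exponent of \<open>q\<close>. An infinite level set would
  silently sum to 0, which is why \<open>graded\<close> accompanies the product formulas.\<close>

definition gf :: "'i set \<Rightarrow> ('i \<Rightarrow> nat) \<Rightarrow> ('i \<Rightarrow> 'a::comm_ring_1) \<Rightarrow> 'a fps" where
  "gf A w f = Abs_fps (\<lambda>n. \<Sum>i | i \<in> A \<and> w i = n. f i)"

definition graded :: "'i set \<Rightarrow> ('i \<Rightarrow> nat) \<Rightarrow> bool" where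
  "graded A w \<longleftrightarrow> (\<forall>n. finite {i. i \<in> A \<and> w i = n})"

lemma gf_bij:
  assumes "bij_betw h A B" "\<And>i. i \<in> A \<Longrightarrow> v (h i) = w i" "\<And>i. i \<in> A \<Longrightarrow> g (h i) = f i"
  shows "gf A w f = gf B v g"
proof -
  have "(\<Sum>i | i \<in> A \<and> w i = n. f i) = (\<Sum>j | j \<in> B \<and> v j = n. g j)" for n
  proof -
    have inj: "inj_on h {i. i \<in> A \<and> w i = n}"
      using assms(1) by (auto simp: bij_betw_def intro: inj_on_subset)
    have "{j. j \<in> B \<and> v j = n} = h ` {i. i \<in> A \<and> w i = n}"
      using assms(1,2) by (auto simp: bij_betw_def)
    then show ?thesis using assms(3) by (simp add: sum.reindex[OF inj])
  qed
  then show ?thesis by (simp add: gf_def)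
qed

lemma graded_bij:
  assumes "bij_betw h A B" "\<And>i. i \<in> A \<Longrightarrow> v (h i) = w i"
  shows "graded A w \<longleftrightarrow> graded B v"
proof -
  have "finite {i. i \<in> A \<and> w i = n} \<longleftrightarrow> finite {j. j \<in> B \<and> v j = n}" for n
  proof -
    have inj: "inj_on h {i. i \<in> A \<and> w i = n}"
      using assms(1) by (auto simp: bij_betw_def intro: inj_on_subset)
    have "{j. j \<in> B \<and> v j = n} = h ` {i. i \<in> A \<and> w i = n}"
      using assms by (auto simp: bij_betw_def)
    then show ?thesis by (simp add: finite_image_iff[OF inj])
  qed
  then show ?thesis by (simp add: graded_def)
qed

lemma Times_weight_eq:
  fixes w :: "'i \<Rightarrow> nat" and v :: "'j \<Rightarrow> nat"
  shows "{p. p \<in> A \<times> B \<and> w (fst p) + v (snd p) = n}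
   = (\<Union>k\<in>{0..n}. {i. i \<in> A \<and> w i = k} \<times> {j. j \<in> B \<and> v j = n - k})"
proof (intro Set.set_eqI iffI)
  fix p assume p: "p \<in> {p. p \<in> A \<times> B \<and> w (fst p) + v (snd p) = n}"
  obtain i j where ij: "p = (i, j)" by force
  have "w i \<in> {0..n}" using p ij by auto
  moreover have "p \<in> {i'. i' \<in> A \<and> w i' = w i} \<times> {j. j \<in> B \<and> v j = n - w i}" using p ij by auto
  ultimately show "p \<in> (\<Union>k\<in>{0..n}. {i. i \<in> A \<and> w i = k} \<times> {j. j \<in> B \<and> v j = n - k})" by blast
qed auto

lemma graded_Times:
  assumes "graded A w" "graded B v"
  shows "graded (A \<times> B) (\<lambda>p. w (fst p) + v (snd p))"
  using assms unfolding graded_def Times_weight_eq by auto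

lemma gf_Times:
  assumes "graded A w" "graded B v"
  shows "gf (A \<times> B) (\<lambda>p. w (fst p) + v (snd p)) (\<lambda>p. f (fst p) * g (snd p)) = gf A w f * gf B v g"
proof (rule fps_ext)
  fix n
  have fin: "finite {i. i \<in> A \<and> w i = k}" "finite {j. j \<in> B \<and> v j = k}" for k
    using assms by (auto simp: graded_def)
  have "fps_nth (gf (A \<times> B) (\<lambda>p. w (fst p) + v (snd p)) (\<lambda>p. f (fst p) * g (snd p))) n
     = (\<Sum>k=0..n. \<Sum>p\<in>{i. i \<in> A \<and> w i = k} \<times> {j. j \<in> B \<and> v j = n - k}. f (fst p) * g (snd p))"
    unfolding gf_def Times_weight_eq fps_nth_Abs_fps
    using fin by (intro sum.UNION_disjoint) auto
  also have "\<dots> = (\<Sum>k=0..n. (\<Sum>i | i \<in> A \<and> w i = k. f i) * (\<Sum>j | j \<in> B \<and> v j = n - k. g j))"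
    by (simp add: sum_product sum.cartesian_product case_prod_beta)
  also have "\<dots> = fps_nth (gf A w f * gf B v g) n"
    by (simp add: fps_mult_nth gf_def)
  finally show "fps_nth (gf (A \<times> B) (\<lambda>p. w (fst p) + v (snd p)) (\<lambda>p. f (fst p) * g (snd p))) n
     = fps_nth (gf A w f * gf B v g) n" .
qed

lemma bij_PiE_insert:
  assumes "x \<notin> I"
  shows "bij_betw (\<lambda>(a, y). y(x := a)) (A x \<times> PiE I A) (PiE (insert x I) A)"
  unfolding bij_betw_def
proof
  show "inj_on (\<lambda>(a, y). y(x := a)) (A x \<times> PiE I A)"
  proof (rule inj_onI)
    fix p q assume pq: "p \<in> A x \<times> PiE I A" "q \<in> A x \<times> PiE I A"
      "(\<lambda>(a, y). y(x := a)) p = (\<lambda>(a, y). y(x := a)) q"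
    obtain a y b z where ab: "p = (a, y)" "q = (b, z)" by force
    have eq: "y(x := a) = z(x := b)" using pq(3) ab by simp
    have "a = b" using fun_cong[OF eq, of x] by simp
    moreover have "y i = z i" for i
    proof (cases "i = x")
      case True
      then show ?thesis using pq(1,2) ab assms by (auto simp: PiE_def extensional_def)
    next
      case False
      then show ?thesis using fun_cong[OF eq, of i] by simp
    qed
    ultimately show "p = q" using ab by auto
  qed
  show "(\<lambda>(a, y). y(x := a)) ` (A x \<times> PiE I A) = PiE (insert x I) A"
    by (rule PiE_insert_eq[symmetric])
qed

text \<open>Both claims are proved in one induction because multiplying by the next factor needs the
  gradedness of the product so far.\<close>

lemma gf_PiE:
  assumes "finite I" "\<And>i. i \<in> I \<Longrightarrow> graded (A i) (w i)"
  shows "graded (PiE I A) (\<lambda>y. \<Sum>i\<in>I. w i (y i)) \<and>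
    gf (PiE I A) (\<lambda>y. \<Sum>i\<in>I. w i (y i)) (\<lambda>y. \<Prod>i\<in>I. f i (y i)) = (\<Prod>i\<in>I. gf (A i) (w i) (f i))"
  using assms
proof (induction I)
  case empty
  show ?case
    by (auto simp: gf_def graded_def fps_eq_iff)
next
  case (insert x I)
  let ?h = "\<lambda>(a, y). y(x := a)"
  let ?w = "\<lambda>y. \<Sum>i\<in>insert x I. w i (y i)" and ?f = "\<lambda>y. \<Prod>i\<in>insert x I. f i (y i)"
  let ?w' = "\<lambda>p. w x (fst p) + (\<Sum>i\<in>I. w i (snd p i))"
  let ?f' = "\<lambda>p. f x (fst p) * (\<Prod>i\<in>I. f i (snd p i))"
  have bij: "bij_betw ?h (A x \<times> PiE I A) (PiE (insert x I) A)"
    by (rule bij_PiE_insert) (use insert in auto)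
  have ne: "i \<noteq> x" if "i \<in> I" for i using that insert by auto
  have w: "?w (?h p) = ?w' p" for p
    using insert ne by (cases p) (auto intro!: sum.cong)
  have f: "?f (?h p) = ?f' p" for p
    using insert ne by (cases p) (auto intro!: arg_cong2[where f = "(*)"] prod.cong)
  have gr: "graded (A x) (w x)" "graded (PiE I A) (\<lambda>y. \<Sum>i\<in>I. w i (y i))"
    using insert by auto
  have "graded (PiE (insert x I) A) ?w"
  proof -
    have "graded (A x \<times> PiE I A) ?w' \<longleftrightarrow> graded (PiE (insert x I) A) ?w"
      by (rule graded_bij[OF bij]) (rule w)
    then show ?thesis using graded_Times[OF gr] by blast
  qed
  moreover have "gf (PiE (insert x I) A) ?w ?f = gf (A x \<times> PiE I A) ?w' ?f'"
    by (rule sym, rule gf_bij[OF bij], rule w, rule f)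
  moreover have "\<dots> = gf (A x) (w x) (f x) * (\<Prod>i\<in>I. gf (A i) (w i) (f i))"
    using gf_Times[OF gr, of "f x" "\<lambda>y. \<Prod>i\<in>I. f i (y i)"] insert by simp
  ultimately show ?case using insert by simp
qed

lemma gf_has_sum:
  assumes "graded A w"
  shows "((\<lambda>i. fps_const (f i) * fps_X ^ w i) has_sum gf A w f) A"
proof (rule has_sum_fpsI)
  fix n
  have nth: "fps_nth (fps_const (f i) * fps_X ^ w i) n = (if w i = n then f i else 0)" for i
    by (simp add: fps_X_power_nth)
  have fin: "finite {i. i \<in> A \<and> w i = n}" using assms by (simp add: graded_def)
  show "finite {i \<in> A. fps_nth (fps_const (f i) * fps_X ^ w i) n \<noteq> 0}"
    by (rule finite_subset[OF _ fin]) (auto simp: nth)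
  have "fps_nth (gf A w f) n = (\<Sum>i | i \<in> A \<and> w i = n. f i)" by (simp add: gf_def)
  also have "\<dots> = (\<Sum>i | i \<in> A \<and> fps_nth (fps_const (f i) * fps_X ^ w i) n \<noteq> 0.
        fps_nth (fps_const (f i) * fps_X ^ w i) n)"
    by (rule sum.mono_neutral_cong_right[OF fin]) (auto simp: nth split: if_splits)
  finally show "fps_nth (gf A w f) n = (\<Sum>i | i \<in> A \<and> fps_nth (fps_const (f i) * fps_X ^ w i) n \<noteq> 0.
        fps_nth (fps_const (f i) * fps_X ^ w i) n)" .
qed

section \<open>Splitting a symmetric diagram by residues modulo \<open>2 u\<close>\<close>

definition runner :: "nat \<Rightarrow> nat set \<Rightarrow> nat \<Rightarrow> int set" where
  "runner u D r = {j. int r + 2 * int u * j \<in> sym_maya D}"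

definition runners :: "nat \<Rightarrow> nat set \<Rightarrow> nat \<Rightarrow> int set" where
  "runners u D = restrict (runner u D) {..<u}"

text \<open>The share of \<open>D\<close> recorded by runner \<open>r\<close>: a bead at
  \<open>j \<ge> 0\<close> is an element of residue \<open>r\<close>, and a hole at
  \<open>j < 0\<close> is, after reflection, an element of residue
  \<open>2 u - 1 - r\<close>.\<close>

definition runner_sum :: "nat \<Rightarrow> (nat \<Rightarrow> 'b::comm_monoid_add) \<Rightarrow> nat \<Rightarrow> int set \<Rightarrow> 'b" where
  "runner_sum u g r M = (\<Sum>j\<in>M \<inter> {0..}. g (r + 2 * u * nat j))
     + (\<Sum>j\<in>{..<0} - M. g (2 * u - 1 - r + 2 * u * nat (- 1 - j)))"

lemma mod_class: "r < 2 * u \<Longrightarrow> (int r + 2 * int u * j) mod (2 * int u) = int r"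
  and div_class: "r < 2 * u \<Longrightarrow> (int r + 2 * int u * j) div (2 * int u) = j"
  by (simp_all add: mod_pos_pos_trivial div_pos_pos_trivial)

lemma reflected_mod: "r < u \<Longrightarrow> (2 * u - 1 - r + 2 * u * q) mod (2 * u) = 2 * u - 1 - r" for r u q :: nat
  by (subst mod_mult_self2) simp

lemma reflected_div: "r < u \<Longrightarrow> (2 * u - 1 - r + 2 * u * q) div (2 * u) = q" for r u q :: nat
  by (subst div_mult_self2) auto

lemma int_in_sym_maya: "int a \<in> sym_maya D \<longleftrightarrow> a \<in> D"
  by (simp add: sym_maya_def)

lemma runner_nonneg:
  assumes "j \<ge> 0"
  shows "j \<in> runner u D r \<longleftrightarrow> r + 2 * u * nat j \<in> D"
proof -
  have eq: "int r + 2 * int u * j = int (r + 2 * u * nat j)" using assms by simp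
  show ?thesis unfolding runner_def mem_Collect_eq eq int_in_sym_maya ..
qed

lemma runner_neg:
  assumes "r < u" "j < 0"
  shows "j \<in> runner u D r \<longleftrightarrow> 2 * u - 1 - r + 2 * u * nat (- 1 - j) \<notin> D"
proof -
  have eq: "- 1 - (int r + 2 * int u * j) = int (2 * u - 1 - r + 2 * u * nat (- 1 - j))"
    using assms by (simp add: of_nat_diff algebra_simps)
  show ?thesis
    using sym_maya_symmetric[of "int r + 2 * int u * j" D]
    unfolding eq int_in_sym_maya runner_def mem_Collect_eq by blast
qed

lemma sum_split_runners:
  assumes "finite D" "u > 0"
  shows "(\<Sum>a\<in>D. g a) = (\<Sum>r<u. runner_sum u g r (runner u D r))"
proof -
  let ?M = "runner u D" and ?t = "2 * u"
  have t: "?t > 0" using assms(2) by simp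
  let ?A = "{a \<in> D. a mod ?t < u}" and ?B = "{a \<in> D. \<not> a mod ?t < u}"
  have fin: "finite (?M r \<inter> {0..})" "finite ({..<0} - ?M r)" if r: "r < u" for r
  proof -
    have "?M r \<inter> {0..} \<subseteq> (\<lambda>a. int (a div ?t)) ` D"
    proof
      fix j assume j: "j \<in> ?M r \<inter> {0..}"
      then have "r + ?t * nat j \<in> D" using runner_nonneg by auto
      moreover have "(r + ?t * nat j) div ?t = nat j" using r by simp
      ultimately show "j \<in> (\<lambda>a. int (a div ?t)) ` D"
        using j by (intro image_eqI[of _ _ "r + ?t * nat j"]) auto
    qed
    then show "finite (?M r \<inter> {0..})" by (rule finite_subset) (use assms in auto)
    have "{..<0} - ?M r \<subseteq> (\<lambda>a. - 1 - int (a div ?t)) ` D"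
    proof
      fix j assume j: "j \<in> {..<0} - ?M r"
      then have "?t - 1 - r + ?t * nat (- 1 - j) \<in> D" using runner_neg[OF r] by auto
      moreover have "(?t - 1 - r + ?t * nat (- 1 - j)) div ?t = nat (- 1 - j)"
        by (rule reflected_div[OF r])
      ultimately show "j \<in> (\<lambda>a. - 1 - int (a div ?t)) ` D"
        using j by (intro image_eqI[of _ _ "?t - 1 - r + ?t * nat (- 1 - j)"]) auto
    qed
    then show "finite ({..<0} - ?M r)" by (rule finite_subset) (use assms in auto)
  qed
  have "(\<Sum>a\<in>D. g a) = (\<Sum>a\<in>?A. g a) + (\<Sum>a\<in>?B. g a)"
    using assms by (subst sum.union_disjoint[symmetric]) (auto intro!: sum.cong)
  also have "(\<Sum>a\<in>?A. g a) = (\<Sum>(r, j)\<in>Sigma {..<u} (\<lambda>r. ?M r \<inter> {0..}). g (r + ?t * nat j))"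
  proof (rule sum.reindex_bij_witness[of _ "\<lambda>(r, j). r + ?t * nat j" "\<lambda>a. (a mod ?t, int (a div ?t))"], goal_cases)
    case (2 a)
    then show ?case by (auto simp: runner_nonneg)
  next
    case (4 p)
    then show ?case by (auto simp: runner_nonneg)
  qed auto
  also have "\<dots> = (\<Sum>r<u. \<Sum>j\<in>?M r \<inter> {0..}. g (r + ?t * nat j))"
    using fin by (subst sum.Sigma) auto
  also have "(\<Sum>a\<in>?B. g a)
     = (\<Sum>(r, j)\<in>Sigma {..<u} (\<lambda>r. {..<0} - ?M r). g (?t - 1 - r + ?t * nat (- 1 - j)))"
  proof (rule sum.reindex_bij_witness[of _ "\<lambda>(r, j). ?t - 1 - r + ?t * nat (- 1 - j)"
        "\<lambda>a. (?t - 1 - a mod ?t, - 1 - int (a div ?t))"], goal_cases)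
    case (1 a)
    have "a mod ?t < ?t" using t by simp
    then show ?case using mult_div_mod_eq[of ?t a] by simp
  next
    case (2 a)
    have lt: "a mod ?t < ?t" using t by simp
    then have "?t - 1 - (?t - 1 - a mod ?t) + ?t * nat (- 1 - (- 1 - int (a div ?t))) = a"
      using mult_div_mod_eq[of ?t a] by simp
    moreover have "?t - 1 - a mod ?t < u" using 2 lt by auto
    ultimately show ?case using 2 runner_neg[of "?t - 1 - a mod ?t" u "- 1 - int (a div ?t)" D] by auto
  next
    case (3 p)
    obtain r j where p: "p = (r, j)" "r < u" "j < 0" using 3 by auto
    then show ?case
      using reflected_mod[OF p(2), of "nat (- 1 - j)"] reflected_div[OF p(2), of "nat (- 1 - j)"]
      by auto
  next
    case (4 p)
    obtain r j where p: "p = (r, j)" "r < u" "j < 0" "j \<notin> ?M r" using 4 by auto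
    show ?case using p runner_neg[of r u j D] reflected_mod[OF p(2), of "nat (- 1 - j)"] by auto
  next
    case (5 a)
    have "a mod ?t < ?t" using t by simp
    then show ?case using mult_div_mod_eq[of ?t a] by simp
  qed
  also have "\<dots> = (\<Sum>r<u. \<Sum>j\<in>{..<0} - ?M r. g (?t - 1 - r + ?t * nat (- 1 - j)))"
    using fin by (subst sum.Sigma) auto
  finally show ?thesis by (simp add: runner_sum_def sum.distrib)
qed

section \<open>The runners of a symmetric Maya diagram\<close>

lemma mod_eq_of_dvd: "int t dvd x - y \<Longrightarrow> x mod int t = y mod int t"
  by (simp add: mod_eq_dvd_iff)

text \<open>A pair of positions in the same residue class lies either on a runner \<open>r < u\<close>, or it is the
  reflection of such a pair; this is why the hook-lengths divisible by \<open>2 u\<close> come in pairs.\<close>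

definition runner_pair :: "nat \<Rightarrow> (nat \<times> int \<times> int) \<times> bool \<Rightarrow> int \<times> int" where
  "runner_pair u = (\<lambda>((r, i, j), b). if b then (int r + 2 * int u * i, int r + 2 * int u * j)
     else (- 1 - (int r + 2 * int u * j), - 1 - (int r + 2 * int u * i)))"

lemma reflected_mod_int:
  assumes "r < u"
  shows "(- 1 - (int r + 2 * int u * j)) mod (2 * int u) = 2 * int u - 1 - int r"
    and "(- 1 - (int r + 2 * int u * j)) div (2 * int u) = - 1 - j"
proof -
  have eq: "- 1 - (int r + 2 * int u * j) = (2 * int u - 1 - int r) + 2 * int u * (- 1 - j)"
    by (simp add: algebra_simps)
  have b: "0 \<le> 2 * int u - 1 - int r" "2 * int u - 1 - int r < 2 * int u" using assms by auto
  show "(- 1 - (int r + 2 * int u * j)) mod (2 * int u) = 2 * int u - 1 - int r"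
    unfolding eq by (subst mod_mult_self2) (rule mod_pos_pos_trivial[OF b])
  show "(- 1 - (int r + 2 * int u * j)) div (2 * int u) = - 1 - j"
    unfolding eq using b by (subst div_mult_self2) (auto simp: div_pos_pos_trivial)
qed

lemma runner_pair_bij:
  assumes "u > 0"
  shows "bij_betw (runner_pair u)
     (Sigma {..<u} (\<lambda>r. inversions (runner u D r)) \<times> UNIV)
     {(x, y). (x, y) \<in> inversions (sym_maya D) \<and> int (2 * u) dvd x - y}"
proof -
  let ?t = "2 * int u" and ?S = "sym_maya D"
  let ?A = "Sigma {..<u} (\<lambda>r. inversions (runner u D r)) \<times> (UNIV :: bool set)"
  let ?B = "{(x, y). (x, y) \<in> inversions ?S \<and> int (2 * u) dvd x - y}"
  \<comment> \<open>The residue of \<open>x\<close> tells whether the pair was reflected; reflection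
    reverses the order, so \<open>x\<close> and \<open>y\<close> then change places.\<close>
  let ?inv = "\<lambda>(x, y). if x mod ?t < int u then ((nat (x mod ?t), x div ?t, y div ?t), True)
     else ((nat (?t - 1 - x mod ?t), - 1 - y div ?t, - 1 - x div ?t), False)"
  have t: "?t > 0" using assms by simp
  show ?thesis
  proof (rule bij_betw_byWitness[of _ ?inv])
    show "\<forall>p\<in>?A. ?inv (runner_pair u p) = p"
    proof
      fix p assume "p \<in> ?A"
      then obtain r i j b where p: "p = ((r, i, j), b)" "r < u" by auto
      then show "?inv (runner_pair u p) = p"
        using mod_class[of r u] div_class[of r u] reflected_mod_int[OF p(2)]
        by (cases b) (simp_all add: runner_pair_def)
    qed
    have recompose: "int (nat (x mod ?t)) + ?t * (x div ?t) = x" for x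
      using t by simp
    have reflect: "- 1 - (int (nat (?t - 1 - x mod ?t)) + ?t * (- 1 - y div ?t)) = y"
      if "x mod ?t = y mod ?t" for x y
    proof -
      have "y mod ?t < ?t" using t by simp
      then have "int (nat (?t - 1 - x mod ?t)) = ?t - 1 - y mod ?t" using that by simp
      then show ?thesis using mult_div_mod_eq[of ?t y] by (simp add: algebra_simps)
    qed
    show "\<forall>p\<in>?B. runner_pair u (?inv p) = p"
    proof
      fix p assume "p \<in> ?B"
      then obtain x y where p: "p = (x, y)" "int (2 * u) dvd x - y" by auto
      then have eq: "x mod ?t = y mod ?t" using mod_eq_of_dvd[of "2 * u" x y] by simp
      show "runner_pair u (?inv p) = p"
        using recompose[of x] recompose[of y] reflect[OF eq] reflect[of x x] eq p(1)
        by (simp add: runner_pair_def)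
    qed
    show "runner_pair u ` (?A)
        \<subseteq> ?B"
    proof
      fix q assume "q \<in> runner_pair u ` (?A)"
      then obtain r i j b where q: "q = runner_pair u ((r, i, j), b)" "r < u"
        "(i, j) \<in> inversions (runner u D r)" by auto
      then have ij: "int r + ?t * i \<in> ?S" "int r + ?t * j \<notin> ?S" "j < i"
        by (auto simp: inversions_def runner_def)
      have lt: "?t * j < ?t * i" using ij(3) t by (simp only: mult_less_cancel_left_pos)
      have dvd: "?t dvd ?t * i - ?t * j" by simp
      show "q \<in> ?B"
        using ij lt dvd sym_maya_symmetric[of "int r + ?t * j" D] sym_maya_symmetric[of "int r + ?t * i" D]
        unfolding q(1) runner_pair_def by (cases b) (auto simp: inversions_def)
    qed
    show "?inv ` ?B
        \<subseteq> ?A"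
    proof
      fix q assume "q \<in> ?inv ` ?B"
      then obtain x y where q: "q = ?inv (x, y)" "x \<in> ?S" "y \<notin> ?S" "y < x" "int (2 * u) dvd x - y"
        by (auto simp: inversions_def)
      have eq: "x mod ?t = y mod ?t" using mod_eq_of_dvd[OF q(5)] by simp
      have "x mod ?t < ?t" "y mod ?t < ?t" "0 \<le> x mod ?t" using t by simp_all
      have lt: "y div ?t < x div ?t"
      proof (rule ccontr)
        assume "\<not> y div ?t < x div ?t"
        then have "?t * (x div ?t) \<le> ?t * (y div ?t)" using t by (intro mult_left_mono) auto
        then show False
          using q(4) eq mult_div_mod_eq[of ?t x] mult_div_mod_eq[of ?t y] by linarith
      qed
      have "x mod ?t < int u \<Longrightarrow> x div ?t \<in> runner u D (nat (x mod ?t)) \<and> y div ?t \<notin> runner u D (nat (x mod ?t))"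
        using recompose[of x] recompose[of y] q(2,3) eq by (simp add: runner_def)
      moreover have "- 1 - y div ?t \<in> runner u D (nat (?t - 1 - x mod ?t))
          \<and> - 1 - x div ?t \<notin> runner u D (nat (?t - 1 - x mod ?t))"
        using reflect[OF eq] reflect[of x x] q(2,3) sym_maya_symmetric[of _ D]
        unfolding runner_def mem_Collect_eq by metis
      ultimately show "q \<in> ?A"
        using q(1) lt \<open>x mod ?t < ?t\<close> \<open>0 \<le> x mod ?t\<close> by (auto simp: inversions_def)
    qed
  qed
qed

lemma maya_runner:
  assumes "finite D" "r < u"
  shows "maya (runner u D r)"
proof -
  let ?t = "2 * int u" and ?M = "runner u D r"
  have t: "?t > 0" using assms by simp
  have S: "maya (sym_maya D)" by (rule maya_sym_maya[OF assms(1)])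
  have inj: "inj_on (\<lambda>j. int r + ?t * j) A" for A using t by (auto intro!: inj_onI)
  have "(\<lambda>j. int r + ?t * j) ` (?M \<inter> {0..}) \<subseteq> sym_maya D \<inter> {0..}"
    using t by (auto simp: runner_def)
  then have 1: "finite (?M \<inter> {0..})"
    using S inj by (meson finite_imageD finite_subset maya_def)
  have "(\<lambda>j. int r + ?t * j) ` ({..<0} - ?M) \<subseteq> {..<0} - sym_maya D"
  proof
    fix x assume "x \<in> (\<lambda>j. int r + ?t * j) ` ({..<0} - ?M)"
    then obtain j where j: "x = int r + ?t * j" "j < 0" "j \<notin> ?M" by auto
    have "?t * j \<le> ?t * (- 1)" using j(2) t by (intro mult_left_mono) auto
    then have "x < 0" unfolding j(1) using assms(2) by linarith
    then show "x \<in> {..<0} - sym_maya D" using j by (auto simp: runner_def)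
  qed
  then have 2: "finite ({..<0} - ?M)"
    using S inj by (meson finite_imageD finite_subset maya_def)
  show ?thesis using 1 2 by (simp add: maya_def)
qed

text \<open>Any family of \<open>u\<close> Maya diagrams occurs. Membership of \<open>a\<close> in
  \<open>D\<close> is read off from a bead if the residue of \<open>a\<close> is below
  \<open>u\<close>, and otherwise from a hole on the runner with the reflected residue.\<close>

lemma runners_bij:
  assumes "u > 0"
  shows "bij_betw (runners u) {D. finite D} (PiE {..<u} (\<lambda>_. {M. maya M}))"
proof -
  let ?t = "2 * u"
  let ?inv = "\<lambda>y :: nat \<Rightarrow> int set. {a. if a mod ?t < u then int (a div ?t) \<in> y (a mod ?t)
     else - 1 - int (a div ?t) \<notin> y (?t - 1 - a mod ?t)}"
  have t: "?t > 0" using assms by simp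
  have inv1: "?inv (runners u D) = D" for D
  proof -
    have "a \<in> ?inv (runners u D) \<longleftrightarrow> a \<in> D" for a
    proof (cases "a mod ?t < u")
      case True
      then show ?thesis by (simp add: runners_def runner_nonneg)
    next
      case False
      have "a mod ?t < ?t" using t by simp
      then have lt: "?t - 1 - a mod ?t < u" using False by simp
      have "?t - 1 - (?t - 1 - a mod ?t) + ?t * nat (- 1 - (- 1 - int (a div ?t))) = a"
        using \<open>a mod ?t < ?t\<close> mult_div_mod_eq[of ?t a] by simp
      then show ?thesis
        using False lt runner_neg[OF lt, of "- 1 - int (a div ?t)" D] by (simp add: runners_def)
    qed
    then show ?thesis by blast
  qed
  have inv2: "runners u (?inv y) = y" if y: "y \<in> PiE {..<u} (\<lambda>_. {M. maya M})" for y
  proof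
    fix r
    show "runners u (?inv y) r = y r"
    proof (cases "r < u")
      case True
      have "j \<in> runner u (?inv y) r \<longleftrightarrow> j \<in> y r" for j
      proof (cases "j \<ge> 0")
        case j: True
        then show ?thesis using True by (simp add: runner_nonneg)
      next
        case j: False
        then have "j < 0" by simp
        have nlt: "\<not> 2 * u - 1 - r < u" "2 * u - 1 - (2 * u - 1 - r) = r" using True by auto
        have jj: "- 1 - int (nat (- 1 - j)) = j" using \<open>j < 0\<close> by simp
        show ?thesis
          unfolding runner_neg[OF True \<open>j < 0\<close>] mem_Collect_eq reflected_mod[OF True]
            reflected_div[OF True] if_not_P[OF nlt(1)] nlt(2) jj not_not ..
      qed
      then have "runner u (?inv y) r = y r" by blast
      then show ?thesis using True unfolding runners_def restrict_apply lessThan_iff by (simp only: if_True)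
    next
      case False
      then show ?thesis using y by (auto simp: runners_def PiE_def extensional_def)
    qed
  qed
  have fin: "finite (?inv y)" if y: "y \<in> PiE {..<u} (\<lambda>_. {M. maya M})" for y
  proof -
    have m: "maya (y r)" if "r < u" for r using y that by auto
    let ?U = "(\<Union>r\<in>{..<u}. (\<lambda>j. r + ?t * nat j) ` (y r \<inter> {0..}))
        \<union> (\<Union>r\<in>{..<u}. (\<lambda>j. ?t - 1 - r + ?t * nat (- 1 - j)) ` ({..<0} - y r))"
    have "?inv y \<subseteq> ?U"
    proof
      fix a assume a: "a \<in> ?inv y"
      show "a \<in> ?U"
      proof (cases "a mod ?t < u")
        case True
        then have "int (a div ?t) \<in> y (a mod ?t) \<inter> {0..}" using a by simp
        moreover have "a = a mod ?t + ?t * nat (int (a div ?t))" by simp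
        ultimately show ?thesis using True by blast
      next
        case False
        have "a mod ?t < ?t" using t by simp
        then have lt: "?t - 1 - a mod ?t < u" using False by simp
        have "- 1 - int (a div ?t) \<in> {..<0} - y (?t - 1 - a mod ?t)" using a False by simp
        moreover have "a = ?t - 1 - (?t - 1 - a mod ?t) + ?t * nat (- 1 - (- 1 - int (a div ?t)))"
          using \<open>a mod ?t < ?t\<close> mult_div_mod_eq[of ?t a] by simp
        ultimately show ?thesis using lt by blast
      qed
    qed
    then show ?thesis
      by (rule finite_subset) (use m in \<open>auto simp: maya_def\<close>)
  qed
  show ?thesis
  proof (rule bij_betw_byWitness[of _ ?inv])
    show "\<forall>D\<in>{D. finite D}. ?inv (runners u D) = D" using inv1 by blast
    show "\<forall>y\<in>PiE {..<u} (\<lambda>_. {M. maya M}). runners u (?inv y) = y" using inv2 by blast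
    show "runners u ` {D. finite D} \<subseteq> PiE {..<u} (\<lambda>_. {M. maya M})"
      using maya_runner by (auto simp: runners_def)
    show "?inv ` PiE {..<u} (\<lambda>_. {M. maya M}) \<subseteq> {D. finite D}" using fin by blast
  qed
qed

section \<open>Substitution and powers of formal power series\<close>

lemma scalar_0 [simp]: "scalar 0 = 0"
  by (simp add: scalar_def)

lemma scalar_1 [simp]: "scalar 1 = 1"
  unfolding scalar_def by (metis single_one zero_prod_def)

lemma scalar_add: "scalar (a + b) = scalar a + scalar b"
  by (simp add: scalar_def single_add)

lemma scalar_mult: "scalar (a * b) = scalar a * scalar b"
  by (simp add: scalar_def mult_single)

lemma scalar_uminus: "scalar (- a) = - scalar a"
  by (simp add: scalar_def single_uminus)

lemma scalar_sum: "scalar (sum f A) = (\<Sum>i\<in>A. scalar (f i))"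
  by (induction A rule: infinite_finite_induct) (simp_all add: scalar_add)

lemma scalar_prod: "scalar (prod f A) = (\<Prod>i\<in>A. scalar (f i))"
  by (induction A rule: infinite_finite_induct) (simp_all add: scalar_mult)

lemma b_pow_add: "b_pow (k + l) = b_pow k * b_pow l"
  by (simp add: b_pow_def mult_single)

lemma b_pow_0 [simp]: "b_pow 0 = 1"
  unfolding b_pow_def by (metis single_one zero_prod_def)

lemma b_pow_sum: "b_pow (sum f A) = (\<Prod>i\<in>A. b_pow (f i))"
  by (induction A rule: infinite_finite_induct) (simp_all add: b_pow_add)

text \<open>The library proves the laws of \<open>fps_compose\<close> over integral domains only, and \<open>coeff_ring\<close> is not an
  instance of that class; hence a separate operation for substituting \<open>v * X ^ k\<close>.\<close>

definition fps_subst :: "coeff_ring \<Rightarrow> nat \<Rightarrow> complex fps \<Rightarrow> coeff_ring fps" where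
  "fps_subst v k G = Abs_fps (\<lambda>n. if k dvd n then scalar (fps_nth G (n div k)) * v ^ (n div k) else 0)"

lemma fps_subst_1: "k > 0 \<Longrightarrow> fps_subst v k 1 = 1"
  by (rule fps_ext) (auto simp: fps_subst_def elim!: dvdE)

lemma fps_subst_const: "k > 0 \<Longrightarrow> fps_subst v k (fps_const c) = fps_const (scalar c)"
  by (rule fps_ext) (auto simp: fps_subst_def elim!: dvdE)

lemma fps_subst_X: "k > 0 \<Longrightarrow> fps_subst v k fps_X = fps_const v * fps_X ^ k"
  by (rule fps_ext) (auto simp: fps_subst_def fps_X_power_nth elim!: dvdE)

lemma fps_subst_minus: "fps_subst v k (F - G) = fps_subst v k F - fps_subst v k G"
proof (rule fps_ext)
  fix n
  have "scalar (a - b) = scalar a - scalar b" for a b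
    using scalar_add[of a "- b"] by (simp add: scalar_uminus)
  then show "fps_nth (fps_subst v k (F - G)) n = fps_nth (fps_subst v k F - fps_subst v k G) n"
    by (simp add: fps_subst_def left_diff_distrib)
qed

lemma fps_subst_mult:
  assumes k: "k > 0"
  shows "fps_subst v k (F * G) = fps_subst v k F * fps_subst v k G"
proof (rule fps_ext)
  fix n
  let ?f = "\<lambda>F n. scalar (fps_nth F n) * v ^ n"
  let ?g = "\<lambda>i. (if k dvd i then ?f F (i div k) else 0) * (if k dvd n - i then ?f G ((n - i) div k) else 0)"
  have rhs: "fps_nth (fps_subst v k F * fps_subst v k G) n
     = (\<Sum>i=0..n. ?g i)"
    by (simp add: fps_mult_nth fps_subst_def)
  show "fps_nth (fps_subst v k (F * G)) n = fps_nth (fps_subst v k F * fps_subst v k G) n"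
  proof (cases "k dvd n")
    case True
    then obtain N where N: "n = k * N" by auto
    have "(\<Sum>i=0..n. ?g i) = (\<Sum>i | i \<in> {0..n} \<and> k dvd i. ?g i)"
      by (rule sum.mono_neutral_right) auto
    also have "\<dots> = (\<Sum>j=0..N. ?f F j * ?f G (N - j))"
    proof (rule sum.reindex_bij_witness[of _ "\<lambda>j. k * j" "\<lambda>i. i div k"])
      fix i assume "i \<in> {i. i \<in> {0..n} \<and> k dvd i}"
      then obtain j where j: "i = k * j" "i \<le> n" by auto
      have "n - k * j = k * (N - j)" using N by (simp add: right_diff_distrib')
      then show "k * (i div k) = i" "i div k \<in> {0..N}" "?f F (i div k) * ?f G (N - i div k) = ?g i"
        using j N k by auto
    qed (use N k in auto)
    also have "\<dots> = (\<Sum>j=0..N. scalar (fps_nth F j * fps_nth G (N - j)) * v ^ N)"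
    proof (rule sum.cong[OF refl])
      fix j assume "j \<in> {0..N}"
      then have "v ^ N = v ^ j * v ^ (N - j)" by (simp flip: power_add)
      then show "?f F j * ?f G (N - j) = scalar (fps_nth F j * fps_nth G (N - j)) * v ^ N"
        by (simp add: scalar_mult mult_ac)
    qed
    also have "\<dots> = fps_nth (fps_subst v k (F * G)) n"
      using N k by (simp add: fps_subst_def fps_mult_nth scalar_sum sum_distrib_right)
    finally show ?thesis unfolding rhs by simp
  next
    case False
    have "?g i = 0"
      if "i \<in> {0..n}" for i
    proof -
      have "\<not> (k dvd i \<and> k dvd n - i)"
      proof
        assume "k dvd i \<and> k dvd n - i"
        then have "k dvd i + (n - i)" by (intro dvd_add) auto
        then show False using False that by simp
      qed
      then show ?thesis by auto
    qed
    then show ?thesis unfolding rhs using False by (simp add: fps_subst_def)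
  qed
qed

lemma fps_subst_power: "k > 0 \<Longrightarrow> fps_subst v k (F ^ n) = fps_subst v k F ^ n"
  by (induction n) (simp_all add: fps_subst_1 fps_subst_mult)

lemma fps_subst_prod: "k > 0 \<Longrightarrow> fps_subst v k (\<Prod>i\<in>A. F i) = (\<Prod>i\<in>A. fps_subst v k (F i))"
  by (induction A rule: infinite_finite_induct) (simp_all add: fps_subst_1 fps_subst_mult)

text \<open>Lets the logarithm and exponential in \<open>fps_cpow\<close> be computed over the
  complex numbers before \<open>v * X ^ k\<close> is substituted.\<close>

lemma lift_compose_subst:
  assumes k: "k > 0" and G: "fps_nth G 0 = 0"
  shows "lift_fps E oo fps_subst v k G = fps_subst v k (E oo G)"
proof (rule fps_ext)
  fix n
  have lhs: "fps_nth (lift_fps E oo fps_subst v k G) n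
     = (\<Sum>i=0..n. scalar (fps_nth E i) * fps_nth (fps_subst v k (G ^ i)) n)"
    by (simp add: fps_compose_nth lift_fps_def fps_subst_power[OF k])
  show "fps_nth (lift_fps E oo fps_subst v k G) n = fps_nth (fps_subst v k (E oo G)) n"
  proof (cases "k dvd n")
    case True
    then obtain N where N: "n = k * N" by auto
    have "(\<Sum>i=0..n. scalar (fps_nth E i) * fps_nth (fps_subst v k (G ^ i)) n)
       = (\<Sum>i=0..n. scalar (fps_nth E i * fps_nth (G ^ i) N) * v ^ N)"
      using N k by (simp add: fps_subst_def scalar_mult mult_ac)
    also have "\<dots> = (\<Sum>i=0..N. scalar (fps_nth E i * fps_nth (G ^ i) N) * v ^ N)"
    proof (rule sum.mono_neutral_right)
      show "\<forall>i\<in>{0..n} - {0..N}. scalar (fps_nth E i * fps_nth (G ^ i) N) * v ^ N = 0"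
        using startsby_zero_power_prefix[OF G] by auto
    qed (use N k in auto)
    also have "\<dots> = fps_nth (fps_subst v k (E oo G)) n"
      using N k by (simp add: fps_subst_def fps_compose_nth scalar_sum sum_distrib_right)
    finally show ?thesis unfolding lhs .
  next
    case False
    then show ?thesis unfolding lhs by (simp add: fps_subst_def)
  qed
qed

lemma fps_cpow_subst:
  assumes "k > 0" "fps_nth F 0 = 1"
  shows "fps_cpow (fps_subst v k F) c
    = fps_subst v k (fps_exp 1 oo (fps_const c * (fps_ln 1 oo (F - 1))))"
proof -
  have "fps_subst v k F - 1 = fps_subst v k (F - 1)"
    using assms by (simp add: fps_subst_minus fps_subst_1)
  moreover have "lift_fps (fps_ln 1) oo fps_subst v k (F - 1) = fps_subst v k (fps_ln 1 oo (F - 1))"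
    using assms by (intro lift_compose_subst) auto
  moreover have "fps_const (scalar c) * fps_subst v k (fps_ln 1 oo (F - 1))
     = fps_subst v k (fps_const c * (fps_ln 1 oo (F - 1)))"
    using assms by (simp add: fps_subst_mult fps_subst_const)
  moreover have "lift_fps (fps_exp 1) oo fps_subst v k (fps_const c * (fps_ln 1 oo (F - 1)))
     = fps_subst v k (fps_exp 1 oo (fps_const c * (fps_ln 1 oo (F - 1))))"
    using assms by (intro lift_compose_subst) (auto simp: fps_compose_nth)
  ultimately show ?thesis unfolding fps_cpow_def by simp
qed

section \<open>Infinite products and the logarithm of the Euler product\<close>

lemma factor_nth:
  fixes a q :: "'a::comm_ring_1 fps"
  assumes "fps_nth a 0 = 0" "fps_nth q 0 = 0" "n \<le> N"
  shows "fps_nth (F * (1 - a * q ^ N)) n = fps_nth F n"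
proof -
  have "fps_nth (a * q ^ N) i = 0" if "i \<le> N" for i
    unfolding fps_mult_nth
  proof (rule sum.neutral, rule ballI)
    fix j assume j: "j \<in> {0..i}"
    show "fps_nth a j * fps_nth (q ^ N) (i - j) = 0"
    proof (cases "j = 0")
      case False
      then have "i - j < N" using that j by auto
      then show ?thesis using startsby_zero_power_prefix[OF assms(2), of N] by simp
    qed (use assms(1) in simp)
  qed
  then have "fps_nth (F * (a * q ^ N)) n = 0"
    unfolding fps_mult_nth[of F] using assms(3) by (intro sum.neutral) auto
  then show ?thesis by (simp add: right_diff_distrib)
qed

lemma partial_product_stable:
  fixes a q :: "'a::comm_ring_1 fps"
  assumes "fps_nth a 0 = 0" "fps_nth q 0 = 0" "n \<le> N"
  shows "fps_nth (\<Prod>j<N. 1 - a * q ^ j) n = fps_nth (\<Prod>j<n. 1 - a * q ^ j) n"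
  using assms(3)
proof (induction N rule: dec_induct)
  case (step N)
  then show ?case using factor_nth[OF assms(1,2), of n N] by simp
qed simp

text \<open>Factor \<open>j\<close> changes only coefficients of degree above \<open>j\<close>, so
  the partial products stabilize to a series \<open>P\<close>. As \<open>prodinf\<close> is a
  definite description, \<open>P\<close> must also be shown to be the only value.\<close>

lemma qpoch_inf_nth:
  assumes a: "fps_nth a 0 = 0" and q: "fps_nth q 0 = 0" and n: "n \<le> N"
  shows "fps_nth (qpoch_inf a q) n = fps_nth (\<Prod>j<N. 1 - a * q ^ j) n"
proof -
  let ?f = "\<lambda>j. 1 - a * q ^ j"
  define P where "P = Abs_fps (\<lambda>n. fps_nth (\<Prod>j<n. ?f j) n)"
  have lim: "(\<lambda>n. \<Prod>i\<le>n. ?f (i + 0)) \<longlonglongrightarrow> P"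
  proof (rule tendsto_fpsI)
    fix m
    show "\<forall>\<^sub>F x in sequentially. fps_nth (\<Prod>i\<le>x. ?f (i + 0)) m = fps_nth P m"
      unfolding eventually_sequentially
    proof (intro exI[of _ m] allI impI)
      fix x assume "m \<le> x"
      then show "fps_nth (\<Prod>i\<le>x. ?f (i + 0)) m = fps_nth P m"
        using partial_product_stable[OF a q, of m "Suc x"]
        by (simp only: lessThan_Suc_atMost P_def fps_nth_Abs_fps add_0_right le_SucI)
    qed
  qed
  have "fps_nth P 0 = 1" by (simp add: P_def)
  then have "P \<noteq> 0" by (metis fps_zero_nth zero_neq_one)
  then have raw: "raw_has_prod ?f 0 P" using lim by (simp only: raw_has_prod_def simp_thms)
  \<comment> \<open>Rules out the case of \<open>has_prod\<close> in which a factor is 0, so that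
    every value is a limit of the partial products from index 0.\<close>
  have nz: "?f i \<noteq> 0" for i
  proof
    assume "?f i = 0"
    then have "fps_nth (?f i) 0 = 0" by simp
    then show False using a by simp
  qed
  have "prodinf ?f = P"
    unfolding prodinf_def
  proof (rule the_equality)
    show "?f has_prod P" using raw by (simp add: has_prod_def)
    fix p assume "?f has_prod p"
    then have "raw_has_prod ?f 0 p" using nz by (auto simp: has_prod_def)
    then have "(\<lambda>n. \<Prod>i\<le>n. ?f (i + 0)) \<longlonglongrightarrow> p" by (simp only: raw_has_prod_def simp_thms)
    then show "p = P" using lim LIMSEQ_unique by blast
  qed
  then show ?thesis
    unfolding qpoch_inf_def P_def using partial_product_stable[OF a q n] by simp
qed

definition euler :: "complex fps" where
  "euler = Abs_fps (\<lambda>n. fps_nth (\<Prod>j<n. 1 - fps_X * fps_X ^ j) n)"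

lemma euler_nth: "n \<le> N \<Longrightarrow> fps_nth euler n = fps_nth (\<Prod>j<N. 1 - fps_X * fps_X ^ j) n"
  unfolding euler_def fps_nth_Abs_fps by (subst partial_product_stable[of fps_X fps_X n N]) simp_all

lemma euler_0 [simp]: "fps_nth euler 0 = 1"
  by (simp add: euler_def)

lemma qpoch_inf_eq_subst:
  assumes k: "k > 0"
  shows "qpoch_inf (fps_const v * fps_X ^ k) (fps_const v * fps_X ^ k) = fps_subst v k euler"
proof (rule fps_ext)
  fix n
  let ?Y = "fps_const v * fps_X ^ k :: coeff_ring fps"
  have Y: "fps_nth ?Y 0 = 0" using k by (simp add: fps_X_power_nth)
  have "fps_nth (qpoch_inf ?Y ?Y) n = fps_nth (\<Prod>j<n. 1 - ?Y * ?Y ^ j) n"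
    by (rule qpoch_inf_nth[OF Y Y order_refl])
  also have "(\<Prod>j<n. 1 - ?Y * ?Y ^ j) = fps_subst v k (\<Prod>j<n. 1 - fps_X * fps_X ^ j)"
    unfolding fps_subst_prod[OF k] fps_subst_minus fps_subst_1[OF k] fps_subst_mult[OF k]
      fps_subst_power[OF k] fps_subst_X[OF k] ..
  also have "fps_nth \<dots> n = fps_nth (fps_subst v k euler) n"
    by (simp add: fps_subst_def euler_nth[of "n div k" n])
  finally show "fps_nth (qpoch_inf ?Y ?Y) n = fps_nth (fps_subst v k euler) n" .
qed

lemma lambert_summand:
  assumes "d > 0"
  shows "(1 - fps_X ^ d) * Abs_fps (\<lambda>n. if d dvd n \<and> n > 0 then of_nat d else 0)
    = (of_nat d * fps_X ^ d :: complex fps)"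
proof (rule fps_ext)
  fix n
  let ?A = "Abs_fps (\<lambda>n. if d dvd n \<and> n > 0 then of_nat d else 0) :: complex fps"
  have "fps_nth ((1 - fps_X ^ d) * ?A) n = fps_nth ?A n - fps_nth (fps_X ^ d * ?A) n"
    by (simp add: left_diff_distrib)
  also have "\<dots> = (if n = d then of_nat d else 0)"
  proof (cases "n < d")
    case True
    then have "\<not> (d dvd n \<and> n > 0)" using dvd_imp_le[of d n] by auto
    then show ?thesis using True by (simp add: fps_X_power_mult_nth)
  next
    case False
    then have "d dvd n - d \<longleftrightarrow> d dvd n" by (simp add: dvd_minus_self)
    then show ?thesis using False assms by (auto simp: fps_X_power_mult_nth)
  qed
  also have "\<dots> = fps_nth (of_nat d * fps_X ^ d :: complex fps) n"
    by (simp add: fps_of_nat[symmetric] fps_X_power_nth)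
  finally show "fps_nth ((1 - fps_X ^ d) * ?A) n = fps_nth (of_nat d * fps_X ^ d) n" .
qed

text \<open>Logarithmic differentiation of the partial products: the factor \<open>1 - X ^ d\<close>
  contributes \<open>- d X ^ d / (1 - X ^ d)\<close>. The sum of these has as coefficients the
  divisor sums of \<open>n\<close>, which are \<open>n * inv_divisor_sum n\<close>.\<close>

lemma euler_deriv: "fps_deriv euler = - (euler * fps_deriv lambert)"
proof -
  define A where "A = (\<lambda>d. Abs_fps (\<lambda>n. if d dvd n \<and> n > 0 then of_nat d else 0) :: complex fps)"
  have prod: "fps_X * fps_deriv (\<Prod>j<J. 1 - fps_X * fps_X ^ j)
      = - ((\<Prod>j<J. 1 - fps_X * fps_X ^ j) * (\<Sum>j<J. A (Suc j)))" for J
  proof (induction J)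
    case (Suc J)
    let ?E = "\<Prod>j<J. 1 - fps_X * fps_X ^ j :: complex fps" and ?f = "1 - fps_X ^ Suc J :: complex fps"
    have "fps_deriv (fps_X ^ Suc J :: complex fps) = of_nat (Suc J) * fps_X ^ J"
      by (simp add: fps_deriv_power' del: power_Suc of_nat_Suc)
    then have "fps_X * fps_deriv ?f = - (of_nat (Suc J) * fps_X ^ Suc J)"
      by (simp add: mult_ac del: of_nat_Suc)
    also have "\<dots> = - (?f * A (Suc J))"
      using lambert_summand[of "Suc J"] by (simp add: A_def)
    finally have f: "fps_X * fps_deriv ?f = - (?f * A (Suc J))" .
    have "fps_X * fps_deriv (?E * ?f) = (fps_X * fps_deriv ?E) * ?f + ?E * (fps_X * fps_deriv ?f)"
      by (simp add: algebra_simps del: power_Suc)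
    also have "\<dots> = - (?E * ?f * ((\<Sum>j<J. A (Suc j)) + A (Suc J)))"
      unfolding f Suc.IH by (simp add: algebra_simps del: power_Suc)
    finally show ?case by simp
  qed simp
  have L: "fps_nth (\<Sum>j<J. A (Suc j)) n = fps_nth (fps_X * fps_deriv lambert) n" if n: "n \<le> J" for n J
  proof (cases n)
    case 0
    then show ?thesis by (simp add: fps_sum_nth A_def)
  next
    case (Suc n')
    have "fps_nth (\<Sum>j<J. A (Suc j)) n = (\<Sum>j<J. if Suc j dvd n then of_nat (Suc j) else 0)"
      using Suc by (simp add: fps_sum_nth A_def del: of_nat_Suc)
    also have "\<dots> = (\<Sum>j | j \<in> {..<J} \<and> Suc j dvd n. of_nat (Suc j))"
      by (rule sum.inter_filter[symmetric]) simp
    \<comment> \<open>Passes to the complementary divisor \<open>k = n / (j + 1)\<close>.\<close>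
    also have "\<dots> = (\<Sum>k | k dvd n. of_nat n * (1 / of_nat k))"
    proof (rule sum.reindex_bij_witness[of _ "\<lambda>k. n div k - 1" "\<lambda>j. n div Suc j"])
      fix j assume "j \<in> {j. j \<in> {..<J} \<and> Suc j dvd n}"
      then obtain q where q: "n = Suc j * q" by auto
      then have q0: "q \<noteq> 0" using Suc by (cases "q = 0") auto
      show "n div (n div Suc j) - 1 = j" "n div Suc j \<in> {k. k dvd n}"
        "of_nat n * (1 / of_nat (n div Suc j)) = (of_nat (Suc j) :: complex)"
      proof -
        have d: "n div Suc j = q" "n div q = Suc j"
          unfolding q using q0 by (simp_all del: mult_Suc)
        have "of_nat n = of_nat (Suc j) * (of_nat q :: complex)" unfolding q by (rule of_nat_mult)
        then show "n div (n div Suc j) - 1 = j" "n div Suc j \<in> {k. k dvd n}"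
          "of_nat n * (1 / of_nat (n div Suc j)) = (of_nat (Suc j) :: complex)"
          unfolding d using q0 q by (simp_all del: of_nat_Suc mult_Suc)
      qed
    next
      fix k assume "k \<in> {k. k dvd n}"
      then obtain q where q: "n = k * q" by auto
      then have q0: "q \<noteq> 0" "k \<noteq> 0" using Suc by (cases "q = 0"; cases "k = 0"; auto)+
      show "n div Suc (n div k - 1) = k" using q0 by (simp add: q)
      have "q \<le> n" using q0 by (simp add: q)
      then have "q - 1 < J" using n q0(1) by linarith
      then show "n div k - 1 \<in> {j. j \<in> {..<J} \<and> Suc j dvd n}"
        using q0 by (simp add: q)
    qed
    also have "\<dots> = of_nat n * inv_divisor_sum n"
      by (simp add: inv_divisor_sum_def sum_distrib_left)
    also have "\<dots> = fps_nth (fps_X * fps_deriv lambert) n"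
      using Suc by (simp add: lambert_def)
    finally show ?thesis .
  qed
  have "fps_X * fps_deriv euler = - (euler * (fps_X * fps_deriv lambert))"
  proof (rule fps_ext)
    fix n
    let ?E = "\<Prod>j<n. 1 - fps_X * fps_X ^ j :: complex fps"
    have "fps_nth (fps_X * fps_deriv euler) n = fps_nth (fps_X * fps_deriv ?E) n"
    proof -
      have "fps_nth (fps_X * fps_deriv F) n = of_nat n * fps_nth F n" for F :: "complex fps"
        by (cases n) simp_all
      then show ?thesis by (simp only: euler_nth[OF order_refl])
    qed
    also have "\<dots> = - (\<Sum>i=0..n. fps_nth ?E i * fps_nth (\<Sum>j<n. A (Suc j)) (n - i))"
      unfolding prod by (simp add: fps_mult_nth)
    also have "\<dots> = - (\<Sum>i=0..n. fps_nth euler i * fps_nth (fps_X * fps_deriv lambert) (n - i))"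
    proof (intro arg_cong[where f = uminus] sum.cong refl)
      fix i assume "i \<in> {0..n}"
      then have "i \<le> n" by simp
      show "fps_nth ?E i * fps_nth (\<Sum>j<n. A (Suc j)) (n - i)
          = fps_nth euler i * fps_nth (fps_X * fps_deriv lambert) (n - i)"
        unfolding L[OF diff_le_self] euler_nth[OF \<open>i \<le> n\<close>] ..
    qed
    finally show "fps_nth (fps_X * fps_deriv euler) n = fps_nth (- (euler * (fps_X * fps_deriv lambert))) n"
      by (simp add: fps_mult_nth)
  qed
  then have "fps_X * fps_deriv euler = fps_X * (- (euler * fps_deriv lambert))"
    by (simp add: mult_ac)
  then show ?thesis by (metis fps_X_neq_zero mult_cancel_left)
qed

lemma ln_euler: "fps_ln 1 oo (euler - 1) = - lambert"
proof -
  have e: "fps_nth (euler - 1) 0 = 0" by simp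
  have "fps_deriv (fps_ln 1 oo (euler - 1)) = (inverse (1 + fps_X) oo (euler - 1)) * fps_deriv euler"
    using fps_compose_deriv[OF e, of "fps_ln 1"] by (simp add: fps_ln_deriv)
  also have "inverse (1 + fps_X) oo (euler - 1) = inverse euler"
    by (subst fps_inverse_compose[OF e]) (simp_all add: fps_compose_add_distrib fps_X_fps_compose_startby0[OF e])
  also have "inverse euler * fps_deriv euler = - fps_deriv lambert"
    unfolding euler_deriv using inverse_mult_eq_1[of euler] by (simp add: mult.assoc[symmetric])
  finally have "fps_deriv (fps_ln 1 oo (euler - 1)) = fps_deriv (- lambert)" by simp
  then show ?thesis by (subst (asm) fps_deriv_eq_iff) simp
qed

lemma euler_exp: "euler * (fps_exp 1 oo lambert) = 1"
proof -
  let ?E = "fps_exp 1 oo lambert"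
  have "fps_deriv (euler * ?E) = 0"
    by (simp add: euler_deriv fps_compose_deriv[OF lambert_0] algebra_simps)
  then have "euler * ?E = fps_const (fps_nth (euler * ?E) 0)"
    using fps_deriv_eq_0_iff by blast
  then show ?thesis by simp
qed

lemma exp_scaled_compose:
  fixes F :: "complex fps"
  shows "fps_exp 1 oo (fps_const c * F) = fps_exp c oo F"
  by (rule fps_ext)
     (simp add: fps_compose_nth power_mult_distrib fps_const_power mult_ac)

lemma fps_cpow_qpoch:
  assumes "k > 0"
  shows "fps_cpow (qpoch_inf (fps_const v * fps_X ^ k) (fps_const v * fps_X ^ k)) c
    = fps_subst v k (fps_exp (- c) oo lambert)"
proof -
  have "fps_const c * (- lambert) = fps_const (- c) * lambert"
    by (simp flip: fps_const_neg)
  then show ?thesis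
    using assms by (simp add: qpoch_inf_eq_subst fps_cpow_subst ln_euler exp_scaled_compose)
qed

section \<open>The generating function of self-conjugate partitions\<close>

abbreviation odd_size :: "nat set \<Rightarrow> nat" where
  "odd_size D \<equiv> \<Sum>a\<in>D. 2 * a + 1"

abbreviation nek_coeff_series :: "complex \<Rightarrow> complex fps" where
  "nek_coeff_series z \<equiv> fps_exp (1 - z) oo lambert"

definition runner_weight :: "nat \<Rightarrow> nat \<Rightarrow> int set \<Rightarrow> nat" where
  "runner_weight u = runner_sum u (\<lambda>a. 2 * a + 1)"

text \<open>The sum of \<open>2 (r + 2 u j) + 1\<close> over the ground state \<open>{..<c}\<close>
  relative to the vacuum. By \<open>theta_exp_ge\<close> the argument of \<open>nat\<close> is
  nonnegative when \<open>r < u\<close>.\<close>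

definition theta_exp :: "nat \<Rightarrow> nat \<Rightarrow> int \<Rightarrow> nat" where
  "theta_exp u r c = nat ((2 * int r + 1) * c + 2 * int u * (c * (c - 1)))"

text \<open>Besides nonnegativity, the bound leaves only finitely many charges for each exponent, as
  \<open>graded_theta\<close> requires. For \<open>c = - d < 0\<close> the expression is
  \<open>d (2 u (d + 1) - 2 r - 1)\<close>, where the second factor is positive.\<close>

lemma theta_exp_ge:
  assumes "r < u"
  shows "\<bar>c\<bar> \<le> (2 * int r + 1) * c + 2 * int u * (c * (c - 1))"
proof (cases "c \<ge> 0")
  case True
  have "0 \<le> c * (c - 1)" using True by (cases "c = 0") auto
  then have "0 \<le> 2 * int u * (c * (c - 1))" by simp
  moreover have "1 * c \<le> (2 * int r + 1) * c" using True by (intro mult_right_mono) auto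
  ultimately show ?thesis unfolding abs_of_nonneg[OF True] by linarith
next
  case False
  define d where "d = - c"
  have d: "d \<ge> 1" using False by (simp add: d_def)
  have "(2 * int r + 1) * c + 2 * int u * (c * (c - 1)) = d * (2 * int u * (d + 1) - 2 * int r - 1)"
    by (simp add: d_def algebra_simps)
  moreover have "2 * int u * 2 \<le> 2 * int u * (d + 1)" using d by (intro mult_left_mono) auto
  then have "1 \<le> 2 * int u * (d + 1) - 2 * int r - 1" using assms by linarith
  then have "d * 1 \<le> d * (2 * int u * (d + 1) - 2 * int r - 1)" using d by (intro mult_left_mono) auto
  ultimately show ?thesis using False by (simp add: d_def)
qed

lemma graded_theta:
  assumes "r < u"
  shows "graded UNIV (theta_exp u r)"
  unfolding graded_def
proof
  fix n
  have "{c. c \<in> UNIV \<and> theta_exp u r c = n} \<subseteq> {- int n..int n}"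
  proof
    fix c assume "c \<in> {c. c \<in> UNIV \<and> theta_exp u r c = n}"
    then show "c \<in> {- int n..int n}"
      using theta_exp_ge[OF assms, of c] by (auto simp: theta_exp_def)
  qed
  then show "finite {c. c \<in> UNIV \<and> theta_exp u r c = n}" by (rule finite_subset) simp
qed

text \<open>The weight \<open>2 a + 1\<close> changes sign under \<open>a\<close> to
  \<open>- 1 - a\<close>, so a runner's share of the size is a \<open>maya_sum\<close> of an affine
  function of \<open>j\<close>, and \<open>maya_energy\<close> separates charge from
  inversions.\<close>

lemma runner_weight_eq:
  assumes "r < u" "maya M"
  shows "runner_weight u r M = theta_exp u r (charge M) + 4 * u * card (inversions M)"
proof -
  let ?g = "\<lambda>j. 2 * (int r + 2 * int u * j) + 1"
  have pos: "int (\<Sum>j\<in>M \<inter> {0..}. 2 * (r + 2 * u * nat j) + 1) = (\<Sum>j\<in>M \<inter> {0..}. ?g j)"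
    unfolding of_nat_sum by (rule sum.cong) auto
  have neg: "int (\<Sum>j\<in>{..<0} - M. 2 * (2 * u - 1 - r + 2 * u * nat (- 1 - j)) + 1)
      = - (\<Sum>j\<in>{..<0} - M. ?g j)"
    unfolding of_nat_sum sum_negf[symmetric]
    by (rule sum.cong) (use assms(1) in \<open>auto simp: of_nat_diff algebra_simps\<close>)
  have "int (runner_weight u r M) = maya_sum ?g M"
    unfolding runner_weight_def runner_sum_def of_nat_add[of "sum _ (M \<inter> {0..})"] pos neg maya_sum_def by simp
  also have "\<dots> = (2 * int r + 1) * charge M + 4 * int u * maya_sum (\<lambda>j. j) M"
    by (simp add: maya_sum_def charge_def sum.distrib sum_distrib_left algebra_simps)
  also have "4 * int u * maya_sum (\<lambda>j. j) M = 2 * int u * (2 * maya_sum (\<lambda>j. j) M)" by simp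
  also have "\<dots> = 2 * int u * (charge M * (charge M - 1)) + int (4 * u * card (inversions M))"
    unfolding maya_energy[OF assms(2)] by (simp add: algebra_simps)
  finally have "int (runner_weight u r M) = ((2 * int r + 1) * charge M + 2 * int u * (charge M * (charge M - 1)))
      + int (4 * u * card (inversions M))" by simp
  moreover have "0 \<le> (2 * int r + 1) * charge M + 2 * int u * (charge M * (charge M - 1))"
    using theta_exp_ge[OF assms(1), of "charge M"] by linarith
  ultimately show ?thesis unfolding theta_exp_def by linarith
qed

text \<open>\<open>v\<close> becomes \<open>x_var ^ 2\<close>, as an inversion on a runner stands
  for two hooks, or 1 in the specialization. All positions on runner \<open>r\<close> have the
  parity of \<open>r\<close>, the modulus being even; hence the sign at the charge.\<close>

definition class_coeff :: "nat \<Rightarrow> coeff_ring \<Rightarrow> complex \<Rightarrow> int set \<Rightarrow> coeff_ring" where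
  "class_coeff r v z M = b_pow ((- 1) ^ r * charge M)
     * (v ^ card (inversions M) * scalar (int_weight z M))"

lemma gf_charge_0:
  assumes "u > 0"
  shows "graded {M. maya M \<and> charge M = 0} (\<lambda>M. 4 * u * card (inversions M))"
    and "gf {M. maya M \<and> charge M = 0} (\<lambda>M. 4 * u * card (inversions M))
        (\<lambda>M. v ^ card (inversions M) * scalar (int_weight z M))
      = fps_subst v (4 * u) (nek_coeff_series z)"
proof -
  let ?A = "{M. maya M \<and> charge M = 0}" and ?w = "\<lambda>M. 4 * u * card (inversions M)"
  let ?f = "\<lambda>M. v ^ card (inversions M) * scalar (int_weight z M)"
  let ?B = "\<lambda>N. {M. maya M \<and> charge M = 0 \<and> card (inversions M) = N}"
  have fiber: "{M. M \<in> ?A \<and> 4 * u * card (inversions M) = n}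
     = (if 4 * u dvd n then {M. maya M \<and> charge M = 0 \<and> card (inversions M) = n div (4 * u)} else {})" for n
    using assms by auto
  show "graded ?A ?w"
    unfolding graded_def fiber using finite_maya_charge by simp
  show "gf ?A ?w
        ?f
      = fps_subst v (4 * u) (nek_coeff_series z)"
  proof (rule fps_ext)
    fix n
    have "(\<Sum>M\<in>?B N. ?f M)
        = scalar (fps_nth (nek_coeff_series z) N) * v ^ N" for N
    proof -
      have "(\<Sum>M\<in>?B N. ?f M)
         = v ^ N * (\<Sum>M\<in>?B N. scalar (int_weight z M))"
        unfolding sum_distrib_left by (rule sum.cong) auto
      then show ?thesis
        by (simp only: scalar_sum[symmetric] nekrasov_okounkov mult.commute)
    qed
    then show "fps_nth (gf ?A ?w
        ?f) n
      = fps_nth (fps_subst v (4 * u) (nek_coeff_series z)) n"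
      unfolding gf_def fps_nth_Abs_fps fiber fps_subst_def by simp
  qed
qed

lemma charge_bij:
  "bij_betw (\<lambda>(c, M). (\<lambda>j. j + c) ` M) (UNIV \<times> {M. maya M \<and> charge M = 0}) {M. maya M}"
proof (rule bij_betw_byWitness[of _ "\<lambda>M. (charge M, (\<lambda>j. j + - charge M) ` M)"])
  have shift: "(\<lambda>j. j + - c) ` ((\<lambda>j. j + c) ` M) = M" "(\<lambda>j. j + c) ` ((\<lambda>j. j + - c) ` M) = M"
    for c :: int and M
    by (simp_all add: image_image)
  show "\<forall>p\<in>UNIV \<times> {M. maya M \<and> charge M = 0}. (\<lambda>M. (charge M, (\<lambda>j. j + - charge M) ` M))
      ((\<lambda>(c, M). (\<lambda>j. j + c) ` M) p) = p"
    using shift by (auto simp: charge_shift simp del: image_add_0)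
  show "\<forall>M\<in>{M. maya M}. (\<lambda>(c, M). (\<lambda>j. j + c) ` M) (charge M, (\<lambda>j. j + - charge M) ` M) = M"
    using shift by auto
  show "(\<lambda>(c, M). (\<lambda>j. j + c) ` M) ` (UNIV \<times> {M. maya M \<and> charge M = 0}) \<subseteq> {M. maya M}"
    using maya_shift by auto
  show "(\<lambda>M. (charge M, (\<lambda>j. j + - charge M) ` M)) ` {M. maya M} \<subseteq> UNIV \<times> {M. maya M \<and> charge M = 0}"
    using maya_shift[of _ "- charge _"] charge_shift[of _ "- charge _"] by fastforce
qed

definition theta :: "nat \<Rightarrow> nat \<Rightarrow> coeff_ring fps" where
  "theta u r = gf UNIV (theta_exp u r) (\<lambda>c. b_pow ((- 1) ^ r * c))"

lemma gf_runner:
  assumes "r < u"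
  shows "graded {M. maya M} (runner_weight u r)"
    and "gf {M. maya M} (runner_weight u r) (class_coeff r v z)
       = theta u r * fps_subst v (4 * u) (nek_coeff_series z)"
proof -
  have u: "u > 0" using assms by simp
  let ?A = "{M. maya M \<and> charge M = 0}" and ?h = "\<lambda>(c, M). (\<lambda>j. j + c) ` M"
  let ?w = "\<lambda>p. theta_exp u r (fst p) + 4 * u * card (inversions (snd p))"
  have w: "runner_weight u r (?h p) = ?w p" if p0: "p \<in> UNIV \<times> ?A" for p
  proof -
    obtain c M where p: "p = (c, M)" "maya M" "charge M = 0" using p0 by (cases p) auto
    show ?thesis unfolding p(1) prod.case fst_conv snd_conv
        runner_weight_eq[OF assms maya_shift[OF p(2)]] charge_shift[OF p(2)]
        card_inversions_shift[OF p(2)] p(3) by simp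
  qed
  have f: "class_coeff r v z (?h p)
      = b_pow ((- 1) ^ r * fst p) * (v ^ card (inversions (snd p)) * scalar (int_weight z (snd p)))"
    if p0: "p \<in> UNIV \<times> ?A" for p
  proof -
    obtain c M where p: "p = (c, M)" "maya M" "charge M = 0" using p0 by (cases p) auto
    show ?thesis unfolding p(1) prod.case fst_conv snd_conv class_coeff_def charge_shift[OF p(2)]
        card_inversions_shift[OF p(2)] int_weight_shift[OF p(2)] p(3) by simp
  qed
  have "graded (UNIV \<times> ?A) ?w \<longleftrightarrow> graded {M. maya M} (runner_weight u r)"
    by (rule graded_bij[OF charge_bij]) (rule w)
  moreover have "graded (UNIV \<times> ?A) ?w"
    by (rule graded_Times[OF graded_theta[OF assms] gf_charge_0(1)[OF u]])
  ultimately show "graded {M. maya M} (runner_weight u r)" by blast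
  have "gf {M. maya M} (runner_weight u r) (class_coeff r v z)
     = gf (UNIV \<times> ?A) ?w (\<lambda>p. b_pow ((- 1) ^ r * fst p)
        * (v ^ card (inversions (snd p)) * scalar (int_weight z (snd p))))"
    by (rule sym, rule gf_bij[OF charge_bij], rule w, assumption, rule f, assumption)
  also have "\<dots> = theta u r * fps_subst v (4 * u) (nek_coeff_series z)"
    unfolding theta_def gf_charge_0(2)[OF u, symmetric]
    by (rule gf_Times[OF graded_theta[OF assms] gf_charge_0(1)[OF u]])
  finally show "gf {M. maya M} (runner_weight u r) (class_coeff r v z)
       = theta u r * fps_subst v (4 * u) (nek_coeff_series z)" .
qed

lemma runners_apply: "r < u \<Longrightarrow> runners u D r = runner u D r"
  by (simp add: runners_def)

lemma gf_finite_sets: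
  assumes "u > 0"
  shows "graded {D. finite D} odd_size"
    and "gf {D. finite D} odd_size
        (\<lambda>D. \<Prod>r<u. class_coeff r v z (runner u D r))
      = (\<Prod>r<u. theta u r) * fps_subst v (4 * u) (nek_coeff_series z) ^ u"
proof -
  let ?P = "PiE {..<u} (\<lambda>_. {M. maya M})"
  have w: "(\<Sum>r<u. runner_weight u r (runners u D r)) = odd_size D" if "D \<in> {D. finite D}" for D
    using that sum_split_runners[of D u "\<lambda>a. 2 * a + 1"] assms
    by (simp add: runner_weight_def runners_apply)
  have gr: "graded ?P (\<lambda>y. \<Sum>r<u. runner_weight u r (y r)) \<and>
     gf ?P (\<lambda>y. \<Sum>r<u. runner_weight u r (y r)) (\<lambda>y. \<Prod>r<u. class_coeff r v z (y r))
      = (\<Prod>r<u. gf {M. maya M} (runner_weight u r) (class_coeff r v z))" for v z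
    by (rule gf_PiE) (auto intro: gf_runner)
  have "graded {D. finite D} odd_size
     \<longleftrightarrow> graded ?P (\<lambda>y. \<Sum>r<u. runner_weight u r (y r))"
    by (rule graded_bij[OF runners_bij[OF assms]], rule w)
  then show "graded {D. finite D} odd_size" using gr by blast
  have "gf {D. finite D} odd_size
        (\<lambda>D. \<Prod>r<u. class_coeff r v z (runner u D r))
     = gf ?P (\<lambda>y. \<Sum>r<u. runner_weight u r (y r)) (\<lambda>y. \<Prod>r<u. class_coeff r v z (y r))"
    by (rule gf_bij[OF runners_bij[OF assms]], rule w, assumption) (simp add: runners_apply)
  also have "\<dots> = (\<Prod>r<u. theta u r * fps_subst v (4 * u) (nek_coeff_series z))"
    using gr[of v z] by (simp add: gf_runner(2))
  finally show "gf {D. finite D} odd_size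
        (\<lambda>D. \<Prod>r<u. class_coeff r v z (runner u D r))
      = (\<Prod>r<u. theta u r) * fps_subst v (4 * u) (nek_coeff_series z) ^ u"
    by (simp add: prod.distrib)
qed

text \<open>As \<open>2 u - 1\<close> is odd, the reflected residue has the opposite parity, so
  holes count negatively and the sum becomes a charge.\<close>

lemma sum_sign_runner:
  assumes "r < u"
  shows "runner_sum u (\<lambda>a. (- 1) ^ a) r M = (- 1) ^ r * charge M"
proof -
  have even: "(- 1 :: int) ^ (r + 2 * u * k) = (- 1) ^ r" for k
    by (simp add: power_add power_mult)
  have odd: "(- 1 :: int) ^ (2 * u - 1 - r + 2 * u * k) = - ((- 1) ^ r)" for k
  proof -
    have "even (2 * u - 1 - r + 2 * u * k) \<longleftrightarrow> odd r" using assms by auto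
    then show ?thesis by (simp add: minus_one_power_iff)
  qed
  show ?thesis
    unfolding runner_sum_def even odd charge_def maya_sum_def by (simp add: algebra_simps)
qed

lemma b_pow_BG_runners:
  assumes "finite D" "u > 0"
  shows "(\<Sum>a\<in>D. (- 1) ^ a) = (\<Sum>r<u. (- 1) ^ r * charge (runner u D r))"
  using sum_split_runners[OF assms, of "\<lambda>a. (- 1 :: int) ^ a"] by (simp add: sum_sign_runner)

text \<open>A set \<open>D\<close> is a choice of factors in the product of
  \<open>1 + b ^ ((- 1) ^ a) q ^ (2 a + 1)\<close>. Even \<open>a\<close> give the exponents
  \<open>1\<close> modulo 4 with \<open>b\<close>, odd \<open>a\<close> the exponents
  \<open>3\<close> modulo 4 with \<open>1 / b\<close>. Coefficient \<open>n\<close> involves only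
  \<open>a < 2 * n\<close>.\<close>

lemma gf_strict_odd:
  "gf {D. finite D} odd_size (\<lambda>D. b_pow (\<Sum>a\<in>D. (- 1) ^ a))
   = qpoch_inf (- (fps_const (b_pow 1) * fps_X)) (fps_X ^ 4)
     * qpoch_inf (- (fps_const (b_pow (- 1)) * fps_X ^ 3)) (fps_X ^ 4)"
proof (rule fps_ext)
  fix n
  let ?F = "\<lambda>a. fps_const (b_pow ((- 1) ^ a)) * fps_X ^ (2 * a + 1) :: coeff_ring fps"
  let ?a1 = "- (fps_const (b_pow 1) * fps_X) :: coeff_ring fps"
  let ?a3 = "- (fps_const (b_pow (- 1)) * fps_X ^ 3) :: coeff_ring fps"
  let ?q = "fps_X ^ 4 :: coeff_ring fps"
  have "(\<Prod>j<N. 1 - ?a1 * ?q ^ j) * (\<Prod>j<N. 1 - ?a3 * ?q ^ j) = (\<Prod>a<2 * N. 1 + ?F a)" for N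
  proof (induction N)
    case (Suc N)
    have "1 - ?a1 * ?q ^ N = 1 + ?F (2 * N)"
      by (simp add: power_mult[symmetric] power_Suc[symmetric] mult.assoc del: power_Suc)
    moreover have "1 - ?a3 * ?q ^ N = 1 + ?F (2 * N + 1)"
    proof -
      have e: "2 * (2 * N + 1) + 1 = 3 + 4 * N" by simp
      show ?thesis unfolding e power_add[of _ 3] power_mult by (simp add: mult.assoc)
    qed
    moreover have "(\<Prod>a<2 * Suc N. 1 + ?F a) = (\<Prod>a<2 * N. 1 + ?F a) * (1 + ?F (2 * N)) * (1 + ?F (2 * N + 1))"
      by simp
    ultimately have step: "1 - ?a1 * ?q ^ N = 1 + ?F (2 * N)" "1 - ?a3 * ?q ^ N = 1 + ?F (2 * N + 1)"
      "(\<Prod>a<2 * Suc N. 1 + ?F a) = (\<Prod>a<2 * N. 1 + ?F a) * (1 + ?F (2 * N)) * (1 + ?F (2 * N + 1))"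
      by blast+
    have comm: "(A * f) * (B * g) = (A * B) * f * g" for A B f g :: "coeff_ring fps"
      by (simp only: mult_ac)
    show ?case unfolding step(3) prod.lessThan_Suc step(1,2) comm Suc.IH ..
  qed simp
  note prod = this
  have a: "fps_nth ?a1 0 = 0" "fps_nth ?a3 0 = 0" "fps_nth ?q 0 = 0"
    by (simp_all add: fps_X_power_nth)
  have "fps_nth (qpoch_inf ?a1 ?q * qpoch_inf ?a3 ?q) n
      = fps_nth ((\<Prod>j<n. 1 - ?a1 * ?q ^ j) * (\<Prod>j<n. 1 - ?a3 * ?q ^ j)) n"
    unfolding fps_mult_nth
    by (intro sum.cong refl arg_cong2[where f = "(*)"] qpoch_inf_nth a) auto
  also have "\<dots> = fps_nth (\<Prod>a<2 * n. ?F a + 1) n"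
    unfolding prod by (simp only: add.commute)
  also have "(\<Prod>a<2 * n. ?F a + 1) = (\<Sum>D\<in>Pow {..<2 * n}. (\<Prod>a\<in>D. ?F a) * (\<Prod>a\<in>{..<2 * n} - D. 1))"
    by (rule prod_add) simp
  also have "\<dots> = (\<Sum>D\<in>Pow {..<2 * n}. fps_const (b_pow (\<Sum>a\<in>D. (- 1) ^ a)) * fps_X ^ odd_size D)"
  proof (rule sum.cong[OF refl])
    fix D assume "D \<in> Pow {..<2 * n}"
    then have "finite D" using finite_subset by auto
    then have "(\<Prod>a\<in>D. fps_const (b_pow ((- 1) ^ a))) = (fps_const (b_pow (\<Sum>a\<in>D. (- 1) ^ a)))"
      by (induction D rule: finite_induct) (simp_all add: b_pow_add)
    then show "(\<Prod>a\<in>D. ?F a) * (\<Prod>a\<in>{..<2 * n} - D. 1)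
        = fps_const (b_pow (\<Sum>a\<in>D. (- 1) ^ a)) * fps_X ^ odd_size D"
      by (simp only: prod.distrib power_sum prod.neutral_const mult_1_right)
  qed
  also have "fps_nth \<dots> n = (\<Sum>D\<in>Pow {..<2 * n}. if odd_size D = n then b_pow (\<Sum>a\<in>D. (- 1) ^ a) else 0)"
    unfolding fps_sum_nth by (rule sum.cong[OF refl]) (simp only: fps_mult_left_const_nth fps_X_power_nth, simp)
  also have "\<dots> = (\<Sum>D | D \<in> Pow {..<2 * n} \<and> odd_size D = n. b_pow (\<Sum>a\<in>D. (- 1) ^ a))"
    by (rule sum.inter_filter[symmetric]) simp
  also have "{D. D \<in> Pow {..<2 * n} \<and> odd_size D = n}
      = {D. D \<in> {D. finite D} \<and> odd_size D = n}"
  proof (intro Set.set_eqI iffI)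
    fix D assume "D \<in> {D. D \<in> {D. finite D} \<and> odd_size D = n}"
    then have D: "finite D" "odd_size D = n" by auto
    have "a < 2 * n" if "a \<in> D" for a
      using member_le_sum[of a D "\<lambda>a. 2 * a + 1"] that D by simp
    then show "D \<in> {D. D \<in> Pow {..<2 * n} \<and> odd_size D = n}" using D by auto
  qed (auto intro: finite_subset)
  finally show "fps_nth (gf {D. finite D} odd_size (\<lambda>D. b_pow (\<Sum>a\<in>D. (- 1) ^ a))) n
     = fps_nth (qpoch_inf ?a1 ?q * qpoch_inf ?a3 ?q) n"
    unfolding gf_def by simp
qed

section \<open>From hook-lengths to runners, and the final formula\<close>

text \<open>The Boolean distinguishes the two mirror images of a runner inversion; both have the
  same difference, \<open>2 u\<close> times the one on the runner.\<close>

lemma hooks_dvd_SC: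
  assumes lam: "lam \<in> SC" and u: "u > 0"
  defines "H \<equiv> Sigma {..<u} (\<lambda>r. inversions (runner u (diag lam) r))"
  shows "hooks_dvd (2 * u) lam
     = image_mset (\<lambda>((r, i, j), b :: bool). 2 * u * nat (i - j)) (mset_set (H \<times> UNIV))"
proof -
  let ?S = "sym_maya (diag lam)" and ?I = "{(x, y). (x, y) \<in> inversions (sym_maya (diag lam)) \<and> int (2 * u) dvd x - y}"
  have part: "is_partition lam" using lam by (simp add: SC_def)
  have fin: "finite (inversions ?S)"
    using maya_of_SC[OF lam] maya_maya_of[OF part] finite_inversions_maya by metis
  have dvd: "2 * u dvd nat (x - y) \<longleftrightarrow> int (2 * u) dvd x - y" if "y < x" for x y :: int
    using that int_dvd_int_iff[of "2 * u" "nat (x - y)"] by simp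
  have "hooks_dvd (2 * u) lam
     = filter_mset (\<lambda>h. 2 * u dvd h) (image_mset (\<lambda>(x, y). nat (x - y)) (mset_set (inversions ?S)))"
    unfolding hooks_dvd_def hooks_eq_inversions[OF part] maya_of_SC[OF lam] ..
  also have "\<dots> = image_mset (\<lambda>(x, y). nat (x - y)) (filter_mset (\<lambda>(x, y). 2 * u dvd nat (x - y)) (mset_set (inversions ?S)))"
    by (simp add: filter_mset_image_mset case_prod_beta')
  also have "filter_mset (\<lambda>(x, y). 2 * u dvd nat (x - y)) (mset_set (inversions ?S)) = mset_set ?I"
  proof -
    have "{p \<in> inversions ?S. (\<lambda>(x, y). 2 * u dvd nat (x - y)) p} = ?I"
      using dvd by (auto simp: inversions_def)
    then show ?thesis by (simp add: filter_mset_mset_set fin)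
  qed
  also have "mset_set ?I = image_mset (runner_pair u) (mset_set (H \<times> UNIV))"
    using runner_pair_bij[OF u, of "diag lam"] unfolding H_def
    by (simp add: bij_betw_def image_mset_mset_set)
  also have "image_mset (\<lambda>(x, y). nat (x - y)) (image_mset (runner_pair u) (mset_set (H \<times> UNIV)))
     = image_mset (\<lambda>((r, i, j), b :: bool). 2 * u * nat (i - j)) (mset_set (H \<times> UNIV))"
    unfolding multiset.map_comp
  proof (rule image_mset_cong)
    fix p :: "(nat \<times> int \<times> int) \<times> bool"
    obtain r i j b where p: "p = ((r, i, j), b)" by (metis surj_pair)
    have "2 * int u * i - 2 * int u * j = int (2 * u) * (i - j)" by (simp add: algebra_simps)
    then have "nat (2 * int u * i - 2 * int u * j) = 2 * u * nat (i - j)"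
      by (simp only: nat_mult_distrib of_nat_0_le_iff nat_int)
    then show "((\<lambda>(x, y). nat (x - y)) \<circ> runner_pair u) p = (\<lambda>((r, i, j), b). 2 * u * nat (i - j)) p"
      unfolding p by (cases b) (simp_all add: runner_pair_def)
  qed
  finally show ?thesis .
qed

text \<open>Each length \<open>h = 2 u (i - j)\<close> occurs once for each Boolean, so
  \<open>s\<close> enters only squared. Since \<open>z / h ^ 2\<close> equals
  \<open>z / (2 u) ^ 2\<close> divided by \<open>(i - j) ^ 2\<close>, the runners carry the
  parameter \<open>z / (2 u) ^ 2\<close>.\<close>

lemma SC_term:
  fixes z :: complex
  assumes lam: "lam \<in> SC" and u: "u > 0"
    and s: "\<And>h. 0 < h \<Longrightarrow> (s h)\<^sup>2 = 1 - z / (of_nat h)\<^sup>2"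
  shows "x_var ^ size (hooks_dvd (2 * u) lam) * b_pow (BG lam)
       * scalar (\<Prod>h\<in>#hooks_dvd (2 * u) lam. s h)
     = (\<Prod>r<u. class_coeff r (x_var ^ 2) (z / (of_nat (2 * u))\<^sup>2) (runner u (diag lam) r))"
proof -
  let ?M = "\<lambda>r. runner u (diag lam) r" and ?z = "z / (of_nat (2 * u))\<^sup>2"
  let ?H = "Sigma {..<u} (\<lambda>r. inversions (?M r))"
  have D: "finite (diag lam)" using diag_bij lam by (auto simp: bij_betw_def)
  have fin: "finite (inversions (?M r))" if "r < u" for r
    by (rule finite_inversions_maya[OF maya_runner[OF D that]])
  then have finH: "finite ?H" by auto
  have "size (hooks_dvd (2 * u) lam) = card (?H \<times> (UNIV :: bool set))"
    unfolding hooks_dvd_SC[OF lam u] by simp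
  also have "\<dots> = 2 * (\<Sum>r<u. card (inversions (?M r)))"
    using fin by (simp add: card_cartesian_product)
  finally have size: "x_var ^ size (hooks_dvd (2 * u) lam) = (\<Prod>r<u. (x_var ^ 2) ^ card (inversions (?M r)))"
    by (simp add: power_sum power_mult)
  have "(\<Prod>h\<in>#hooks_dvd (2 * u) lam. s h) = (\<Prod>p\<in>?H \<times> (UNIV :: bool set). case p of ((r, i, j), b) \<Rightarrow> s (2 * u * nat (i - j)))"
    unfolding hooks_dvd_SC[OF lam u]
    by (simp add: prod_unfold_prod_mset multiset.map_comp o_def case_prod_beta)
  also have "\<dots> = (\<Prod>p\<in>?H. \<Prod>b\<in>(UNIV :: bool set). case p of (r, i, j) \<Rightarrow> s (2 * u * nat (i - j)))"
    by (subst prod.cartesian_product) (simp add: case_prod_beta)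
  also have "\<dots> = (\<Prod>(r, p)\<in>?H. case p of (i, j) \<Rightarrow> (s (2 * u * nat (i - j)))\<^sup>2)"
    by (simp add: case_prod_beta card_UNIV_bool)
  also have "\<dots> = (\<Prod>r<u. \<Prod>(i, j)\<in>inversions (?M r). (s (2 * u * nat (i - j)))\<^sup>2)"
    using fin by (subst prod.Sigma) auto
  also have "\<dots> = (\<Prod>r<u. int_weight ?z (?M r))"
  proof (rule prod.cong[OF refl])
    fix r assume "r \<in> {..<u}"
    show "(\<Prod>(i, j)\<in>inversions (?M r). (s (2 * u * nat (i - j)))\<^sup>2) = int_weight ?z (?M r)"
      unfolding int_weight_def
    proof (rule prod.cong[OF refl], clarify)
      fix i j assume "(i, j) \<in> inversions (?M r)"
      then have ij: "j < i" by (simp add: inversions_def)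
      have "(of_nat (2 * u * nat (i - j)) :: complex) = of_nat (2 * u) * of_int (i - j)"
        using ij by (simp add: of_nat_nat)
      then show "(s (2 * u * nat (i - j)))\<^sup>2 = 1 - ?z / (of_int (i - j))\<^sup>2"
        using s[of "2 * u * nat (i - j)"] ij u by (simp add: power_mult_distrib)
    qed
  qed
  finally have prod: "scalar (\<Prod>h\<in>#hooks_dvd (2 * u) lam. s h) = (\<Prod>r<u. scalar (int_weight ?z (?M r)))"
    by (simp only: scalar_prod)
  have BG: "b_pow (BG lam) = (\<Prod>r<u. b_pow ((- 1) ^ r * charge (?M r)))"
    unfolding SC_BG[OF lam] b_pow_BG_runners[OF D u] by (rule b_pow_sum)
  show ?thesis
    unfolding size prod BG class_coeff_def by (simp only: prod.distrib mult_ac)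
qed

theorem corollary1p4:
  fixes z :: complex and t :: nat and s :: "nat \<Rightarrow> complex"
  assumes "0 < t" and "even t"
    and "\<And>h. 0 < h \<Longrightarrow> (s h)\<^sup>2 = 1 - z / (of_nat h)\<^sup>2"
  shows "((\<lambda>lam. fps_const (x_var ^ size (hooks_dvd t lam) * b_pow (BG lam)
                    * scalar (\<Prod>h\<in>#hooks_dvd t lam. s h)) * fps_X ^ sum_list lam)
    has_sum
      (fps_cpow (qpoch_inf (fps_const (x_var ^ 2) * fps_X ^ (2 * t))
                           (fps_const (x_var ^ 2) * fps_X ^ (2 * t)))
                ((z / of_nat t - of_nat t) / 2)
       * qpoch_inf (fps_X ^ (2 * t)) (fps_X ^ (2 * t)) ^ (t div 2)
       * qpoch_inf (- (fps_const (b_pow 1) * fps_X)) (fps_X ^ 4)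
       * qpoch_inf (- (fps_const (b_pow (-1)) * fps_X ^ 3)) (fps_X ^ 4))) SC"
proof -
  obtain u where t: "t = 2 * u" using assms(2) by auto
  then have u: "u > 0" using assms(1) by simp
  let ?k = "4 * u" and ?z = "z / (of_nat t)\<^sup>2" and ?w = odd_size
  let ?E = "\<lambda>c. fps_exp c oo lambert" and ?T = "\<Prod>r<u. theta u r"
  let ?c = "\<lambda>lam. x_var ^ size (hooks_dvd t lam) * b_pow (BG lam) * scalar (\<Prod>h\<in>#hooks_dvd t lam. s h)"
  let ?G = "qpoch_inf (- (fps_const (b_pow 1) * fps_X)) (fps_X ^ 4)
       * qpoch_inf (- (fps_const (b_pow (-1)) * fps_X ^ 3)) (fps_X ^ 4)"
  have k: "?k > 0" "2 * t = ?k" using u t by auto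
  have w: "?w (diag lam) = sum_list lam" if "lam \<in> SC" for lam
    using SC_size[OF that] by simp
  have graded: "graded SC sum_list"
  proof -
    have "graded SC sum_list \<longleftrightarrow> graded {D. finite D} ?w"
      by (rule graded_bij[OF diag_bij], rule w)
    then show ?thesis using gf_finite_sets(1)[OF u] by blast
  qed
  have "gf SC sum_list ?c
     = gf {D. finite D} ?w (\<lambda>D. \<Prod>r<u. class_coeff r (x_var ^ 2) ?z (runner u D r))"
    by (rule gf_bij[OF diag_bij], rule w, assumption) (simp add: t SC_term[OF _ u assms(3)])
  also have "\<dots> = ?T * fps_subst (x_var ^ 2) ?k (?E (1 - ?z)) ^ u"
    by (rule gf_finite_sets(2)[OF u])
  also have "fps_subst (x_var ^ 2) ?k (?E (1 - ?z)) ^ u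
     = fps_cpow (qpoch_inf (fps_const (x_var ^ 2) * fps_X ^ (2 * t)) (fps_const (x_var ^ 2) * fps_X ^ (2 * t)))
                ((z / of_nat t - of_nat t) / 2)"
  proof -
    have "?E (1 - ?z) ^ u = ?E (of_nat u * (1 - ?z))"
      by (simp add: fps_compose_power[OF lambert_0] fps_exp_power_mult)
    \<comment> \<open>With \<open>t = 2 u\<close> this is \<open>t / 2 - z / (2 t)\<close>; the sign
      is absorbed by \<open>lambert\<close> being minus the logarithm of
      \<open>euler\<close>.\<close>
    also have "of_nat u * (1 - ?z) = - ((z / of_nat t - of_nat t) / 2)"
      using u unfolding t by (simp add: field_simps power2_eq_square)
    finally show ?thesis
      unfolding k(2) fps_cpow_qpoch[OF k(1)] fps_subst_power[OF k(1), symmetric] by (rule arg_cong)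
  qed
  finally have main: "gf SC sum_list ?c = ?T * fps_cpow (qpoch_inf (fps_const (x_var ^ 2) * fps_X ^ (2 * t))
      (fps_const (x_var ^ 2) * fps_X ^ (2 * t))) ((z / of_nat t - of_nat t) / 2)" .
  \<comment> \<open>At \<open>v = 1\<close>, \<open>z = 0\<close> every runner weight is 1 and only
    the powers of \<open>b\<close> survive, so the left side is the product in
    \<open>gf_strict_odd\<close>.\<close>
  have "?G = ?T * fps_subst 1 ?k (?E 1) ^ u"
  proof -
    have "?G = gf {D. finite D} ?w (\<lambda>D. \<Prod>r<u. class_coeff r 1 0 (runner u D r))"
      unfolding gf_strict_odd[symmetric]
      by (rule gf_bij[OF bij_betw_id]) (simp_all add: b_pow_BG_runners[OF _ u] b_pow_sum class_coeff_def int_weight_def)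
    then show ?thesis using gf_finite_sets(2)[OF u, of 1 0] by simp
  qed
  moreover have "qpoch_inf (fps_X ^ (2 * t)) (fps_X ^ (2 * t)) = fps_subst 1 ?k euler"
    using qpoch_inf_eq_subst[OF k(1), of 1] by (simp add: k(2))
  \<comment> \<open>\<open>?E 1\<close> is the inverse of \<open>euler\<close>, so the previous
    equation can be solved for \<open>?T\<close>.\<close>
  moreover have "fps_subst 1 ?k euler ^ u * fps_subst 1 ?k (?E 1) ^ u = 1"
    by (simp only: power_mult_distrib[symmetric] fps_subst_mult[OF k(1), symmetric] euler_exp
        fps_subst_1[OF k(1)] power_one)
  moreover have "t div 2 = u" using t by simp
  ultimately have T: "qpoch_inf (fps_X ^ (2 * t)) (fps_X ^ (2 * t)) ^ (t div 2) * ?G = ?T"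
    by (simp only: mult.left_commute[of _ ?T] mult_1_right)
  show ?thesis
    using gf_has_sum[OF graded, of ?c] unfolding main T[symmetric] by (simp only: mult_ac)
qed

end
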